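(* Let $T>16$, $H>0$ and $\varepsilon, C>0$. Then $$\int_T^{T+H} |\zeta(\sigma+it)|\,dt \gg \min\left(H^{2+\varepsilon},H\right)$$ for all real $\sigma$ with $\sigma \geq 1-CH(\log \log T)^{-1-\varepsilon}$, where the implied constant depends only on $\varepsilon$ and $C$ (not on $T$, $H$ or $\sigma$).
   Context: $\zeta$ denotes the Riemann zeta-function. *)

theory Defs
  imports "HOL-Complex_Analysis.Complex_Analysis"
begin

text \<open>
  The Riemann zeta function, as the analytic continuation to the punctured plane of the Dirichlet
  series on the half-plane \<open>Re s > 1\<close>. The value at the pole \<open>s = 1\<close> is left unspecified.
\<close>

definition is_zeta :: "(complex \<Rightarrow> complex) \<Rightarrow> bool" where
  "is_zeta f \<longleftrightarrow> f holomorphic_on (- {1}) \<and>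
     (\<forall>s. Re s > 1 \<longrightarrow> (\<lambda>n. 1 / of_nat (Suc n) powr s) sums f s)"

definition zeta :: "complex \<Rightarrow> complex" where
  "zeta = (SOME f. is_zeta f)"

lemma is_zeta_unique:
  assumes "is_zeta f" "is_zeta g" "s \<noteq> 1"
  shows "f s = g s"
proof (rule analytic_continuation_open[where f = f and g = g and z = s and s = "{s. Re s > 1}" and s' = "- {1}"])
  show "open {s. Re s > 1}" by (rule open_halfspace_Re_gt)
  have "(2::complex) \<in> {s. Re s > 1}" by simp
  then show "{s. Re s > 1} \<noteq> {}" by blast
  show "connected (- {1::complex})"
    by (rule connected_punctured_universe) simp
  show "f z = g z" if "z \<in> {s. Re s > 1}" for z
    using assms that unfolding is_zeta_def by (blast intro: sums_unique2)
qed (use assms in \<open>auto simp: is_zeta_def\<close>)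

lemma holomorphic_series:
  fixes f :: "nat \<Rightarrow> complex \<Rightarrow> complex"
  assumes A: "open A" and hol: "\<And>n. f n holomorphic_on A"
    and bd: "\<And>x. x \<in> A \<Longrightarrow> \<exists>d>0. cball x d \<subseteq> A \<and>
          (\<exists>M. summable M \<and> (\<forall>n\<ge>1. \<forall>z\<in>cball x d. cmod (f n z) \<le> M n))"
  shows "(\<lambda>z. \<Sum>n. f n z) holomorphic_on A" "\<And>z. z \<in> A \<Longrightarrow> summable (\<lambda>n. f n z)"
proof -
  show "(\<lambda>z. \<Sum>n. f n z) holomorphic_on A"
  proof (rule holomorphic_uniform_sequence[OF A, where f = "\<lambda>N z. \<Sum>n<N. f n z"])
    show "(\<lambda>z. \<Sum>n<N. f n z) holomorphic_on A" for N
      using hol by (intro holomorphic_intros)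
    fix x assume "x \<in> A"
    from bd[OF this] obtain d M where d: "d > 0" "cball x d \<subseteq> A" and M: "summable M"
      "\<And>n z. n \<ge> 1 \<Longrightarrow> z \<in> cball x d \<Longrightarrow> cmod (f n z) \<le> M n" by blast
    have "uniform_limit (cball x d) (\<lambda>N z. \<Sum>n<N. f n z) (\<lambda>z. \<Sum>n. f n z) sequentially"
      by (rule Weierstrass_m_test_ev[OF _ M(1)])
         (use M(2) in \<open>auto simp: eventually_at_top_linorder intro!: exI[of _ 1]\<close>)
    with d show "\<exists>d>0. cball x d \<subseteq> A \<and>
        uniform_limit (cball x d) (\<lambda>N z. \<Sum>n<N. f n z) (\<lambda>z. \<Sum>n. f n z) sequentially" by blast
  qed
  fix z assume "z \<in> A"
  from bd[OF this] obtain d M where d: "d > 0" "cball z d \<subseteq> A" and M: "summable M"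
    "\<And>n x. n \<ge> 1 \<Longrightarrow> x \<in> cball z d \<Longrightarrow> cmod (f n x) \<le> M n" by blast
  show "summable (\<lambda>n. f n z)"
    by (rule summable_comparison_test[OF _ M(1)]) (use M(2)[of _ z] d in \<open>auto intro!: exI[of _ 1]\<close>)
qed

lemma cball_in_halfplane:
  fixes x :: complex
  assumes "Re x > a"
  obtains d \<sigma> r where "d > 0" "cball x d \<subseteq> {s. Re s > a}" "\<sigma> > a" "r > 0"
    "\<And>z. z \<in> cball x d \<Longrightarrow> Re z \<ge> \<sigma>" "\<And>z. z \<in> cball x d \<Longrightarrow> cmod (1 - z) \<le> r"
proof -
  define d where "d = (Re x - a) / 2"
  have d: "d > 0" using assms by (simp add: d_def)
  have 1: "Re z \<ge> (a + Re x) / 2" if "z \<in> cball x d" for z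
  proof -
    have "Re x - Re z \<le> cmod (x - z)" using complex_Re_le_cmod[of "x - z"] by simp
    also have "\<dots> \<le> d" using that by (simp add: dist_norm)
    finally show ?thesis by (simp add: d_def field_simps)
  qed
  have 2: "cmod (1 - z) \<le> cmod (1 - x) + d" if "z \<in> cball x d" for z
  proof -
    have "cmod (1 - z) \<le> cmod (1 - x) + cmod (x - z)"
      using norm_triangle_ineq[of "1 - x" "x - z"] by simp
    also have "\<dots> \<le> cmod (1 - x) + d" using that by (simp add: dist_norm)
    finally show ?thesis .
  qed
  have gt: "(a + Re x) / 2 > a" using assms by simp
  show ?thesis
  proof (rule that[of d "(a + Re x) / 2" "cmod (1 - x) + d"])
    show "cball x d \<subseteq> {s. Re s > a}" using 1 gt by force
    show "cmod (1 - x) + d > 0" using d by (simp add: add_nonneg_pos)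
  qed (use d 1 2 gt in auto)
qed

lemma norm_gbinomial_le:
  fixes a :: complex
  assumes "cmod a \<le> r"
  shows "cmod (a gchoose k) \<le> (-1) ^ k * ((- r) gchoose k)"
proof -
  have "cmod (pochhammer (- a) k) \<le> pochhammer r k"
  proof -
    have "cmod (- a + of_nat i) \<le> r + of_nat i" for i
      using norm_triangle_ineq[of "- a" "of_nat i"] assms by simp
    then show ?thesis unfolding pochhammer_prod prod_norm [symmetric]
      by (intro prod_mono) auto
  qed
  then show ?thesis
    by (simp add: gbinomial_pochhammer norm_mult norm_divide norm_power divide_right_mono
        mult.assoc [symmetric] power_add [symmetric] flip: mult_2)
qed

lemma binomial_remainder:
  fixes a :: complex and x :: real
  assumes a: "cmod a \<le> r" and x: "0 < x" "x \<le> 1/2"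
  shows "cmod ((1 + of_real x) powr a - (\<Sum>k\<le>K. (a gchoose k) * of_real x ^ k))
           \<le> 2 powr r * (2 * x) ^ Suc K"
proof -
  define g where "g = (\<lambda>k. ((- r) gchoose k) * (- (1/2)) ^ k)"
  have g: "g sums (2 powr r)"
    using gen_binomial_real[of "- (1/2)" "- r"]
    by (simp add: g_def powr_minus powr_divide)
  have s: "(\<lambda>k. (a gchoose k) * of_real x ^ k) sums ((1 + of_real x) powr a)"
    by (rule gen_binomial_complex) (use x in simp)
  have bd: "cmod ((a gchoose k) * of_real x ^ k) \<le> g k * (2 * x) ^ k" for k
  proof -
    have "cmod ((a gchoose k) * of_real x ^ k) = cmod (a gchoose k) * x ^ k"
      using x by (simp add: norm_mult norm_power)
    also have "\<dots> \<le> ((-1) ^ k * ((- r) gchoose k)) * x ^ k"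
      by (intro mult_right_mono norm_gbinomial_le a) (use x in simp)
    also have "\<dots> = g k * (2 * x) ^ k"
      by (simp add: g_def power_mult_distrib power_divide power_minus [of "1/2 :: real"])
    finally show ?thesis .
  qed
  have g0: "g k \<ge> 0" for k
  proof -
    have "0 \<le> (-1) ^ k * ((- r) gchoose k)"
      using norm_gbinomial_le[OF a, of k] norm_ge_zero[of "a gchoose k"] by linarith
    then have "0 \<le> ((-1) ^ k * ((- r) gchoose k)) * (1/2)^k" by (rule mult_nonneg_nonneg) simp
    also have "\<dots> = g k" by (simp add: g_def power_minus [of "1/2 :: real"])
    finally show ?thesis .
  qed
  have t: "(\<lambda>k. (a gchoose (k + Suc K)) * of_real x ^ (k + Suc K)) sums
        ((1 + of_real x) powr a - (\<Sum>k\<le>K. (a gchoose k) * of_real x ^ k))"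
    using sums_split_initial_segment[OF s, of "Suc K"] by (simp only: lessThan_Suc_atMost)
  have g': "(\<lambda>k. g (k + Suc K) * (2 * x) ^ Suc K) sums
        ((2 powr r - (\<Sum>k<Suc K. g k)) * (2 * x) ^ Suc K)"
    by (intro sums_mult2 sums_split_initial_segment g)
  have b': "cmod ((a gchoose (k + Suc K)) * of_real x ^ (k + Suc K))
              \<le> g (k + Suc K) * (2 * x) ^ Suc K" for k
  proof -
    have "(2 * x) ^ (k + Suc K) \<le> (2 * x) ^ Suc K"
      by (rule power_decreasing) (use x in auto)
    then show ?thesis using bd[of "k + Suc K"] g0[of "k + Suc K"]
      by (meson mult_left_mono order_trans)
  qed
  have "cmod ((1 + of_real x) powr a - (\<Sum>k\<le>K. (a gchoose k) * of_real x ^ k))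
      \<le> (2 powr r - (\<Sum>k<Suc K. g k)) * (2 * x) ^ Suc K"
    by (rule norm_sums_le[OF t g' b'])
  also have "\<dots> \<le> 2 powr r * (2 * x) ^ Suc K"
    by (intro mult_right_mono) (use x g0 sum_nonneg[of "{..<Suc K}" g] in auto)
  finally show ?thesis .
qed

lemma summable_powr_Suc:
  assumes "e < -1"
  shows "summable (\<lambda>n. real (Suc n) powr e)"
  using assms by (subst summable_Suc_iff) (simp add: summable_real_powr_iff)

lemma dirichlet_bound:
  "cmod (1 / of_nat (Suc n) powr s) = real (Suc n) powr (- Re s)"
  by (simp add: norm_divide norm_powr_real_powr powr_minus field_simps del: of_nat_Suc)

lemma dirichlet_series:
  shows "(\<lambda>s. \<Sum>n. 1 / of_nat (Suc n) powr s) holomorphic_on {s. Re s > 1}"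
    and "\<And>s. Re s > 1 \<Longrightarrow> summable (\<lambda>n. 1 / of_nat (Suc n) powr s)"
proof -
  have bd: "\<exists>d>0. cball x d \<subseteq> {s. Re s > 1} \<and> (\<exists>M. summable M \<and>
      (\<forall>n\<ge>1. \<forall>z\<in>cball x d. cmod (1 / of_nat (Suc n) powr z) \<le> M n))"
    if "x \<in> {s. Re s > 1}" for x
  proof -
    from that have "Re x > 1" by simp
    then obtain d \<sigma> r where d: "d > 0" "cball x d \<subseteq> {s. Re s > 1}" "\<sigma> > 1" "r > 0"
      "\<And>z. z \<in> cball x d \<Longrightarrow> Re z \<ge> \<sigma>" "\<And>z. z \<in> cball x d \<Longrightarrow> cmod (1 - z) \<le> r"
      by (rule cball_in_halfplane) blast
    have "summable (\<lambda>n. real (Suc n) powr (-\<sigma>))" by (rule summable_powr_Suc) (use d in simp)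
    moreover have "cmod (1 / of_nat (Suc n) powr z) \<le> real (Suc n) powr (-\<sigma>)"
      if "z \<in> cball x d" for n z
      unfolding dirichlet_bound by (rule powr_mono) (use d(5)[OF that] in auto)
    ultimately show ?thesis using d(1,2) by blast
  qed
  have hol: "(\<lambda>s. 1 / of_nat (Suc n) powr s) holomorphic_on {s. Re s > 1}" for n
    by (intro holomorphic_intros) (auto simp del: of_nat_Suc)
  show "(\<lambda>s. \<Sum>n. 1 / of_nat (Suc n) powr s) holomorphic_on {s. Re s > 1}"
    by (rule holomorphic_series(1)[OF open_halfspace_Re_gt hol bd])
  show "summable (\<lambda>n. 1 / of_nat (Suc n) powr s)" if "Re s > 1" for s
    by (rule holomorphic_series(2)[OF open_halfspace_Re_gt hol bd]) (use that in auto)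
qed

definition zeta_rem :: "nat \<Rightarrow> nat \<Rightarrow> complex \<Rightarrow> complex" where
  "zeta_rem K n s = of_nat (Suc (Suc n)) powr (1 - s) -
     (\<Sum>k\<le>K. ((1 - s) gchoose k) * of_nat (Suc n) powr (1 - s - of_nat k))"

lemma zeta_rem_bound:
  assumes r: "cmod (1 - s) \<le> r" and \<sigma>: "Re s \<ge> \<sigma>" and n: "n \<ge> 1"
  shows "cmod (zeta_rem K n s) \<le> 2 powr r * 2 ^ Suc K * real (Suc n) powr (- \<sigma> - real K)"
proof -
  define N where "N = real (Suc n)"
  have N: "N \<ge> 2" using n by (simp add: N_def)
  have e1: "of_nat (Suc (Suc n)) powr (1 - s) =
      of_real N powr (1 - s) * (1 + of_real (1/N)) powr (1 - s)"
  proof -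
    have "of_nat (Suc (Suc n)) = complex_of_real (N * (1 + 1/N))"
    proof -
      have "N * (1 + 1/N) = N + 1" using N by (simp add: field_simps)
      then have "N * (1 + 1/N) = real (Suc (Suc n))" by (simp add: N_def)
      then show ?thesis by (simp only: of_real_of_nat_eq)
    qed
    also have "\<dots> powr (1 - s) = of_real N powr (1 - s) * of_real (1 + 1/N) powr (1 - s)"
      unfolding of_real_mult by (rule powr_times_real) (use N in auto)
    finally show ?thesis by simp
  qed
  have e2: "of_nat (Suc n) powr (1 - s - of_nat k) =
      of_real N powr (1 - s) * of_real (1/N) ^ k" for k
  proof -
    have "of_nat (Suc n) = complex_of_real N" by (simp add: N_def)
    moreover have "complex_of_real N powr (1 - s - of_nat k) =
        of_real N powr (1 - s) / of_real N ^ k"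
      using N by (simp add: powr_diff powr_nat')
    ultimately show ?thesis by (simp add: power_divide)
  qed
  have "zeta_rem K n s = of_real N powr (1 - s) *
      ((1 + of_real (1/N)) powr (1 - s) - (\<Sum>k\<le>K. ((1 - s) gchoose k) * of_real (1/N) ^ k))"
    unfolding zeta_rem_def e1 e2 right_diff_distrib sum_distrib_left by (simp add: mult_ac)
  also have "cmod \<dots> = N powr (1 - Re s) *
      cmod ((1 + of_real (1/N)) powr (1 - s) - (\<Sum>k\<le>K. ((1 - s) gchoose k) * of_real (1/N) ^ k))"
    using N by (simp add: norm_mult norm_powr_real_powr)
  also have "\<dots> \<le> N powr (1 - \<sigma>) * (2 powr r * (2 * (1/N)) ^ Suc K)"
    by (intro mult_mono binomial_remainder powr_mono r) (use N \<sigma> in auto)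
  also have "\<dots> = 2 powr r * 2 ^ Suc K * (N powr (1 - \<sigma>) / N ^ Suc K)"
    by (simp add: power_divide)
  also have "N powr (1 - \<sigma>) / N ^ Suc K = N powr (- \<sigma> - real K)"
  proof -
    have "N ^ Suc K = N powr real (Suc K)" using N by (subst powr_realpow) auto
    then show ?thesis by (simp add: powr_diff [symmetric])
  qed
  finally show ?thesis by (simp add: N_def)
qed

lemma zeta_rem_holomorphic [holomorphic_intros]: "zeta_rem K n holomorphic_on A"
  unfolding zeta_rem_def gbinomial_prod_rev
  by (intro holomorphic_intros) (auto simp del: of_nat_Suc)

lemma zeta_rem_series:
  shows "(\<lambda>s. \<Sum>n. zeta_rem (Suc m) n s) holomorphic_on {s. Re s > - real m}"
    and "\<And>s. Re s > - real m \<Longrightarrow> summable (\<lambda>n. zeta_rem (Suc m) n s)"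
proof -
  have bd: "\<exists>d>0. cball x d \<subseteq> {s. Re s > - real m} \<and> (\<exists>M. summable M \<and>
      (\<forall>n\<ge>1. \<forall>z\<in>cball x d. cmod (zeta_rem (Suc m) n z) \<le> M n))"
    if "x \<in> {s. Re s > - real m}" for x
  proof -
    from that have "Re x > - real m" by simp
    then obtain d \<sigma> r where d: "d > 0" "cball x d \<subseteq> {s. Re s > - real m}" "\<sigma> > - real m" "r > 0"
      "\<And>z. z \<in> cball x d \<Longrightarrow> Re z \<ge> \<sigma>" "\<And>z. z \<in> cball x d \<Longrightarrow> cmod (1 - z) \<le> r"
      by (rule cball_in_halfplane) blast
    have "summable (\<lambda>n. 2 powr r * 2 ^ Suc (Suc m) * real (Suc n) powr (- \<sigma> - real (Suc m)))"
      by (intro summable_mult summable_powr_Suc) (use d in simp)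
    then show ?thesis using d zeta_rem_bound by blast
  qed
  show "(\<lambda>s. \<Sum>n. zeta_rem (Suc m) n s) holomorphic_on {s. Re s > - real m}"
    by (rule holomorphic_series(1)[OF open_halfspace_Re_gt zeta_rem_holomorphic bd])
  show "summable (\<lambda>n. zeta_rem (Suc m) n s)" if "Re s > - real m" for s
    by (rule holomorphic_series(2)[OF open_halfspace_Re_gt zeta_rem_holomorphic bd]) (use that in auto)
qed

text \<open>
  Summing the binomial expansion of \<open>(n + 1) powr (1 - s) - n powr (1 - s)\<close> over \<open>n\<close> expresses
  \<open>(s - 1) * \<zeta>(s)\<close> through its values further to the right.
\<close>

lemma zeta_recurrence:
  fixes s :: complex
  defines "D \<equiv> (\<lambda>s. \<Sum>n. 1 / of_nat (Suc n) powr s)"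
  assumes s: "Re s > 1"
  shows "(s - 1) * D s = 1 + (\<Sum>n. zeta_rem (Suc m) n s) -
    (\<Sum>j\<in>{1..m}. ((1 - s) gchoose j) / of_nat (Suc j) * ((s + of_nat j - 1) * D (s + of_nat j)))"
proof -
  have D: "(\<lambda>n. of_nat (Suc n) powr (- s)) sums D s" if "Re s > 1" for s
    using summable_sums[OF dirichlet_series(2)[OF that]]
    by (simp add: D_def powr_minus field_simps del: of_nat_Suc)
  have "(\<lambda>n. complex_of_real (real (Suc n)) powr (1 - s)) \<longlonglongrightarrow> 0"
  proof (rule tendsto_norm_zero_cancel)
    have "(\<lambda>n. real (Suc n) powr (1 - Re s)) \<longlonglongrightarrow> 0"
      by (rule LIMSEQ_Suc, rule tendsto_neg_powr)
         (use s in \<open>auto intro: filterlim_real_sequentially\<close>)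
    then show "(\<lambda>n. cmod (complex_of_real (real (Suc n)) powr (1 - s))) \<longlonglongrightarrow> 0"
      by (simp add: norm_powr_real_powr del: of_nat_Suc)
  qed
  then have "(\<lambda>n. of_nat (Suc (Suc n)) powr (1 - s) - of_nat (Suc n) powr (1 - s)) sums
      (0 - of_nat (Suc 0) powr (1 - s) :: complex)"
    using telescope_sums[of "\<lambda>n. of_nat (Suc n) powr (1 - s) :: complex" 0]
    by (simp del: of_nat_Suc)
  then have t: "(\<lambda>n. of_nat (Suc (Suc n)) powr (1 - s) - of_nat (Suc n) powr (1 - s)) sums (-1 :: complex)"
    by simp
  have R: "(\<lambda>n. zeta_rem (Suc m) n s) sums (\<Sum>n. zeta_rem (Suc m) n s)"
    by (rule summable_sums, rule zeta_rem_series(2)) (use s in linarith)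
  have S: "(\<lambda>n. \<Sum>j\<le>m. ((1 - s) gchoose Suc j) * of_nat (Suc n) powr (- (s + of_nat j))) sums
      (\<Sum>j\<le>m. ((1 - s) gchoose Suc j) * D (s + of_nat j))"
    by (intro sums_sum sums_mult D) (use s in auto)
  have "of_nat (Suc (Suc n)) powr (1 - s) - of_nat (Suc n) powr (1 - s) =
      zeta_rem (Suc m) n s +
      (\<Sum>j\<le>m. ((1 - s) gchoose Suc j) * of_nat (Suc n) powr (- (s + of_nat j)))" for n
    unfolding zeta_rem_def by (subst sum.atMost_Suc_shift) (simp add: algebra_simps)
  with t sums_add[OF R S] have "-1 = (\<Sum>n. zeta_rem (Suc m) n s) +
      (\<Sum>j\<le>m. ((1 - s) gchoose Suc j) * D (s + of_nat j))"
    by (simp add: sums_unique2)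
  also have "(\<Sum>j\<le>m. ((1 - s) gchoose Suc j) * D (s + of_nat j)) =
      (1 - s) * D s + (\<Sum>j\<in>{1..m}. ((1 - s) gchoose Suc j) * D (s + of_nat j))"
    unfolding atMost_atLeast0 by (subst sum.atLeast_Suc_atMost) auto
  also have "(\<Sum>j\<in>{1..m}. ((1 - s) gchoose Suc j) * D (s + of_nat j)) =
      - (\<Sum>j\<in>{1..m}. ((1 - s) gchoose j) / of_nat (Suc j) * ((s + of_nat j - 1) * D (s + of_nat j)))"
  proof -
    have "((1 - s) gchoose Suc j) = - (((1 - s) gchoose j) / of_nat (Suc j) * (s + of_nat j - 1))" for j
      by (simp add: gbinomial_prod_rev field_simps del: of_nat_Suc)
    then show ?thesis by (simp add: sum_negf mult.assoc del: of_nat_Suc)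
  qed
  finally show ?thesis by (simp add: algebra_simps del: of_nat_Suc)
qed

lemma zeta_continuation_halfplane:
  "\<exists>Z. Z holomorphic_on {s. Re s > 1 - real m} \<and>
     (\<forall>s. Re s > 1 \<longrightarrow> Z s = (s - 1) * (\<Sum>n. 1 / of_nat (Suc n) powr s))"
proof (induction m)
  case 0
  have "(\<lambda>s. (s - 1) * (\<Sum>n. 1 / of_nat (Suc n) powr s)) holomorphic_on {s. Re s > 1}"
    by (intro holomorphic_intros dirichlet_series)
  then show ?case by (intro exI[of _ "\<lambda>s. (s - 1) * (\<Sum>n. 1 / of_nat (Suc n) powr s)"]) simp
next
  case (Suc m)
  then obtain Z where Z: "Z holomorphic_on {s. Re s > 1 - real m}"
    "\<And>s. Re s > 1 \<Longrightarrow> Z s = (s - 1) * (\<Sum>n. 1 / of_nat (Suc n) powr s)" by blast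
  define Z' where "Z' = (\<lambda>s. 1 + (\<Sum>n. zeta_rem (Suc m) n s) -
    (\<Sum>j\<in>{1..m}. ((1 - s) gchoose j) / of_nat (Suc j) * Z (s + of_nat j)))"
  have Zj: "(\<lambda>s. Z (s + of_nat j)) holomorphic_on {s. Re s > - real m}" if "j \<in> {1..m}" for j
    using holomorphic_on_compose_gen[of "\<lambda>s. s + of_nat j" "{s. Re s > - real m}" Z
        "{s. Re s > 1 - real m}"] Z(1) that
    by (force simp: o_def intro!: holomorphic_intros)
  have "Z' holomorphic_on {s. Re s > - real m}"
    unfolding Z'_def gbinomial_prod_rev
    by (intro holomorphic_intros zeta_rem_series Zj) (auto simp del: of_nat_Suc)
  moreover have "Z' s = (s - 1) * (\<Sum>n. 1 / of_nat (Suc n) powr s)" if "Re s > 1" for s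
    unfolding zeta_recurrence[OF that, of m] Z'_def using that
    by (simp add: Z(2) del: of_nat_Suc)
  ultimately show ?case by (intro exI[of _ Z']) simp
qed

theorem is_zeta_zeta: "is_zeta zeta"
proof -
  define P where "P = (\<lambda>m Z. Z holomorphic_on {s. Re s > 1 - real m} \<and>
     (\<forall>s. Re s > 1 \<longrightarrow> Z s = (s - 1) * (\<Sum>n. 1 / of_nat (Suc n) powr s)))"
  obtain Z where Z: "\<And>m. P m (Z m)"
    using zeta_continuation_halfplane unfolding P_def by metis
  have eq: "Z m s = Z k s" if "m \<le> k" "Re s > 1 - real m" for m k s
  proof (rule analytic_continuation_open[where f = "Z m" and g = "Z k" and z = s and
        s = "{s. Re s > 1}" and s' = "{s. Re s > 1 - real m}"])
    have "(2::complex) \<in> {s. Re s > 1}" by simp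
    then show "{s. Re s > 1} \<noteq> {}" by blast
    show "connected {s. Re s > 1 - real m}"
      by (intro convex_connected convex_halfspace_Re_gt)
    show "Z k holomorphic_on {s. Re s > 1 - real m}"
      by (rule holomorphic_on_subset[of _ "{s. Re s > 1 - real k}"])
         (use Z[of k] that in \<open>auto simp: P_def\<close>)
  qed (use Z that in \<open>auto simp: P_def open_halfspace_Re_gt\<close>)
  define k where "k = (\<lambda>s::complex. nat \<lceil>2 - Re s\<rceil>)"
  have k: "Re s > 1 - real (k s)" for s unfolding k_def by linarith
  define W where "W = (\<lambda>s. Z (k s) s)"
  have W: "W s = Z m s" if "Re s > 1 - real m" for m s
    using eq[of m "k s" s] eq[of "k s" m s] that k[of s] unfolding W_def by (metis nle_le)
  have Whol: "W holomorphic_on UNIV"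
  proof -
    have "W field_differentiable (at s)" for s
    proof -
      have "Z (k s) holomorphic_on {z. Re z > 1 - real (k s)}" using Z by (simp add: P_def)
      then have "W holomorphic_on {z. Re z > 1 - real (k s)}"
        by (rule holomorphic_transform) (simp add: W)
      then show ?thesis
        by (rule holomorphic_on_imp_differentiable_at) (use k in \<open>auto simp: open_halfspace_Re_gt\<close>)
    qed
    then show ?thesis by (auto simp: holomorphic_on_def field_differentiable_at_within)
  qed
  have "is_zeta (\<lambda>s. W s / (s - 1))"
    unfolding is_zeta_def
  proof (intro conjI allI impI)
    show "(\<lambda>s. W s / (s - 1)) holomorphic_on - {1}"
      by (intro holomorphic_intros holomorphic_on_subset[OF Whol]) auto
    fix s assume s: "Re s > 1"
    have "W s = (s - 1) * (\<Sum>n. 1 / of_nat (Suc n) powr s)"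
      using W[of 0 s] Z[of 0] s by (simp add: P_def)
    moreover from s have "s \<noteq> 1" by auto
    ultimately have "W s / (s - 1) = (\<Sum>n. 1 / of_nat (Suc n) powr s)" by simp
    then show "(\<lambda>n. 1 / of_nat (Suc n) powr s) sums (W s / (s - 1))"
      using dirichlet_series(2)[OF s] by (simp add: summable_sums del: of_nat_Suc)
  qed
  then show ?thesis unfolding zeta_def by (rule someI[of is_zeta])
qed

end

theory Submission
  imports Defs
begin

text \<open>
  For \<open>Re s > 1\<close> the Euler product gives \<open>\<bar>\<zeta>(s)\<bar> \<ge> (Re s - 1) / Re s\<close>. Cauchy's formula at a point
  \<open>\<eta> H\<close> to the right of the line 1, applied to \<open>\<zeta>\<close> times a damping factor, transfers this bound to the
  mean of \<open>\<bar>\<zeta>\<bar>\<close> over a segment of length \<open>H\<close> on the line \<open>Re s = \<sigma>\<close>. On most of the contour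
  \<open>\<bar>\<zeta>(s)\<bar> \<le> 1 + 1 / (Re s - 1)\<close> suffices; only near \<open>Re s = \<sigma>\<close> does the height \<open>T\<close> enter, through a
  polynomial bound. There the contour runs along a neck of width about \<open>H / ln (ln T)\<close>, in which a damping
  factor of the form \<open>exp (- cos)\<close> decays doubly exponentially and absorbs any power of \<open>T\<close>. This needs
  \<open>1 - \<sigma>\<close> to be at most a small multiple of \<open>H / ln (ln T)\<close>, which holds when \<open>T\<close> or \<open>H\<close> is large; the
  remaining range is compact, and there at most simple zeros on \<open>Re s = 1\<close> matter. Finally, the functional
  equation reduces \<open>\<sigma> < 1/2\<close> to \<open>1 - \<sigma>\<close>.
\<close>

section \<open>The zeta function to the right of the line 1\<close>

lemma zeta_holomorphic: "zeta holomorphic_on (- {1})"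
  using is_zeta_zeta by (simp add: is_zeta_def)

lemma zeta_holomorphic_on [holomorphic_intros]: "1 \<notin> A \<Longrightarrow> zeta holomorphic_on A"
  by (rule holomorphic_on_subset[OF zeta_holomorphic]) auto

lemma zeta_sums:
  assumes "Re s > 1"
  shows "(\<lambda>n. of_nat (Suc n) powr (- s)) sums zeta s"
  using is_zeta_zeta assms by (simp add: is_zeta_def powr_minus divide_inverse del: of_nat_Suc)

lemma zeta_of_real_sums:
  assumes "x > 1"
  shows "(\<lambda>n. real (Suc n) powr (- x)) sums Re (zeta (of_real x))"
    and "zeta (of_real x) = of_real (Re (zeta (of_real x)))"
proof -
  have eq: "of_nat (Suc n) powr (- complex_of_real x) = of_real (real (Suc n) powr (- x))" for n
    by (simp flip: powr_of_real del: of_nat_Suc)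
  have "summable (\<lambda>n. real (Suc n) powr (- x))"
    using assms by (intro summable_powr_Suc) simp
  then have 1: "(\<lambda>n. real (Suc n) powr (- x)) sums (\<Sum>n. real (Suc n) powr (- x))"
    by (rule summable_sums)
  have 2: "(\<lambda>n. complex_of_real (real (Suc n) powr (- x))) sums zeta (of_real x)"
    using zeta_sums[of "of_real x"] assms unfolding eq by simp
  from sums_unique2[OF 2 sums_of_real[OF 1]]
  have 3: "zeta (of_real x) = of_real (\<Sum>n. real (Suc n) powr (- x))" .
  show "(\<lambda>n. real (Suc n) powr (- x)) sums Re (zeta (of_real x))" using 1 3 by simp
  show "zeta (of_real x) = of_real (Re (zeta (of_real x)))" using 3 by simp
qed

lemma norm_zeta_le_zeta_Re:
  assumes "Re s > 1"
  shows "cmod (zeta s) \<le> Re (zeta (of_real (Re s)))"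
proof -
  have "cmod (of_nat (Suc n) powr (- s)) \<le> real (Suc n) powr (- Re s)" for n
    by (simp add: norm_powr_real_powr del: of_nat_Suc)
  then show ?thesis
    using norm_sums_le[OF zeta_sums[OF assms] zeta_of_real_sums(1)[OF assms]] by blast
qed

text \<open>The right-hand side is the integral of \<open>u powr (- x)\<close> over
  \<open>{a..a + 1}\<close>. Summed over \<open>a\<close> it telescopes, which is the integral test
  for the upper bound of zeta.\<close>

lemma powr_diff_ge:
  fixes a x :: real
  assumes "x > 1" "a > 0"
  shows "(a + 1) powr (- x) \<le> (a powr (1 - x) - (a + 1) powr (1 - x)) / (x - 1)"
proof -
  have "\<exists>z>a. z < a + 1 \<and> (\<lambda>u. u powr (1 - x)) (a + 1) - (\<lambda>u. u powr (1 - x)) a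
      = (a + 1 - a) * ((1 - x) * z powr (- x))"
  proof (rule MVT2)
    fix u assume "a \<le> u" "u \<le> a + 1"
    then show "((\<lambda>u. u powr (1 - x)) has_real_derivative (1 - x) * u powr - x) (at u)"
      using assms by (auto intro!: derivative_eq_intros)
  qed simp
  then obtain z where z: "z > a" "z < a + 1"
    "(a + 1) powr (1 - x) - a powr (1 - x) = (1 - x) * z powr (- x)" by auto
  have "(a + 1) powr (- x) \<le> z powr (- x)"
    using z assms by (intro powr_mono2') auto
  also have "\<dots> = (a powr (1 - x) - (a + 1) powr (1 - x)) / (x - 1)"
    using z assms by (simp add: field_simps)
  finally show ?thesis .
qed

lemma zeta_real_le:
  assumes "x > 1"
  shows "Re (zeta (of_real x)) \<le> 1 + 1 / (x - 1)"
proof -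
  have "(\<lambda>n. real (Suc n) powr (1 - x)) \<longlonglongrightarrow> 0"
    by (rule LIMSEQ_Suc, rule tendsto_neg_powr)
       (use assms in \<open>auto intro: filterlim_real_sequentially\<close>)
  from telescope_sums'[OF this]
  have "(\<lambda>n. real (Suc n) powr (1 - x) - real (Suc (Suc n)) powr (1 - x)) sums 1"
    by simp
  then have A: "(\<lambda>n. (real (Suc n) powr (1 - x) - real (Suc (Suc n)) powr (1 - x)) / (x - 1)) sums (1 / (x - 1))"
    by (rule sums_divide)
  have B: "(\<lambda>n. real (Suc (Suc n)) powr (- x)) sums (Re (zeta (of_real x)) - 1)"
    using zeta_of_real_sums(1)[OF assms] by (subst sums_Suc_iff) simp
  have C: "real (Suc (Suc n)) powr (- x) \<le>
      (real (Suc n) powr (1 - x) - real (Suc (Suc n)) powr (1 - x)) / (x - 1)" for n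
  proof -
    have "real (Suc n) + 1 = real (Suc (Suc n))" by simp
    with powr_diff_ge[OF assms, of "real (Suc n)"] show ?thesis by (simp only:)
  qed
  from sums_le[OF C B A] have "Re (zeta (of_real x)) - 1 \<le> 1 / (x - 1)"
    .
  then show ?thesis by simp
qed

lemma norm_zeta_le:
  assumes "Re s > 1"
  shows "cmod (zeta s) \<le> 1 + 1 / (Re s - 1)"
  using norm_zeta_le_zeta_Re[OF assms] zeta_real_le[OF assms] by linarith

lemma zeta_has_sum:
  assumes "Re s > 1"
  shows "((\<lambda>n. of_nat n powr (- s)) has_sum zeta s) {0<..}"
proof -
  have "summable (\<lambda>n. cmod (of_nat (Suc n) powr (- s)))"
    using summable_powr_Suc[of "- Re s"] assms
    by (simp add: norm_powr_real_powr del: of_nat_Suc)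
  then have "((\<lambda>n. of_nat (Suc n) powr (- s)) has_sum zeta s) UNIV"
    by (intro norm_summable_imp_has_sum zeta_sums assms)
  moreover have "range Suc = {0<..}"
    by (auto simp: image_def) (metis gr0_implies_Suc)
  ultimately show ?thesis
    using has_sum_reindex[of Suc UNIV "\<lambda>n. of_nat n powr (- s) :: complex"]
    by (simp add: o_def del: of_nat_Suc)
qed

text \<open>Sieve of Eratosthenes: striking out the multiples of one more prime \<open>p\<close>
  from the survivors \<open>A\<close> removes exactly the image of \<open>A\<close> under
  multiplication by \<open>p\<close>, whose sum is \<open>p powr (- s)\<close> times the sum over
  \<open>A\<close>. Finite products suffice, so no infinite product has to be formed.\<close>

lemma has_sum_sieve:
  assumes s: "Re s > 1" and S: "finite S" "\<And>p. p \<in> S \<Longrightarrow> prime (p::nat)"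
  shows "((\<lambda>n. of_nat n powr (- s)) has_sum (zeta s * (\<Prod>p\<in>S. 1 - of_nat p powr (- s))))
     {n. n > 0 \<and> (\<forall>p\<in>S. \<not> p dvd n)}"
  using S
proof (induction S rule: finite_induct)
  case empty
  then show ?case using zeta_has_sum[OF s] by (simp add: greaterThan_def)
next
  case (insert p S)
  define A where "A = {n. n > 0 \<and> (\<forall>p\<in>S. \<not> p dvd n)}"
  define P where "P = zeta s * (\<Prod>p\<in>S. 1 - of_nat p powr (- s))"
  have p: "prime p" using insert by auto
  have IH: "((\<lambda>n. of_nat n powr (- s)) has_sum P) A"
    using insert by (simp add: A_def P_def)
  have "((\<lambda>n. of_nat p powr (- s) * of_nat n powr (- s)) has_sum (of_nat p powr (- s) * P)) A"
    by (intro has_sum_cmult_right IH)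
  also have "(\<lambda>n. of_nat p powr (- s) * of_nat n powr (- s)) =
      (\<lambda>n. of_nat n powr (- s) :: complex) \<circ> (\<lambda>n. p * n)"
    using powr_times_real[of "of_nat p" "of_nat n" "- s" for n] by (auto simp: fun_eq_iff powr_times_real)
  finally have "((\<lambda>n. of_nat n powr (- s)) has_sum (of_nat p powr (- s) * P)) ((\<lambda>n. p * n) ` A)"
    using p by (subst has_sum_reindex) (auto simp: inj_on_def prime_gt_0_nat simp del: o_apply of_nat_mult)
  moreover have "(\<lambda>n. p * n) ` A \<subseteq> A"
  proof -
    have "\<not> q dvd p * n" if "n \<in> A" "q \<in> S" for q n
    proof -
      have q: "prime q" "q \<noteq> p" using insert that by auto
      have "\<not> q dvd p" using primes_dvd_imp_eq[OF q(1) p] q(2) by auto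
      with q that show ?thesis by (auto simp: A_def prime_dvd_mult_iff)
    qed
    with p show ?thesis by (auto simp: A_def prime_gt_0_nat)
  qed
  ultimately have "((\<lambda>n. of_nat n powr (- s)) has_sum (P - of_nat p powr (- s) * P)) (A - (\<lambda>n. p * n) ` A)"
    by (intro has_sum_Diff IH)
  moreover have "A - (\<lambda>n. p * n) ` A = {n. n > 0 \<and> (\<forall>p\<in>insert p S. \<not> p dvd n)}"
  proof (intro equalityI subsetI)
    fix n assume n: "n \<in> A - (\<lambda>n. p * n) ` A"
    have "\<not> p dvd n"
    proof
      assume "p dvd n"
      then obtain m where m: "n = p * m" by (rule dvdE)
      then have "m \<in> A" using n by (auto simp: A_def)
      with m n show False by blast
    qed
    with n show "n \<in> {n. n > 0 \<and> (\<forall>p\<in>insert p S. \<not> p dvd n)}" by (auto simp: A_def)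
  qed (auto simp: A_def)
  moreover have "P - of_nat p powr (- s) * P = zeta s * (\<Prod>p\<in>insert p S. 1 - of_nat p powr (- s))"
    using insert by (simp add: P_def algebra_simps)
  ultimately show ?case by simp
qed

text \<open>After sieving by all primes up to \<open>N\<close>, the survivors other than 1 exceed
  \<open>N\<close>, so \<open>zeta s * P\<close> is within \<open>e\<close> of 1. On the other hand
  \<open>cmod P\<close> is at most \<open>1 / Q\<close>, because
  \<open>(1 + f p) * (1 - f p) \<le> 1\<close>, and \<open>1 / Q\<close> is at most zeta at the real
  part, because the sieved sum there still contains the term 1.\<close>

lemma norm_zeta_ge_inverse:
  assumes s: "Re s > 1"
  shows "cmod (zeta s) * Re (zeta (of_real (Re s))) \<ge> 1"
proof (rule field_le_epsilon)
  fix e :: real assume e: "e > 0"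
  define x where "x = Re s"
  have x: "x > 1" using s by (simp add: x_def)
  define f where "f = (\<lambda>n::nat. real n powr (- x))"
  have "summable (\<lambda>n. f (Suc n))"
    unfolding f_def using x by (intro summable_powr_Suc) simp
  then have f_sum: "summable f" by (simp add: summable_Suc_iff)
  obtain N where N: "\<And>n. n \<ge> N \<Longrightarrow> norm (\<Sum>i. f (i + n)) < e"
    using suminf_exist_split[OF e f_sum] by blast
  define S where "S = {p. prime p \<and> p < Suc N}"
  have S: "finite S" "\<And>p. p \<in> S \<Longrightarrow> prime p" unfolding S_def by auto
  define A where "A = {n. n > 0 \<and> (\<forall>p\<in>S. \<not> p dvd n)}"
  have A1: "1 \<in> A" unfolding A_def S_def by (auto simp: not_prime_1)
  have A2: "A - {1} \<subseteq> {Suc N..}"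
  proof
    fix n assume n: "n \<in> A - {1}"
    then have "n > 0" "n \<noteq> 1" by (auto simp: A_def)
    then obtain p where p: "prime p" "p dvd n" by (metis prime_factor_nat)
    then have "p \<le> n" using \<open>n > 0\<close> by (auto intro: dvd_imp_le)
    moreover have "p \<notin> S" using n p by (auto simp: A_def)
    ultimately show "n \<in> {Suc N..}" using p by (auto simp: S_def)
  qed
  define P where "P = (\<Prod>p\<in>S. 1 - of_nat p powr (- s) :: complex)"
  define Q where "Q = (\<Prod>p\<in>S. 1 - f p)"
  have hs: "((\<lambda>n. of_nat n powr (- s)) has_sum (zeta s * P)) A"
    using has_sum_sieve[OF s S] by (simp add: A_def P_def)
  have hx: "((\<lambda>n. of_nat n powr (- complex_of_real x)) has_sum (zeta (of_real x) * (\<Prod>p\<in>S. 1 - of_nat p powr (- of_real x)))) A"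
    using has_sum_sieve[OF _ S, of "of_real x"] x by (simp add: A_def)
  have pr: "of_nat n powr (- complex_of_real x) = of_real (f n)" for n
    by (simp add: f_def flip: powr_of_real)
  have "zeta (of_real x) * (\<Prod>p\<in>S. 1 - of_nat p powr (- of_real x)) = of_real (Re (zeta (of_real x)) * Q)"
    unfolding pr Q_def using zeta_of_real_sums(2)[OF x] by simp
  with hx have "((\<lambda>n. complex_of_real (f n)) has_sum of_real (Re (zeta (of_real x)) * Q)) A"
    unfolding pr by simp
  then have hf: "(f has_sum (Re (zeta (of_real x)) * Q)) A"
    by (simp only: has_sum_of_real_iff)
  have tail: "(f has_sum (\<Sum>i. f (i + Suc N))) {Suc N..}"
  proof -
    have "((\<lambda>i. f (i + Suc N)) has_sum (\<Sum>i. f (i + Suc N))) UNIV"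
      using summable_sums[OF summable_ignore_initial_segment[OF f_sum, of "Suc N"]]
      by (intro sums_nonneg_imp_has_sum) (auto simp: f_def)
    moreover have "range (\<lambda>i. i + Suc N) = {Suc N..}"
      by (auto simp: image_iff) (metis le_add_diff_inverse2 add_Suc_right)
    ultimately show ?thesis
      using has_sum_reindex[of "\<lambda>i. i + Suc N" UNIV f] by (simp add: o_def inj_on_def)
  qed
  have tail_less: "(\<Sum>i. f (i + Suc N)) \<le> e" using N[of "Suc N"] by simp
  have f1: "f 1 = 1" by (simp add: f_def)
  have hf': "(f has_sum (Re (zeta (of_real x)) * Q - 1)) (A - {1})"
    using has_sum_Diff[OF hf has_sum_finite[of "{1}" f]] A1 f1 by simp
  have hs': "((\<lambda>n. of_nat n powr (- s)) has_sum (zeta s * P - 1)) (A - {1})"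
    using has_sum_Diff[OF hs has_sum_finite[of "{1}"]] A1 by simp
  have "cmod (zeta s * P - 1) \<le> Re (zeta (of_real x)) * Q - 1"
    by (rule norm_has_sum_bound[OF _ hs'], rule has_sum_cong[THEN iffD1, OF _ hf'])
       (auto simp: f_def x_def norm_powr_real_powr)
  also have "\<dots> \<le> (\<Sum>i. f (i + Suc N))"
    by (rule has_sum_mono2[OF hf' tail A2]) (auto simp: f_def)
  finally have lowP: "cmod (zeta s) * cmod P \<ge> 1 - e"
    using tail_less norm_triangle_ineq2[of 1 "1 - zeta s * P"]
    by (simp add: norm_mult norm_minus_commute)
  have fp: "f p < 1" "f p \<ge> 0" if "p \<in> S" for p
  proof -
    have "p > 1" using S(2)[OF that] by (rule prime_gt_1_nat)
    then have "real p powr (- x) < real p powr 0" using x by (intro powr_less_mono) auto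
    then show "f p < 1" using \<open>p > 1\<close> by (simp add: f_def)
  qed (simp add: f_def)
  have Q0: "Q > 0" unfolding Q_def by (intro prod_pos) (use fp in auto)
  have "Re (zeta (of_real x)) * Q - 1 \<ge> 0"
    using has_sum_nonneg[OF hf'] by (auto simp: f_def)
  have "cmod P \<le> (\<Prod>p\<in>S. 1 + f p)"
    unfolding P_def prod_norm[symmetric]
  proof (rule prod_mono, safe)
    fix p show "cmod (1 - of_nat p powr (- s)) \<le> 1 + f p"
      using norm_triangle_ineq4[of 1 "of_nat p powr (- s)"] by (simp add: f_def x_def norm_powr_real_powr)
  qed auto
  also have "\<dots> \<le> (\<Prod>p\<in>S. inverse (1 - f p))"
  proof (intro prod_mono conjI)
    fix p assume "p \<in> S"
    with fp[of p] have "1 - f p > 0" "(1 + f p) * (1 - f p) \<le> 1" by (auto simp: algebra_simps)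
    then show "1 + f p \<le> inverse (1 - f p)" by (simp add: field_simps)
  qed (use fp in \<open>auto intro: add_nonneg_nonneg\<close>)
  also have "\<dots> = inverse Q" using prod_inversef[of "\<lambda>p. 1 - f p" S] by (simp add: Q_def o_def)
  also have "\<dots> \<le> Re (zeta (of_real x))"
    using Q0 \<open>Re (zeta (of_real x)) * Q - 1 \<ge> 0\<close> by (simp add: field_simps)
  finally have "cmod (zeta s) * cmod P \<le> cmod (zeta s) * Re (zeta (of_real x))"
    by (intro mult_left_mono) auto
  with lowP show "1 \<le> cmod (zeta s) * Re (zeta (of_real (Re s))) + e" by (simp add: x_def)
qed

lemma norm_zeta_ge:
  assumes s: "Re s > 1"
  shows "cmod (zeta s) \<ge> (Re s - 1) / Re s"
proof -
  have "1 \<le> cmod (zeta s) * (1 + 1 / (Re s - 1))"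
    using norm_zeta_ge_inverse[OF s] mult_left_mono[OF zeta_real_le[OF s], of "cmod (zeta s)"] by simp
  also have "1 + 1 / (Re s - 1) = Re s / (Re s - 1)" using s by (simp add: field_simps)
  finally show ?thesis using s by (simp add: field_simps)
qed

section \<open>The Euler--Maclaurin formula\<close>

text \<open>The error of the trapezoidal rule for \<open>u powr (- s)\<close> on
  \<open>{a..a + 1}\<close>.\<close>

definition em_term :: "real \<Rightarrow> complex \<Rightarrow> complex" where
  "em_term a s = (of_real a powr (- s) + of_real (a + 1) powr (- s)) / 2
     - (of_real (a + 1) powr (1 - s) - of_real a powr (1 - s)) / (1 - s)"

lemma em_term_holomorphic:
  assumes "a > 0"
  shows "em_term a holomorphic_on - {1}"
  unfolding em_term_def using assms
  by (intro holomorphic_intros) (auto simp del: of_real_add)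

text \<open>Peano kernel of the trapezoidal rule: the error is half the parabola
  \<open>(u - a) * (a + 1 - u)\<close> integrated against the second derivative. Two integrations by
  parts produce the antiderivative \<open>W\<close>, that is \<open>(p * f' - p' * f) / 2\<close>
  minus an antiderivative of \<open>f\<close>, for the parabola \<open>p\<close> and the power
  \<open>f\<close>.\<close>

lemma has_integral_em_term:
  assumes a: "a > 0" and s: "s \<noteq> 1"
  shows "((\<lambda>u. s * (s + 1) / 2 * of_real ((u - a) * (a + 1 - u)) * of_real u powr (- s - 2))
    has_integral em_term a s) {a..a + 1}"
proof -
  define A where "A = complex_of_real a"
  define W where "W = (\<lambda>z. ((z - A) * (A + 1 - z) * (- s) * z powr (- s - 1)
      - (2 * A + 1 - 2 * z) * z powr (- s)) / 2 - z powr (1 - s) / (1 - s))"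
  have W: "((\<lambda>u. W (of_real u)) has_vector_derivative
      s * (s + 1) / 2 * of_real ((u - a) * (a + 1 - u)) * of_real u powr (- s - 2)) (at u within {a..a + 1})"
    if u: "u \<in> {a..a+1}" for u
  proof (rule has_vector_derivative_real_field)
    define z where "z = complex_of_real u"
    have z: "z \<notin> \<real>\<^sub>\<le>\<^sub>0" using u a by (simp add: z_def)
    have D: "((\<lambda>z. z powr r) has_field_derivative r * z powr (r - 1)) (at z)" for r
      by (rule has_field_derivative_powr[OF z])
    note [derivative_intros] = D[of "- s - 1"] D[of "- s"] D[of "1 - s"]
    have e: "- s - 1 - 1 = - s - 2" "1 - s - 1 = - s" by simp_all
    have W': "(W has_field_derivative
      (((1 * (A + 1 - z) + (- 1) * (z - A)) * (- s) * z powr (- s - 1)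
         + ((- s - 1) * z powr (- s - 2)) * ((z - A) * (A + 1 - z) * (- s)))
        - ((- 2) * z powr (- s) + (- s * z powr (- s - 1)) * (2 * A + 1 - 2 * z))) / 2
        - (1 - s) * z powr (- s) / (1 - s)) (at z)"
      unfolding W_def e(1)[symmetric]
      by (rule derivative_eq_intros refl | (simp add: s; fail) | simp add: e algebra_simps)+
    have eq: "(((1 * (A + 1 - z) + (- 1) * (z - A)) * (- s) * z powr (- s - 1)
         + ((- s - 1) * z powr (- s - 2)) * ((z - A) * (A + 1 - z) * (- s)))
        - ((- 2) * z powr (- s) + (- s * z powr (- s - 1)) * (2 * A + 1 - 2 * z))) / 2
        - (1 - s) * z powr (- s) / (1 - s)
      = s * (s + 1) / 2 * ((z - A) * (A + 1 - z)) * z powr (- s - 2)"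
    proof -
      have "(1 - s) * z powr (- s) / (1 - s) = z powr (- s)" using s by simp
      then show ?thesis by (simp only:) (simp add: field_simps)
    qed
    from W'[unfolded eq] show "(W has_field_derivative s * (s + 1) / 2 * of_real ((u - a) * (a + 1 - u)) *
      of_real u powr (- s - 2)) (at (of_real u))"
      by (simp add: z_def A_def)
  qed
  have "((\<lambda>u. s * (s + 1) / 2 * of_real ((u - a) * (a + 1 - u)) * of_real u powr (- s - 2))
    has_integral (W (of_real (a + 1)) - W (of_real a))) {a..a + 1}"
    by (rule fundamental_theorem_of_calculus[OF _ W]) auto
  also have "W (of_real (a + 1)) - W (of_real a) = em_term a s"
    unfolding W_def em_term_def A_def
    by (simp add: diff_divide_distrib add_divide_distrib algebra_simps)
  finally show ?thesis .
qed

lemma norm_em_term_le: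
  assumes a: "a > 0" and s: "s \<noteq> 1" "Re s \<ge> -2"
  shows "cmod (em_term a s) \<le> cmod s * cmod (s + 1) / 8 * a powr (- Re s - 2)"
proof -
  have key: "cmod (s * (s + 1) / 2 * of_real ((u - a) * (a + 1 - u)) * of_real u powr (- s - 2))
        \<le> cmod s * cmod (s + 1) / 8 * a powr (- Re s - 2)" if u: "u \<in> {a..a+1} - {}" for u
  proof -
      have u: "a \<le> u" "u \<le> a + 1" using u by auto
      have "(u - a) * (a + 1 - u) \<le> 1/4"
        using zero_le_power2[of "u - a - 1/2"] by (simp add: power2_eq_square algebra_simps)
      moreover have "(u - a) * (a + 1 - u) \<ge> 0" using u by simp
      moreover have "cmod (of_real u powr (- s - 2)) \<le> a powr (- Re s - 2)"
        using u a s by (simp add: norm_powr_real_powr powr_mono2')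
      ultimately have "\<bar>(u - a) * (a + 1 - u)\<bar> * cmod (of_real u powr (- s - 2)) \<le> 1/4 * a powr (- Re s - 2)"
        by (intro mult_mono) auto
      then have "cmod s * cmod (s + 1) / 2 * (\<bar>(u - a) * (a + 1 - u)\<bar> * cmod (of_real u powr (- s - 2))) \<le>
          cmod s * cmod (s + 1) / 2 * (1/4 * a powr (- Re s - 2))"
        by (intro mult_left_mono) auto
      then show ?thesis
        by (simp add: norm_mult norm_divide mult_ac flip: of_real_add of_real_diff of_real_mult)
  qed
  show ?thesis
    using has_integral_bound_real[OF _ finite.emptyI has_integral_em_term[OF a s(1)] key] by simp
qed

lemma em_series:
  defines "A \<equiv> {s. Re s > -1} - {1}"
  shows "(\<lambda>s. \<Sum>n. em_term (real (Suc n)) s) holomorphic_on A"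
    and "\<And>s. s \<in> A \<Longrightarrow> summable (\<lambda>n. em_term (real (Suc n)) s)"
proof -
  have op: "open A" unfolding A_def by (intro open_Diff open_halfspace_Re_gt) auto
  have hol: "em_term (real (Suc n)) holomorphic_on A" for n
    by (rule holomorphic_on_subset[OF em_term_holomorphic]) (auto simp: A_def)
  have bd: "\<exists>d>0. cball x d \<subseteq> A \<and> (\<exists>M. summable M \<and>
      (\<forall>n\<ge>1. \<forall>z\<in>cball x d. cmod (em_term (real (Suc n)) z) \<le> M n))"
    if "x \<in> A" for x
  proof -
    from that have "Re x > - 1" by (simp add: A_def)
    then obtain d \<sigma> r where d: "d > 0" "cball x d \<subseteq> {s. Re s > - 1}" "\<sigma> > - 1" "r > 0"
      "\<And>z. z \<in> cball x d \<Longrightarrow> Re z \<ge> \<sigma>" "\<And>z. z \<in> cball x d \<Longrightarrow> cmod (1 - z) \<le> r"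
      by (rule cball_in_halfplane) blast
    define d' where "d' = min d (cmod (x - 1) / 2)"
    have "cmod (x - 1) > 0" using that by (simp add: A_def)
    moreover have "d' \<le> cmod (x - 1) / 2" by (simp add: d'_def)
    ultimately have d': "d' > 0" "d' \<le> d" "d' < cmod (x - 1)"
      using d by (auto simp: d'_def simp del: zero_less_norm_iff)
    have sub: "cball x d' \<subseteq> A"
    proof -
      have "cball x d' \<subseteq> {s. Re s > - 1}" using subset_cball[OF d'(2)] d(2) by (rule order_trans)
      moreover have "1 \<notin> cball x d'" using d'(3) by (simp add: dist_norm)
      ultimately show ?thesis by (auto simp: A_def)
    qed
    have "cmod (em_term (real (Suc n)) z) \<le> (1 + r) * (2 + r) / 8 * real (Suc n) powr (- \<sigma> - 2)"
      if z: "z \<in> cball x d'" for n z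
    proof -
      have z1: "z \<in> cball x d" using z d' by auto
      have zA: "z \<in> A" using z sub by blast
      have "cmod z \<le> 1 + r" using norm_triangle_ineq4[of 1 "1 - z"] d(6)[OF z1] by simp
      moreover have "cmod (z + 1) \<le> 2 + r" using norm_triangle_ineq4[of 2 "1 - z"] d(6)[OF z1] by (simp add: add_ac)
      ultimately have "cmod z * cmod (z + 1) / 8 * real (Suc n) powr (- Re z - 2) \<le>
          (1 + r) * (2 + r) / 8 * real (Suc n) powr (- \<sigma> - 2)"
        using d(5)[OF z1] d(4) by (intro mult_mono divide_right_mono powr_mono) auto
      with norm_em_term_le[of "real (Suc n)" z] zA show ?thesis by (force simp: A_def)
    qed
    moreover have "summable (\<lambda>n. (1 + r) * (2 + r) / 8 * real (Suc n) powr (- \<sigma> - 2))"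
      by (intro summable_mult summable_powr_Suc) (use d in simp)
    ultimately show ?thesis using d'(1) sub by blast
  qed
  show "(\<lambda>s. \<Sum>n. em_term (real (Suc n)) s) holomorphic_on A"
    by (rule holomorphic_series(1)[OF op hol bd])
  show "summable (\<lambda>n. em_term (real (Suc n)) s)" if "s \<in> A" for s
    by (rule holomorphic_series(2)[OF op hol bd that])
qed

lemma em_sums_Re_gt_1:
  assumes s: "Re s > 1"
  shows "(\<lambda>n. em_term (real (Suc n)) s) sums (zeta s - 1 / 2 - 1 / (s - 1))"
proof -
  have z: "(\<lambda>n. of_nat (Suc n) powr (- s)) sums zeta s" by (rule zeta_sums[OF s])
  then have z': "(\<lambda>n. of_nat (Suc (Suc n)) powr (- s)) sums (zeta s - 1)"
    by (subst sums_Suc_iff) simp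
  have "(\<lambda>n. complex_of_real (real (Suc n)) powr (1 - s)) \<longlonglongrightarrow> 0"
  proof (rule tendsto_norm_zero_cancel)
    have "(\<lambda>n. real (Suc n) powr (1 - Re s)) \<longlonglongrightarrow> 0"
      by (rule LIMSEQ_Suc, rule tendsto_neg_powr)
         (use s in \<open>auto intro: filterlim_real_sequentially\<close>)
    then show "(\<lambda>n. cmod (complex_of_real (real (Suc n)) powr (1 - s))) \<longlonglongrightarrow> 0"
      by (simp add: norm_powr_real_powr del: of_nat_Suc)
  qed
  from telescope_sums[OF this]
  have t: "(\<lambda>n. of_nat (Suc (Suc n)) powr (1 - s) - of_nat (Suc n) powr (1 - s)) sums (- 1 :: complex)"
    by (simp del: of_nat_Suc) simp
  have "(\<lambda>n. (of_nat (Suc n) powr (- s) + of_nat (Suc (Suc n)) powr (- s)) / 2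
     - (of_nat (Suc (Suc n)) powr (1 - s) - of_nat (Suc n) powr (1 - s)) / (1 - s)) sums
     ((zeta s + (zeta s - 1)) / 2 - (- 1) / (1 - s))"
    by (intro sums_diff sums_divide sums_add z z' t)
  also have "(\<lambda>n. (of_nat (Suc n) powr (- s) + of_nat (Suc (Suc n)) powr (- s)) / 2
     - (of_nat (Suc (Suc n)) powr (1 - s) - of_nat (Suc n) powr (1 - s)) / (1 - s))
     = (\<lambda>n. em_term (real (Suc n)) s)"
  proof
    fix n
    have "real (Suc n) + 1 = real (Suc (Suc n))" by simp
    then show "(of_nat (Suc n) powr (- s) + of_nat (Suc (Suc n)) powr (- s)) / 2
     - (of_nat (Suc (Suc n)) powr (1 - s) - of_nat (Suc n) powr (1 - s)) / (1 - s) = em_term (real (Suc n)) s"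
      unfolding em_term_def by (simp only: of_real_of_nat_eq)
  qed
  also have "(zeta s + (zeta s - 1)) / 2 - (- 1) / (1 - s) = zeta s - 1 / 2 - 1 / (s - 1)"
  proof -
    have "1 / (1 - s) = - (1 / (s - 1))" by (simp add: minus_divide_right)
    then show ?thesis by (simp add: field_simps)
  qed
  finally show ?thesis .
qed

text \<open>Both sides are holomorphic for \<open>Re s > -1\<close> away from 1 and agree where the
  Dirichlet series converges. The strip left of 0 is included because the functional equation is
  first proved on the real interval between -1 and 0.\<close>

lemma em_sums:
  assumes s: "Re s > -1" "s \<noteq> 1"
  shows "(\<lambda>n. em_term (real (Suc n)) s) sums (zeta s - 1 / 2 - 1 / (s - 1))"
proof -
  have "zeta s - 1 / 2 - 1 / (s - 1) = (\<Sum>n. em_term (real (Suc n)) s)"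
  proof (rule analytic_continuation_open[where f = "\<lambda>s. zeta s - 1 / 2 - 1 / (s - 1)" and z = s and
        s = "{s. Re s > 1}" and s' = "{s. Re s > -1} - {1}"])
    have "(2::complex) \<in> {s. Re s > 1}" by simp
    then show "{s. Re s > 1} \<noteq> {}" by blast
    show "open ({s. Re s > -1} - {1})" by (intro open_Diff open_halfspace_Re_gt) auto
    show "connected ({s. Re s > -1} - {1})"
      by (intro connected_open_delete open_halfspace_Re_gt convex_connected convex_halfspace_Re_gt) auto
    show "(\<lambda>s. zeta s - 1 / 2 - 1 / (s - 1)) holomorphic_on {s. Re s > -1} - {1}"
      by (intro holomorphic_intros) auto
    show "zeta z - 1 / 2 - 1 / (z - 1) = (\<Sum>n. em_term (real (Suc n)) z)" if "z \<in> {s. Re s > 1}" for z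
      using em_sums_Re_gt_1[of z] that by (simp add: sums_iff)
    show "(\<lambda>s. \<Sum>n. em_term (real (Suc n)) s) holomorphic_on {s. Re s > -1} - {1}"
      by (rule em_series)
  qed (use s in \<open>auto simp: open_halfspace_Re_gt\<close>)
  with em_series(2)[of s] s show ?thesis by (simp add: sums_iff)
qed

text \<open>The exponent 2 comes from the factor \<open>cmod s * cmod (s + 1)\<close> in the bound
  for \<open>em_term\<close>. The case distinction at real part 2 keeps \<open>cmod s\<close>
  comparable with \<open>Im s\<close>; further right the Dirichlet series gives a constant.\<close>

lemma norm_zeta_le_square:
  obtains B where "B \<ge> 1"
    "\<And>s. Re s \<ge> 1/2 \<Longrightarrow> Im s \<ge> 1 \<Longrightarrow> cmod (zeta s) \<le> B * (Im s)\<^sup>2"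
proof -
  define S where "S = (\<Sum>n. real (Suc n) powr (- 5/2))"
  have sm: "summable (\<lambda>n. real (Suc n) powr (- 5/2))" by (rule summable_powr_Suc) simp
  have S: "(\<lambda>n. real (Suc n) powr (- 5/2)) sums S" "S \<ge> 0"
    unfolding S_def using sm by (auto intro: summable_sums suminf_nonneg)
  have "cmod (zeta s) \<le> (2 + 2 * S) * (Im s)\<^sup>2" if s: "Re s \<ge> 1/2" "Im s \<ge> 1" for s
  proof (cases "Re s \<ge> 2")
    case True
    then have "cmod (zeta s) \<le> 1 + 1 / (Re s - 1)" by (intro norm_zeta_le) simp
    also have "\<dots> \<le> 2" using True by (simp add: field_simps)
    also have "\<dots> \<le> (2 + 2 * S) * (Im s)\<^sup>2"
      using S mult_mono[of 2 "2 + 2 * S" 1 "(Im s)\<^sup>2"] s by (simp add: one_le_power)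
    finally show ?thesis .
  next
    case False
    have s1: "s \<noteq> 1" using s by auto
    have ns: "cmod s \<le> 3 * Im s" "cmod (s + 1) \<le> 4 * Im s" "cmod (s - 1) \<ge> 1"
      using cmod_le[of s] cmod_le[of "s + 1"] abs_Im_le_cmod[of "s - 1"] s False by auto
    have "cmod (em_term (real (Suc n)) s) \<le> 3/2 * (Im s)\<^sup>2 * real (Suc n) powr (- 5/2)" for n
    proof -
      have "cmod s * cmod (s + 1) \<le> (3 * Im s) * (4 * Im s)"
        using ns s by (intro mult_mono) auto
      then have "cmod s * cmod (s + 1) / 8 * real (Suc n) powr (- Re s - 2) \<le>
          3/2 * (Im s)\<^sup>2 * real (Suc n) powr (- 5/2)"
        using s by (intro mult_mono powr_mono) (auto simp: power2_eq_square)
      then show ?thesis using norm_em_term_le[of "real (Suc n)" s] s1 s by force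
    qed
    then have "cmod (zeta s - 1 / 2 - 1 / (s - 1)) \<le> 3/2 * (Im s)\<^sup>2 * S"
      by (intro norm_sums_le[OF em_sums sums_mult[OF S(1)]]) (use s s1 in auto)
    moreover have "cmod (1 / 2 + 1 / (s - 1)) \<le> 2"
    proof -
      have "cmod (1 / 2 + 1 / (s - 1)) \<le> 1 / 2 + 1 / cmod (s - 1)"
        using norm_triangle_ineq[of "1/2" "1 / (s - 1)"] by (simp add: norm_divide)
      also have "1 / cmod (s - 1) \<le> 1" using ns(3) by (auto simp: divide_le_eq_1)
      finally show ?thesis by simp
    qed
    moreover have "cmod (zeta s) \<le> cmod (zeta s - 1 / 2 - 1 / (s - 1)) + cmod (1 / 2 + 1 / (s - 1))"
      using norm_triangle_ineq[of "zeta s - 1 / 2 - 1 / (s - 1)" "1 / 2 + 1 / (s - 1)"] by simp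
    moreover have "2 \<le> 2 * (Im s)\<^sup>2" using s by (simp add: one_le_power)
    moreover have "3/2 * (Im s)\<^sup>2 * S \<le> 2 * S * (Im s)\<^sup>2" using S(2) by (simp add: mult_ac)
    ultimately show ?thesis by (simp add: algebra_simps)
  qed
  then show ?thesis using that[of "2 + 2 * S"] S by auto
qed

section \<open>The functional equation\<close>

lemma nn_integral_powr_exp:
  assumes a: "a > 0" and c: "c > 0"
  shows "(\<integral>\<^sup>+x\<in>{0<..}. ennreal (x powr (a - 1) * exp (- (c * x))) \<partial>lborel) = ennreal (Gamma a * c powr (- a))"
    (is "?I = _")
proof -
  have "ennreal (Gamma a) = (\<integral>\<^sup>+t\<in>{0<..}. ennreal (t powr (a - 1) * exp (- t)) \<partial>lborel)"
    unfolding Gamma_conv_nn_integral_real[OF a]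
    by (intro nn_integral_cong) (auto simp: indicator_def exp_minus divide_inverse)
  also have "\<dots> = \<bar>c\<bar> * (\<integral>\<^sup>+x. ennreal ((0 + c * x) powr (a - 1) * exp (- (0 + c * x))) * indicator {0<..} (0 + c * x) \<partial>lborel)"
    by (rule nn_integral_real_affine) (use c in auto)
  also have "(\<integral>\<^sup>+x. ennreal ((0 + c * x) powr (a - 1) * exp (- (0 + c * x))) * indicator {0<..} (0 + c * x) \<partial>lborel)
      = (\<integral>\<^sup>+x. ennreal (c powr (a - 1)) * (ennreal (x powr (a - 1) * exp (- (c * x))) * indicator {0<..} x) \<partial>lborel)"
    using c by (intro nn_integral_cong)
       (auto simp: indicator_def powr_mult zero_less_mult_iff mult.assoc simp flip: ennreal_mult)
  also have "\<dots> = ennreal (c powr (a - 1)) * ?I"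
    by (rule nn_integral_cmult) auto
  also have "ennreal \<bar>c\<bar> * (ennreal (c powr (a - 1)) * ?I) = ennreal (c powr a) * ?I"
  proof -
    have "\<bar>c\<bar> * c powr (a - 1) = c powr a" using c by (simp add: powr_diff)
    then show ?thesis using c by (simp add: mult.assoc [symmetric] flip: ennreal_mult)
  qed
  finally have "ennreal (c powr (- a)) * ennreal (Gamma a) = ennreal (c powr (- a)) * (ennreal (c powr a) * ?I)"
    by simp
  also have "\<dots> = ?I"
    using c by (simp add: mult.assoc [symmetric] flip: ennreal_mult powr_add)
  finally show ?thesis using a by (simp add: ennreal_mult [symmetric] mult.commute)
qed

lemma Gamma_reflection_real:
  fixes a :: real
  shows "Gamma a * Gamma (1 - a) = pi / sin (pi * a)"
proof -
  have "complex_of_real (Gamma a * Gamma (1 - a)) = Gamma (of_real a) * Gamma (1 - of_real a)"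
    using Gamma_complex_of_real[of a] Gamma_complex_of_real[of "1 - a"] by simp
  also have "\<dots> = of_real (pi / sin (pi * a))"
    by (simp add: Gamma_reflection_complex flip: sin_of_real of_real_mult)
  finally show ?thesis by (simp only: of_real_eq_iff)
qed

text \<open>Write \<open>1 / (q + u)\<close> as the integral of \<open>exp (- ((q + u) * y))\<close>
  over \<open>y > 0\<close> and exchange the integrals: this leaves
  \<open>Gamma a * Gamma (1 - a)\<close>, which reflection evaluates. With nonnegative integrals the
  exchange needs no integrability.\<close>

lemma nn_integral_powr_over_add:
  assumes a: "0 < a" "a < 1" and q: "q > 0"
  shows "(\<integral>\<^sup>+u\<in>{0<..}. ennreal (u powr (a - 1) / (q + u)) \<partial>lborel) = ennreal (q powr (a - 1) * (pi / sin (pi * a)))"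
proof -
  have "(\<integral>\<^sup>+u\<in>{0<..}. ennreal (u powr (a - 1) / (q + u)) \<partial>lborel) =
    (\<integral>\<^sup>+u. \<integral>\<^sup>+y. ennreal (u powr (a - 1) * exp (- ((q + u) * y))) * indicator {0<..} u * indicator {0<..} y \<partial>lborel \<partial>lborel)"
  proof (intro nn_integral_cong)
    fix u :: real
    show "ennreal (u powr (a - 1) / (q + u)) * indicator {0<..} u =
      (\<integral>\<^sup>+y. ennreal (u powr (a - 1) * exp (- ((q + u) * y))) * indicator {0<..} u * indicator {0<..} y \<partial>lborel)"
    proof (cases "u > 0")
      case True
      have "(\<integral>\<^sup>+y. ennreal (u powr (a - 1) * exp (- ((q + u) * y))) * indicator {0<..} u * indicator {0<..} y \<partial>lborel)
        = (\<integral>\<^sup>+y. ennreal (u powr (a - 1)) * (ennreal (y powr (1 - 1) * exp (- ((q + u) * y))) * indicator {0<..} y) \<partial>lborel)"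
        using True by (intro nn_integral_cong) (auto simp: indicator_def simp flip: ennreal_mult)
      also have "\<dots> = ennreal (u powr (a - 1)) * ennreal (Gamma 1 * (q + u) powr (- 1))"
        using True q by (subst nn_integral_cmult, simp, subst nn_integral_powr_exp) auto
      also have "\<dots> = ennreal (u powr (a - 1) / (q + u))"
        using True q by (simp add: powr_minus divide_inverse flip: ennreal_mult)
      finally show ?thesis using True by simp
    qed auto
  qed
  also have "\<dots> = (\<integral>\<^sup>+y. \<integral>\<^sup>+u. ennreal (u powr (a - 1) * exp (- ((q + u) * y))) * indicator {0<..} u * indicator {0<..} y \<partial>lborel \<partial>lborel)"
    by (rule lborel_pair.Fubini') simp
  also have "\<dots> = (\<integral>\<^sup>+y. ennreal (Gamma a) * (ennreal (y powr ((1 - a) - 1) * exp (- (q * y))) * indicator {0<..} y) \<partial>lborel)"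
  proof (intro nn_integral_cong)
    fix y :: real
    show "(\<integral>\<^sup>+u. ennreal (u powr (a - 1) * exp (- ((q + u) * y))) * indicator {0<..} u * indicator {0<..} y \<partial>lborel)
      = ennreal (Gamma a) * (ennreal (y powr ((1 - a) - 1) * exp (- (q * y))) * indicator {0<..} y)"
    proof (cases "y > 0")
      case True
      have "(\<integral>\<^sup>+u. ennreal (u powr (a - 1) * exp (- ((q + u) * y))) * indicator {0<..} u * indicator {0<..} y \<partial>lborel)
        = (\<integral>\<^sup>+u. ennreal (exp (- (q * y))) * (ennreal (u powr (a - 1) * exp (- (y * u))) * indicator {0<..} u) \<partial>lborel)"
        using True by (intro nn_integral_cong)
          (auto simp: indicator_def algebra_simps exp_add exp_diff exp_minus divide_inverse simp flip: ennreal_mult)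
      also have "\<dots> = ennreal (exp (- (q * y))) * ennreal (Gamma a * y powr (- a))"
        using True a by (subst nn_integral_cmult, simp, subst nn_integral_powr_exp) auto
      finally show ?thesis using True a by (simp add: ac_simps flip: ennreal_mult)
    qed auto
  qed
  also have "\<dots> = ennreal (Gamma a) * ennreal (Gamma (1 - a) * q powr (- (1 - a)))"
    using a q by (subst nn_integral_cmult, simp, subst nn_integral_powr_exp) auto
  also have "\<dots> = ennreal (q powr (a - 1) * (Gamma a * Gamma (1 - a)))"
    using a by (simp add: ac_simps flip: ennreal_mult)
  finally show ?thesis by (simp only: Gamma_reflection_real)
qed

lemma cos_half_pi_mult_pos:
  fixes s :: real
  assumes s: "-1 < s" "s < 1"
  shows "cos (pi * s / 2) > 0"
proof (rule cos_gt_zero_pi)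
    have "pi * s > pi * (-1)" using s by (intro mult_strict_left_mono) auto
    then show "- (pi / 2) < pi * s / 2" by simp
    have "pi * s < pi * 1" using s by (intro mult_strict_left_mono) auto
    then show "pi * s / 2 < pi / 2" by simp
qed

text \<open>The substitution \<open>u = x\<^sup>2\<close> reduces this to the preceding integral
  with \<open>a = (s + 1) / 2\<close>; the shift by 1/2 turns the sine into a cosine.\<close>

lemma nn_integral_powr_over_sum_squares:
  assumes s: "-1 < s" "s < 1" and c: "c > 0"
  shows "(\<integral>\<^sup>+x\<in>{0<..}. ennreal (x powr s / (x\<^sup>2 + c\<^sup>2)) \<partial>lborel) =
    ennreal (c powr (s - 1) * (pi / (2 * cos (pi * s / 2))))"
proof -
  define a where "a = (s + 1) / 2"
  define f where "f = (\<lambda>u. u powr (a - 1) / (c\<^sup>2 + u))"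
  define K where "K = c powr (s - 1) * (pi / cos (pi * s / 2))"
  have a: "0 < a" "a < 1" "2 * a - 1 = s" using s by (auto simp: a_def field_simps)
  have sin_cos: "sin (pi * a) = cos (pi * s / 2)"
  proof -
    have "pi * a = pi * s / 2 + pi / 2" by (simp add: a_def field_simps)
    then show ?thesis by (simp only: sin_add) simp
  qed
  have cq: "(c\<^sup>2) powr (a - 1) = c powr (s - 1)"
  proof -
    have "(c\<^sup>2) powr (a - 1) = (c powr 2) powr (a - 1)" using c by simp
    also have "\<dots> = c powr (2 * (a - 1))" by (simp only: powr_powr)
    also have "2 * (a - 1) = s - 1" by (simp add: a_def)
    finally show ?thesis .
  qed
  have K0: "K \<ge> 0" using cos_half_pi_mult_pos[OF s] by (simp add: K_def)
  have "(\<integral>\<^sup>+u. ennreal (indicator {0<..} u * f u) \<partial>lborel) = (\<integral>\<^sup>+u\<in>{0<..}. ennreal (f u) \<partial>lborel)"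
    by (intro nn_integral_cong) (auto simp: indicator_def)
  also have "\<dots> = ennreal K"
    using nn_integral_powr_over_add[OF a(1,2), of "c\<^sup>2"] c unfolding f_def K_def cq sin_cos by simp
  finally have "((\<lambda>u. indicator {0<..} u * f u) has_integral K) UNIV"
    using K0 by (intro nn_integral_has_integral) (auto simp: f_def indicator_def)
  also have "(\<lambda>u. indicator {0<..} u * f u) = (\<lambda>u. if u \<in> {0<..} then f u else 0)"
    by (auto simp: indicator_def fun_eq_iff)
  finally have f: "(f has_integral K) {0<..}" by (simp only: has_integral_restrict_UNIV)
  have img: "(\<lambda>x::real. x\<^sup>2) ` {0<..} = {0<..}"
  proof safe
    fix y :: real assume "0 < y"
    then show "y \<in> (\<lambda>x. x\<^sup>2) ` {0<..}" by (intro image_eqI[of _ _ "sqrt y"]) auto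
  qed auto
  have "f absolutely_integrable_on (\<lambda>x. x\<^sup>2) ` {0<..} \<and> integral ((\<lambda>x. x\<^sup>2) ` {0<..}) f = K"
    unfolding img using f
    by (auto intro!: nonnegative_absolutely_integrable_1 simp: f_def has_integral_iff)
  then have "(\<lambda>x. \<bar>2 * x\<bar> * f (x\<^sup>2)) absolutely_integrable_on {0<..} \<and>
      integral {0<..} (\<lambda>x. \<bar>2 * x\<bar> * f (x\<^sup>2)) = K"
    by (subst has_absolute_integral_change_of_variables_1')
       (auto intro!: derivative_eq_intros simp: inj_on_def)
  then have "((\<lambda>x. \<bar>2 * x\<bar> * f (x\<^sup>2)) has_integral K) {0<..}"
    by (auto simp: has_integral_iff set_lebesgue_integral_eq_integral(1))
  then have "((\<lambda>x. \<bar>2 * x\<bar> * f (x\<^sup>2) / 2) has_integral (K / 2)) {0<..}"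
    by (rule has_integral_divide)
  from nn_integral_has_integral_lebesgue'[OF _ this]
  have "(\<integral>\<^sup>+x\<in>{0<..}. ennreal (\<bar>2 * x\<bar> * f (x\<^sup>2) / 2) \<partial>lborel) = ennreal (K / 2)"
    by (simp add: f_def)
  also have "(\<integral>\<^sup>+x\<in>{0<..}. ennreal (\<bar>2 * x\<bar> * f (x\<^sup>2) / 2) \<partial>lborel) =
      (\<integral>\<^sup>+x\<in>{0<..}. ennreal (x powr s / (x\<^sup>2 + c\<^sup>2)) \<partial>lborel)"
  proof (rule set_nn_integral_cong)
    fix x :: real assume "x \<in> space lborel \<inter> {0<..}"
    then have x: "x > 0" by simp
    have "(x\<^sup>2) powr (a - 1) = (x powr 2) powr (a - 1)" using x by simp
    also have "\<dots> = x powr (2 * (a - 1))" by (simp only: powr_powr)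
    also have "2 * (a - 1) = s - 1" by (simp add: a_def)
    finally have "x * (x\<^sup>2) powr (a - 1) = x powr s" using x by (simp add: powr_diff)
    then show "ennreal (\<bar>2 * x\<bar> * f (x\<^sup>2) / 2) = ennreal (x powr s / (x\<^sup>2 + c\<^sup>2))"
    proof -
      have "2 * x * (p / q) / 2 = x * p / q" for p q :: real by simp
      moreover have "\<bar>2 * x\<bar> = 2 * x" using x by simp
      ultimately have "\<bar>2 * x\<bar> * f (x\<^sup>2) / 2 = x * (x\<^sup>2) powr (a - 1) / (c\<^sup>2 + x\<^sup>2)"
        by (simp only: f_def)
      then show ?thesis using \<open>x * (x\<^sup>2) powr (a - 1) = x powr s\<close> by (simp only: add.commute)
    qed
  qed auto
  finally show ?thesis by (simp add: K_def mult_ac)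
qed

section \<open>Partial fractions of the hyperbolic cotangent\<close>

lemma sinh_product_formula:
  assumes x: "x > 0"
  shows "(\<lambda>n. \<Prod>k=1..n. 1 + x\<^sup>2 / (4 * pi\<^sup>2 * (real k)\<^sup>2)) \<longlonglongrightarrow> sinh (x / 2) / (x / 2)"
proof -
  define z where "z = \<i> * of_real (x / (2 * pi))"
  have z2: "z\<^sup>2 = of_real (- x\<^sup>2 / (4 * pi\<^sup>2))"
    by (simp add: z_def power_mult_distrib power_divide)
  have pz: "of_real pi * z = \<i> * of_real (x / 2)" by (simp add: z_def field_simps)
  have "(\<lambda>n. of_real pi * z * (\<Prod>k=1..n. 1 - z\<^sup>2 / of_nat k ^ 2)) \<longlonglongrightarrow> sin (of_real pi * z)"
    by (rule sin_product_formula_complex)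
  also have "sin (of_real pi * z) = \<i> * of_real (sinh (x / 2))"
    unfolding pz by (simp add: sin_exp_eq sinh_def exp_of_real exp_minus scaleR_conv_of_real of_real_exp field_simps flip: exp_of_real)
  also have "(\<lambda>n. of_real pi * z * (\<Prod>k=1..n. 1 - z\<^sup>2 / of_nat k ^ 2)) =
    (\<lambda>n. \<i> * of_real (x / 2 * (\<Prod>k=1..n. 1 + x\<^sup>2 / (4 * pi\<^sup>2 * (real k)\<^sup>2))))"
    unfolding pz z2 by (simp add: mult_ac)
  finally have "(\<lambda>n. \<i> * of_real (x / 2 * (\<Prod>k=1..n. 1 + x\<^sup>2 / (4 * pi\<^sup>2 * (real k)\<^sup>2))))
      \<longlonglongrightarrow> \<i> * of_real (sinh (x / 2))" .
  from tendsto_Im[OF this]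
  have "(\<lambda>n. x / 2 * (\<Prod>k=1..n. 1 + x\<^sup>2 / (4 * pi\<^sup>2 * (real k)\<^sup>2))) \<longlonglongrightarrow> sinh (x / 2)"
    by (simp only: Im_i_times Re_complex_of_real)
  then have "(\<lambda>n. (x / 2 * (\<Prod>k=1..n. 1 + x\<^sup>2 / (4 * pi\<^sup>2 * (real k)\<^sup>2))) / (x / 2))
      \<longlonglongrightarrow> sinh (x / 2) / (x / 2)"
    by (intro tendsto_divide) (use x in \<open>auto\<close>)
  then show ?thesis using x by simp
qed

text \<open>The logarithmic derivative of the product for \<open>sinh (x / 2) / (x / 2)\<close>; the
  right-hand side is \<open>coth (x / 2) / 2 - 1 / x\<close>. Differentiation term by term is
  justified on the bounded interval \<open>S\<close>, where inverse squares dominate the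
  derivatives.\<close>

lemma coth_partial_fractions:
  assumes x: "x > 0"
  shows "(\<lambda>k. 2 * x / (x\<^sup>2 + (2 * pi * real (Suc k))\<^sup>2)) sums (1 / (exp x - 1) - 1 / x + 1 / 2)"
proof -
  define f where "f = (\<lambda>k x. ln (1 + x\<^sup>2 / (4 * pi\<^sup>2 * (real (Suc k))\<^sup>2)))"
  define f' where "f' = (\<lambda>k x. 2 * x / (x\<^sup>2 + (2 * pi * real (Suc k))\<^sup>2))"
  define S where "S = {0<..<x + 1}"
  have xS: "x \<in> S" using x by (simp add: S_def)
  have f_sums: "(\<lambda>k. f k y) sums ln (sinh (y / 2) / (y / 2))" if y: "y > 0" for y
  proof -
    have "(\<lambda>n. ln (\<Prod>k=1..n. 1 + y\<^sup>2 / (4 * pi\<^sup>2 * (real k)\<^sup>2))) \<longlonglongrightarrow> ln (sinh (y / 2) / (y / 2))"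
      using y by (intro tendsto_ln sinh_product_formula) auto
    also have "(\<lambda>n. ln (\<Prod>k=1..n. 1 + y\<^sup>2 / (4 * pi\<^sup>2 * (real k)\<^sup>2))) = (\<lambda>n. \<Sum>k<n. f k y)"
    proof
      fix n
      have ne: "1 + y\<^sup>2 / (4 * pi\<^sup>2 * (real k)\<^sup>2) \<noteq> 0" for k
        by (intro less_imp_neq[symmetric] add_pos_nonneg) auto
      have "ln (\<Prod>k=1..n. 1 + y\<^sup>2 / (4 * pi\<^sup>2 * (real k)\<^sup>2)) = (\<Sum>k=1..n. ln (1 + y\<^sup>2 / (4 * pi\<^sup>2 * (real k)\<^sup>2)))"
        by (rule ln_prod) (simp, rule ne)
      also have "\<dots> = (\<Sum>k<n. f k y)"
        unfolding f_def by (rule sum.reindex_bij_witness[of _ Suc "\<lambda>k. k - 1"]) auto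
      finally show "ln (\<Prod>k=1..n. 1 + y\<^sup>2 / (4 * pi\<^sup>2 * (real k)\<^sup>2)) = (\<Sum>k<n. f k y)" .
    qed
    finally show ?thesis by (simp add: sums_def)
  qed
  have deriv: "(f k has_field_derivative f' k y) (at y within S)" if "y \<in> S" for k y
  proof -
    define d where "d = 4 * pi\<^sup>2 * (real (Suc k))\<^sup>2"
    have d: "d > 0" by (simp add: d_def)
    then have pos: "1 + y\<^sup>2 / d > 0" by (intro add_pos_nonneg) auto
    have "((\<lambda>y. 1 + y\<^sup>2 / d) has_field_derivative 2 * y / d) (at y within S)"
      using d by (auto intro!: derivative_eq_intros simp: power2_eq_square)
    from DERIV_chain2[OF DERIV_ln_divide[OF pos] this]
    have "((\<lambda>y. ln (1 + y\<^sup>2 / d)) has_field_derivative (2 * y / d) / (1 + y\<^sup>2 / d)) (at y within S)"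
      by (simp add: mult.commute)
    moreover have "(2 * y / d) / (1 + y\<^sup>2 / d) = f' k y"
    proof -
      have "f' k y = 2 * y / (y\<^sup>2 + d)" by (simp add: f'_def d_def power_mult_distrib)
      also have "y\<^sup>2 + d = d * (1 + y\<^sup>2 / d)" using d by (simp add: field_simps)
      finally show ?thesis by simp
    qed
    ultimately show ?thesis by (simp add: f_def d_def)
  qed
  have f'_bd: "norm (f' k y) \<le> 2 * (x + 1) * (1 / (real (Suc k))\<^sup>2)" if "y \<in> S" for k y
  proof -
    have y: "0 < y" "y < x + 1" using that by (auto simp: S_def)
    have "2 * pi * real (Suc k) \<ge> 1 * real (Suc k)"
      using pi_ge_two by (intro mult_right_mono) auto
    then have "(real (Suc k))\<^sup>2 \<le> (2 * pi * real (Suc k))\<^sup>2"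
      by (intro power_mono) auto
    then have "(real (Suc k))\<^sup>2 \<le> y\<^sup>2 + (2 * pi * real (Suc k))\<^sup>2"
      using zero_le_power2[of y] by linarith
    then have "2 * y / (y\<^sup>2 + (2 * pi * real (Suc k))\<^sup>2) \<le> 2 * (x + 1) / (real (Suc k))\<^sup>2"
      using y by (intro frac_le) auto
    then show ?thesis using y by (simp add: f'_def)
  qed
  have sm: "summable (\<lambda>k. 2 * (x + 1) * (1 / (real (Suc k))\<^sup>2))"
    using inverse_squares_sums by (intro summable_mult) (auto simp: sums_iff add_ac)
  have unif: "uniformly_convergent_on S (\<lambda>n y. \<Sum>k<n. f' k y)"
    by (rule Weierstrass_m_test'[OF f'_bd sm])
  have "((\<lambda>y. \<Sum>k. f k y) has_field_derivative (\<Sum>k. f' k x)) (at x)"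
    by (rule has_field_derivative_series'(2)[OF _ deriv unif xS])
       (use xS f_sums[OF x] in \<open>auto simp: S_def sums_iff interior_open\<close>)
  moreover have "\<forall>\<^sub>F y in nhds x. (\<Sum>k. f k y) = ln (sinh (y / 2) / (y / 2))"
    using f_sums eventually_nhds_in_open[of S x] xS
    by (auto elim!: eventually_mono simp: S_def sums_iff)
  ultimately have D1: "((\<lambda>y. ln (sinh (y / 2) / (y / 2))) has_field_derivative (\<Sum>k. f' k x)) (at x)"
    by (simp add: DERIV_cong_ev)
  have "sinh (x / 2) > 0" using x by simp
  then have "((\<lambda>y. ln (sinh (y / 2) / (y / 2))) has_field_derivative
      cosh (x / 2) / (2 * sinh (x / 2)) - 1 / x) (at x)"
    using x by (auto intro!: derivative_eq_intros simp: field_simps)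
  from DERIV_unique[OF D1 this] have "(\<Sum>k. f' k x) = cosh (x / 2) / (2 * sinh (x / 2)) - 1 / x" .
  also have "cosh (x / 2) / (2 * sinh (x / 2)) = 1 / (exp x - 1) + 1 / 2"
  proof -
    define E where "E = exp (x / 2)"
    have "E > 1" using x by (simp add: E_def)
    then have "E * E > 1 * 1" by (intro mult_strict_mono) auto
    have "exp x = E * E" by (simp add: E_def flip: exp_add)
    moreover have "sinh (x / 2) = (E - 1 / E) / 2" "cosh (x / 2) = (E + 1 / E) / 2"
      unfolding sinh_field_def cosh_field_def E_def exp_minus inverse_eq_divide by simp_all
    moreover have "((E + 1 / E) / 2) / (2 * ((E - 1 / E) / 2)) = 1 / (E * E - 1) + 1 / 2"
    proof -
      have "E + 1 / E = (E * E + 1) / E" "E - 1 / E = (E * E - 1) / E"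
        using \<open>E > 1\<close> by (simp_all add: field_simps)
      then have "((E + 1 / E) / 2) / (2 * ((E - 1 / E) / 2)) = (E * E + 1) / (2 * (E * E - 1))"
        using \<open>E > 1\<close> by simp
      also have "\<dots> = 1 / (E * E - 1) + 1 / 2"
        using \<open>E * E > 1 * 1\<close> by (simp add: add_frac_eq mult_ac add_ac)
      finally show ?thesis .
    qed
    ultimately show ?thesis by (simp only:)
  qed
  finally have "(\<Sum>k. f' k x) = 1 / (exp x - 1) - 1 / x + 1 / 2" by simp
  moreover have "summable (\<lambda>k. f' k x)"
    by (rule summable_comparison_test'[OF sm, of 0]) (rule f'_bd[OF xS])
  ultimately show ?thesis by (simp add: sums_iff f'_def)
qed

lemma has_integral_parabola_exp:
  fixes a x :: real
  assumes x: "x > 0"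
  shows "((\<lambda>u. (u - a) * (a + 1 - u) * exp (- (u * x))) has_integral
    exp (- (a * x)) * (((x - 2) + (x + 2) * exp (- x)) / x ^ 3)) {a..a + 1}"
proof -
  \<comment> \<open>Integrating by parts until the derivatives of the parabola vanish gives this
    antiderivative; the cube of \<open>x\<close> belongs to its constant second derivative
    -2.\<close>
  define W where "W = (\<lambda>u. - exp (- (u * x)) * ((u - a) * (a + 1 - u) / x + (2 * a + 1 - 2 * u) / x\<^sup>2 - 2 / x ^ 3))"
  have "((\<lambda>u. (u - a) * (a + 1 - u) * exp (- (u * x))) has_integral (W (a + 1) - W a)) {a..a + 1}"
  proof (rule fundamental_theorem_of_calculus)
    fix u assume "u \<in> {a..a + 1}"
    have "(W has_real_derivative (u - a) * (a + 1 - u) * exp (- (u * x))) (at u)"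
      unfolding W_def using x
      by (auto intro!: derivative_eq_intros simp: field_simps power2_eq_square power3_eq_cube)
    then show "(W has_vector_derivative (u - a) * (a + 1 - u) * exp (- (u * x))) (at u within {a..a + 1})"
      by (simp add: has_real_derivative_iff_has_vector_derivative has_vector_derivative_at_within)
  qed simp
  also have "W (a + 1) - W a = exp (- (a * x)) * (((x - 2) + (x + 2) * exp (- x)) / x ^ 3)"
  proof -
    have "exp (- ((a + 1) * x)) = exp (- (a * x)) * exp (- x)"
      by (simp add: algebra_simps flip: exp_add)
    then show ?thesis
      using x by (simp add: W_def field_simps power2_eq_square power3_eq_cube)
  qed
  finally show ?thesis .
qed

text \<open>A geometric series over the unit intervals. Its value, the Laplace transform of
  \<open>{u} (1 - {u})\<close>, contains exactly the function whose partial fractions are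
  known.\<close>

lemma parabola_exp_sums:
  fixes x :: real
  assumes x: "x > 0"
  shows "(\<lambda>n. exp (- (real n * x)) * (((x - 2) + (x + 2) * exp (- x)) / x ^ 3)) sums
    (2 / x\<^sup>2 * (1 / (exp x - 1) - 1 / x + 1 / 2))"
proof -
  have "norm (exp (- x)) < 1" using x by simp
  then have "(\<lambda>n. exp (- x) ^ n * (((x - 2) + (x + 2) * exp (- x)) / x ^ 3)) sums
    (1 / (1 - exp (- x)) * (((x - 2) + (x + 2) * exp (- x)) / x ^ 3))"
    by (intro sums_mult2 geometric_sums)
  moreover have "exp (- x) ^ n = exp (- (real n * x))" for n
    by (simp flip: exp_of_nat_mult)
  moreover have "1 / (1 - exp (- x)) * (((x - 2) + (x + 2) * exp (- x)) / x ^ 3) =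
      2 / x\<^sup>2 * (1 / (exp x - 1) - 1 / x + 1 / 2)"
  proof -
    define E where "E = exp x"
    have "E > 1" using x by (simp add: E_def)
    then show ?thesis using x unfolding exp_minus E_def[symmetric]
      by (simp add: field_simps power2_eq_square power3_eq_cube)
  qed
  ultimately show ?thesis by simp
qed

text \<open>
  Each side is the integral of \<open>x powr (s + 1)\<close> against the Laplace transform of the periodic
  function \<open>{u} (1 - {u})\<close>, computed interval by interval on the left and by partial fractions
  on the right.
\<close>

lemma periodic_parabola_mellin:
  fixes s :: real
  assumes s: "-1 < s" "s < 0"
  assumes Q: "\<And>n. ((\<lambda>u. (u - real n) * (real n + 1 - u) * u powr (- s - 2)) has_integral Q n) {real n..real n + 1}"
  assumes Z: "Q sums Z"
  shows "Gamma (s + 2) * Z = (2 * pi) powr s / cos (pi * s / 2) * Re (zeta (of_real (1 - s)))"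
proof -
  define p where "p = (\<lambda>n u. (u - real n) * (real n + 1 - u))"
  define q where "q = (\<lambda>x::real. ((x - 2) + (x + 2) * exp (- x)) / x ^ 3)"
  have p0: "p n u \<ge> 0" if "u \<in> {real n..real n + 1}" for n u
    using that by (simp add: p_def)
  have q0: "q x \<ge> 0" if "x > 0" for x
    using has_integral_nonneg[OF has_integral_parabola_exp[OF that, of 0]] by (auto simp: q_def)
  have Q0: "Q n \<ge> 0" for n
    by (rule has_integral_nonneg[OF Q]) auto
  have G0: "Gamma (s + 2) > 0" using s by (intro Gamma_real_pos) auto
  \<comment> \<open>Replace \<open>Gamma (s + 2) * u powr (- s - 2)\<close> by the integral of
    \<open>x powr (s + 1) * exp (- (u * x))\<close> over \<open>x > 0\<close>, then integrate over
    \<open>u\<close> first.\<close>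
  have step: "ennreal (Gamma (s + 2) * Q n) =
      (\<integral>\<^sup>+x\<in>{0<..}. ennreal (x powr (s + 1) * (exp (- (real n * x)) * q x)) \<partial>lborel)" for n
  proof -
    have "ennreal (Gamma (s + 2) * Q n) = ennreal (Gamma (s + 2)) *
        (\<integral>\<^sup>+u\<in>{real n..real n + 1}. ennreal (p n u * u powr (- s - 2)) \<partial>lborel)"
      using nn_integral_has_integral_lebesgue'[OF _ Q[of n]] p0[of _ n] G0 Q0[of n]
      by (simp add: p_def ennreal_mult)
    also have "\<dots> = (\<integral>\<^sup>+u. ennreal (Gamma (s + 2)) *
        (ennreal (p n u * u powr (- s - 2)) * indicator {real n..real n + 1} u) \<partial>lborel)"
      by (rule nn_integral_cmult [symmetric]) (simp add: p_def)
    also have "\<dots> = (\<integral>\<^sup>+u. \<integral>\<^sup>+x. ennreal (p n u * (x powr (s + 1) * exp (- (u * x)))) *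
        indicator {real n..real n + 1} u * indicator {0<..} x \<partial>lborel \<partial>lborel)"
    proof (intro nn_integral_cong)
      fix u :: real
      show "ennreal (Gamma (s + 2)) * (ennreal (p n u * u powr (- s - 2)) * indicator {real n..real n + 1} u) =
        (\<integral>\<^sup>+x. ennreal (p n u * (x powr (s + 1) * exp (- (u * x)))) *
        indicator {real n..real n + 1} u * indicator {0<..} x \<partial>lborel)"
      \<comment> \<open>The point \<open>u = 0\<close> belongs only to the interval with
        \<open>n = 0\<close>. The Laplace integral diverges there, but the parabola
        vanishes.\<close>
      proof (cases "u \<in> {real n..real n + 1} \<and> u \<noteq> 0")
        case True
        then have u: "u > 0" "u \<in> {real n..real n + 1}" by auto
        have "(\<integral>\<^sup>+x. ennreal (p n u * (x powr (s + 1) * exp (- (u * x)))) *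
          indicator {real n..real n + 1} u * indicator {0<..} x \<partial>lborel) =
          (\<integral>\<^sup>+x. ennreal (p n u) * (ennreal (x powr (s + 2 - 1) * exp (- (u * x))) * indicator {0<..} x) \<partial>lborel)"
          using u p0[OF u(2)] by (intro nn_integral_cong) (auto simp: indicator_def add.commute[of 1 s] simp flip: ennreal_mult)
        also have "\<dots> = ennreal (p n u) * ennreal (Gamma (s + 2) * u powr (- (s + 2)))"
          using u s by (subst nn_integral_cmult, simp, subst nn_integral_powr_exp) auto
        also have "\<dots> = ennreal (Gamma (s + 2)) * ennreal (p n u * u powr (- s - 2))"
        proof -
          have "- (s + 2) = - s - 2" by simp
          moreover have "ennreal a * ennreal (b * c) = ennreal b * ennreal (a * c)"
            if "a \<ge> 0" "b \<ge> 0" "c \<ge> 0" for a b c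
            using that by (simp add: mult_ac flip: ennreal_mult)
          ultimately show ?thesis using p0[OF u(2)] G0 by (simp only:) auto
        qed
        finally show ?thesis using u by simp
      next
        case False
        then have "u \<notin> {real n..real n + 1} \<or> p n u = 0" by (auto simp: p_def)
        then show ?thesis by auto
      qed
    qed
    also have "\<dots> = (\<integral>\<^sup>+x. \<integral>\<^sup>+u. ennreal (p n u * (x powr (s + 1) * exp (- (u * x)))) *
        indicator {real n..real n + 1} u * indicator {0<..} x \<partial>lborel \<partial>lborel)"
      by (rule lborel_pair.Fubini') (simp add: p_def)
    also have "\<dots> = (\<integral>\<^sup>+x\<in>{0<..}. ennreal (x powr (s + 1) * (exp (- (real n * x)) * q x)) \<partial>lborel)"
    proof (intro nn_integral_cong)
      fix x :: real
      show "(\<integral>\<^sup>+u. ennreal (p n u * (x powr (s + 1) * exp (- (u * x)))) *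
        indicator {real n..real n + 1} u * indicator {0<..} x \<partial>lborel) =
        ennreal (x powr (s + 1) * (exp (- (real n * x)) * q x)) * indicator {0<..} x"
      proof (cases "x > 0")
        case True
        have "(\<integral>\<^sup>+u. ennreal (p n u * (x powr (s + 1) * exp (- (u * x)))) *
          indicator {real n..real n + 1} u * indicator {0<..} x \<partial>lborel) =
          (\<integral>\<^sup>+u. ennreal (x powr (s + 1)) * (ennreal (p n u * exp (- (u * x))) * indicator {real n..real n + 1} u) \<partial>lborel)"
          using True p0 by (intro nn_integral_cong) (auto simp: indicator_def mult_ac simp flip: ennreal_mult)
        also have "\<dots> = ennreal (x powr (s + 1)) *
           (\<integral>\<^sup>+u\<in>{real n..real n + 1}. ennreal (p n u * exp (- (u * x))) \<partial>lborel)"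
          by (rule nn_integral_cmult) (simp add: p_def)
        also have "(\<integral>\<^sup>+u\<in>{real n..real n + 1}. ennreal (p n u * exp (- (u * x))) \<partial>lborel) =
           ennreal (exp (- (real n * x)) * q x)"
          using nn_integral_has_integral_lebesgue'[OF _ has_integral_parabola_exp[OF True, of "real n"]]
          by (simp add: p_def q_def)
        finally show ?thesis using True q0[OF True] by (simp flip: ennreal_mult)
      qed auto
    qed
    finally show ?thesis .
  qed
  have c0: "cos (pi * s / 2) > 0" using s by (intro cos_half_pi_mult_pos) auto
  \<comment> \<open>The factor 4 collects the 2 from the geometric series and the 2 from the partial
    fraction: \<open>x powr (s + 1) * (2 / x\<^sup>2) * (2 * x)\<close> is
    \<open>4 * x powr s\<close>.\<close>
  define D where "D = (\<lambda>k. 4 * ((2 * pi * real (Suc k)) powr (s - 1) * (pi / (2 * cos (pi * s / 2)))))"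
  have D0: "D k \<ge> 0" for k using c0 by (simp add: D_def)
  have step2: "(\<integral>\<^sup>+x\<in>{0<..}. ennreal (4 * (x powr s / (x\<^sup>2 + (2 * pi * real (Suc k))\<^sup>2))) \<partial>lborel) = ennreal (D k)" for k
  proof -
    have "(\<integral>\<^sup>+x\<in>{0<..}. ennreal (4 * (x powr s / (x\<^sup>2 + (2 * pi * real (Suc k))\<^sup>2))) \<partial>lborel) =
       (\<integral>\<^sup>+x. 4 * (ennreal (x powr s / (x\<^sup>2 + (2 * pi * real (Suc k))\<^sup>2)) * indicator {0<..} x) \<partial>lborel)"
      by (intro nn_integral_cong) (subst ennreal_mult, simp_all add: mult.assoc)
    also have "\<dots> = 4 * (\<integral>\<^sup>+x\<in>{0<..}. ennreal (x powr s / (x\<^sup>2 + (2 * pi * real (Suc k))\<^sup>2)) \<partial>lborel)"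
      by (rule nn_integral_cmult) simp
    also have "\<dots> = 4 * ennreal ((2 * pi * real (Suc k)) powr (s - 1) * (pi / (2 * cos (pi * s / 2))))"
      using s by (subst nn_integral_powr_over_sum_squares) auto
    also have "\<dots> = ennreal (D k)"
      using c0 unfolding D_def by (subst ennreal_mult) auto
    finally show ?thesis .
  qed
  have "ennreal (Gamma (s + 2) * Z) = (\<Sum>n. ennreal (Gamma (s + 2) * Q n))"
    using sums_mult[OF Z, of "Gamma (s + 2)"] Q0 G0 by (subst suminf_ennreal2) (auto simp: sums_iff)
  also have "\<dots> = (\<integral>\<^sup>+x. (\<Sum>n. ennreal (x powr (s + 1) * (exp (- (real n * x)) * q x)) * indicator {0<..} x) \<partial>lborel)"
    unfolding step by (rule nn_integral_suminf [symmetric]) (simp add: q_def)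
  also have "\<dots> = (\<integral>\<^sup>+x. (\<Sum>k. ennreal (4 * (x powr s / (x\<^sup>2 + (2 * pi * real (Suc k))\<^sup>2))) * indicator {0<..} x) \<partial>lborel)"
  proof (intro nn_integral_cong)
    fix x :: real
    show "(\<Sum>n. ennreal (x powr (s + 1) * (exp (- (real n * x)) * q x)) * indicator {0<..} x) =
      (\<Sum>k. ennreal (4 * (x powr s / (x\<^sup>2 + (2 * pi * real (Suc k))\<^sup>2))) * indicator {0<..} x)"
    proof (cases "x > 0")
      case True
      define g where "g = 1 / (exp x - 1) - 1 / x + 1 / 2"
      have 1: "(\<lambda>n. x powr (s + 1) * (exp (- (real n * x)) * q x)) sums (x powr (s + 1) * (2 / x\<^sup>2 * g))"
        unfolding q_def g_def by (intro sums_mult parabola_exp_sums True)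
      have "(\<lambda>k. x powr (s + 1) * (2 / x\<^sup>2 * (2 * x / (x\<^sup>2 + (2 * pi * real (Suc k))\<^sup>2)))) sums (x powr (s + 1) * (2 / x\<^sup>2 * g))"
        unfolding g_def by (intro sums_mult coth_partial_fractions True)
      also have "(\<lambda>k. x powr (s + 1) * (2 / x\<^sup>2 * (2 * x / (x\<^sup>2 + (2 * pi * real (Suc k))\<^sup>2)))) =
        (\<lambda>k. 4 * (x powr s / (x\<^sup>2 + (2 * pi * real (Suc k))\<^sup>2)))"
      proof
        fix k
        have "x powr (s + 1) * (2 / x\<^sup>2 * (2 * x / d)) = 4 * (x powr s / d)" for d
          using True by (simp add: powr_add power2_eq_square)
        then show "x powr (s + 1) * (2 / x\<^sup>2 * (2 * x / (x\<^sup>2 + (2 * pi * real (Suc k))\<^sup>2))) =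
          4 * (x powr s / (x\<^sup>2 + (2 * pi * real (Suc k))\<^sup>2))" .
      qed
      finally have 2: "(\<lambda>k. 4 * (x powr s / (x\<^sup>2 + (2 * pi * real (Suc k))\<^sup>2))) sums (x powr (s + 1) * (2 / x\<^sup>2 * g))" .
      have "(\<Sum>n. ennreal (x powr (s + 1) * (exp (- (real n * x)) * q x))) = ennreal (x powr (s + 1) * (2 / x\<^sup>2 * g))"
        using 1 q0[OF True] by (subst suminf_ennreal2) (auto simp: sums_iff)
      moreover have "(\<Sum>k. ennreal (4 * (x powr s / (x\<^sup>2 + (2 * pi * real (Suc k))\<^sup>2)))) = ennreal (x powr (s + 1) * (2 / x\<^sup>2 * g))"
        using 2 by (subst suminf_ennreal2) (auto simp: sums_iff)
      ultimately show ?thesis using True by simp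
    qed auto
  qed
  also have "\<dots> = (\<Sum>k. (\<integral>\<^sup>+x\<in>{0<..}. ennreal (4 * (x powr s / (x\<^sup>2 + (2 * pi * real (Suc k))\<^sup>2))) \<partial>lborel))"
    by (rule nn_integral_suminf) simp
  also have "\<dots> = (\<Sum>k. ennreal (D k))" by (simp only: step2)
  finally have main: "ennreal (Gamma (s + 2) * Z) = (\<Sum>k. ennreal (D k))" .
  have "(\<lambda>k. (2 * pi) powr s / cos (pi * s / 2) * real (Suc k) powr (- (1 - s))) sums
      ((2 * pi) powr s / cos (pi * s / 2) * Re (zeta (of_real (1 - s))))"
    using s by (intro sums_mult zeta_of_real_sums) auto
  also have "(\<lambda>k. (2 * pi) powr s / cos (pi * s / 2) * real (Suc k) powr (- (1 - s))) = D"
  proof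
    fix k
    have "D k = 4 * ((2 * pi) powr (s - 1) * real (Suc k) powr (s - 1)) * (pi / (2 * cos (pi * s / 2)))"
      by (simp add: D_def powr_mult)
    also have "(2 * pi) powr (s - 1) = (2 * pi) powr s / (2 * pi)" by (simp add: powr_diff)
    finally show "(2 * pi) powr s / cos (pi * s / 2) * real (Suc k) powr (- (1 - s)) = D k"
      by (simp add: field_simps)
  qed
  finally have D: "D sums ((2 * pi) powr s / cos (pi * s / 2) * Re (zeta (of_real (1 - s))))" .
  have "ennreal (Gamma (s + 2) * Z) = ennreal ((2 * pi) powr s / cos (pi * s / 2) * Re (zeta (of_real (1 - s))))"
    unfolding main using D D0 by (subst suminf_ennreal2) (auto simp: sums_iff)
  moreover have "Z \<ge> 0" using Z Q0 by (auto simp: sums_iff intro!: suminf_nonneg)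
  moreover have "(2 * pi) powr s / cos (pi * s / 2) * Re (zeta (of_real (1 - s))) \<ge> 0"
    using sums_unique[OF D] suminf_nonneg[OF sums_summable[OF D] D0] by linarith
  ultimately show ?thesis using G0 by (subst (asm) ennreal_inj) auto
qed

text \<open>For \<open>-1 < s < 0\<close> the integral of
  \<open>{u} (1 - {u}) u powr (- s - 2)\<close> converges at both ends. Multiplied by
  \<open>k\<close>, its part over \<open>{0..1}\<close> is exactly
  \<open>1 / 2 + 1 / (s - 1)\<close>, the terms that separate zeta from the sum of the trapezoidal
  errors. So zeta at \<open>s\<close> is \<open>k\<close> times the integral over the whole
  half-line, and its Mellin evaluation is the functional equation.\<close>

lemma zeta_functional_equation_real:
  fixes s :: real
  assumes s: "-1 < s" "s < 0"
  shows "rGamma (of_real s) * zeta (1 - of_real s) =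
    2 * of_real (2 * pi) powr (- of_real s) * cos (of_real pi * of_real s / 2) * zeta (of_real s)"
proof -
  define Q where "Q = (\<lambda>n. integral {real n..real n + 1} (\<lambda>u. (u - real n) * (real n + 1 - u) * u powr (- s - 2)))"
  define k where "k = s * (s + 1) / 2"
  have k: "k \<noteq> 0" using s by (simp add: k_def)
  have s1: "complex_of_real s \<noteq> 1" using s by (simp add: complex_eq_iff)
  have Q_Suc: "((\<lambda>u. (u - a) * (a + 1 - u) * u powr (- s - 2)) has_integral Re (em_term a (of_real s)) / k) {a..a + 1}
      \<and> em_term a (of_real s) = of_real (Re (em_term a (of_real s)))" if a: "a > 0" for a
  proof
    have I: "((\<lambda>u. of_real (k * ((u - a) * (a + 1 - u) * u powr (- s - 2)))) has_integral em_term a (of_real s)) {a..a + 1}"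
    proof (rule has_integral_eq[OF _ has_integral_em_term[OF a s1]])
      fix u assume "u \<in> {a..a + 1}"
      then have "u > 0" using a by auto
      then have "complex_of_real u powr (- of_real s - 2) = of_real (u powr (- s - 2))"
        using powr_of_real[of u "- s - 2"] by simp
      then show "complex_of_real s * (of_real s + 1) / 2 * of_real ((u - a) * (a + 1 - u)) * of_real u powr (- of_real s - 2)
        = of_real (k * ((u - a) * (a + 1 - u) * u powr (- s - 2)))"
        by (simp add: k_def)
    qed
    from has_integral_linear[OF I bounded_linear_Re]
    have R: "((\<lambda>u. k * ((u - a) * (a + 1 - u) * u powr (- s - 2))) has_integral Re (em_term a (of_real s))) {a..a + 1}"
      by (simp only: o_def Re_complex_of_real)
    from has_integral_divide[OF this, of k] show "((\<lambda>u. (u - a) * (a + 1 - u) * u powr (- s - 2)) has_integral Re (em_term a (of_real s)) / k) {a..a + 1}"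
      using k by simp
    have "((\<lambda>u. complex_of_real (k * ((u - a) * (a + 1 - u) * u powr (- s - 2)))) has_integral of_real (Re (em_term a (of_real s)))) {a..a + 1}"
      by (rule has_integral_linear[OF R bounded_linear_of_real, unfolded o_def])
    from has_integral_unique[OF I this] show "em_term a (of_real s) = of_real (Re (em_term a (of_real s)))" .
  qed
  have Q_0: "((\<lambda>u. (u - 0) * (0 + 1 - u) * u powr (- s - 2)) has_integral (1 / (- s) - 1 / (1 - s))) {0..0 + 1}"
  proof -
    have "((\<lambda>u. u powr (- s - 1) - u powr (- s)) has_integral (1 powr (- s - 1 + 1) / (- s - 1 + 1) - 1 powr (- s + 1) / (- s + 1))) {0..1}"
      by (intro has_integral_diff has_integral_powr_from_0) (use s in auto)
    then have "((\<lambda>u. u powr (- s - 1) - u powr (- s)) has_integral (1 / (- s) - 1 / (1 - s))) {0..0 + 1}"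
      by (simp add: add.commute)
    moreover have "u powr (- s - 1) - u powr (- s) = (u - 0) * (0 + 1 - u) * u powr (- s - 2)" if "u \<in> {0..0 + 1}" for u :: real
    proof (cases "u = 0")
      case False
      with that have "u > 0" by auto
      then have "u powr (- s - 1) = u * u powr (- s - 2)" "u powr (- s) = u * u * u powr (- s - 2)"
        by (simp_all add: powr_diff powr_minus power2_eq_square field_simps)
      then show ?thesis by (simp add: algebra_simps)
    qed auto
    ultimately show ?thesis by (rule has_integral_eq[rotated])
  qed
  have Q: "((\<lambda>u. (u - real n) * (real n + 1 - u) * u powr (- s - 2)) has_integral Q n) {real n..real n + 1}" for n
    unfolding Q_def using Q_0 Q_Suc[of "real n"]
    by (cases "n = 0") (auto intro!: integrable_integral has_integral_integrable simp: has_integral_integrable)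
  have Q0_eq: "Q 0 = 1 / (- s) - 1 / (1 - s)" using has_integral_unique[OF Q[of 0]] Q_0 by simp
  have QSuc_eq: "Q (Suc n) = Re (em_term (real (Suc n)) (of_real s)) / k" for n
    using has_integral_unique[OF Q[of "Suc n"]] Q_Suc[of "real (Suc n)"] by simp
  define R where "R = Re (zeta (of_real s) - 1 / 2 - 1 / (of_real s - 1))"
  have em: "(\<lambda>n. em_term (real (Suc n)) (of_real s)) sums (zeta (of_real s) - 1 / 2 - 1 / (of_real s - 1))"
    using s s1 by (intro em_sums) auto
  have emR: "(\<lambda>n. Re (em_term (real (Suc n)) (of_real s))) sums R"
    unfolding R_def by (rule sums_Re[OF em])
  have "(\<lambda>n. complex_of_real (Re (em_term (real (Suc n)) (of_real s)))) sums of_real R"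
    by (rule sums_of_real[OF emR])
  then have "(\<lambda>n. em_term (real (Suc n)) (of_real s)) sums of_real R"
    using Q_Suc by (simp del: of_nat_Suc)
  from sums_unique2[OF em this]
  have zR: "zeta (of_real s) = of_real (R + 1 / 2 + 1 / (s - 1))" by (simp add: algebra_simps)
  have "(\<lambda>n. Q (Suc n)) sums (R / k)"
    unfolding QSuc_eq by (rule sums_divide[OF emR])
  then have "Q sums (R / k + Q 0)" by (simp add: sums_Suc_iff)
  note FE = periodic_parabola_mellin[OF s Q this]
  have "k * Q 0 = 1 / 2 + 1 / (s - 1)"
    unfolding Q0_eq k_def using s by (simp add: field_simps)
  then have "k * (R / k + Q 0) = R + 1 / 2 + 1 / (s - 1)" using k by (simp add: algebra_simps)
  then have zk: "zeta (of_real s) = of_real (k * (R / k + Q 0))" using zR by simp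
  have z1: "zeta (1 - of_real s) = of_real (Re (zeta (of_real (1 - s))))"
    using zeta_of_real_sums(2)[of "1 - s"] s by simp
  have c0: "cos (pi * s / 2) > 0" using s by (intro cos_half_pi_mult_pos) auto
  have rG: "rGamma s = s * (s + 1) / Gamma (s + 2)"
    using rGamma_plus1[of s] rGamma_plus1[of "s + 1"] by (simp add: rGamma_inverse_Gamma add.assoc divide_inverse mult_ac)
  have "rGamma s * Re (zeta (of_real (1 - s))) = 2 * (2 * pi) powr (- s) * cos (pi * s / 2) * (k * (R / k + Q 0))"
  proof -
    define X where "X = R / k + Q 0"
    have G: "Gamma (s + 2) > 0" using s by (intro Gamma_real_pos) auto
    have "(2 * pi) powr (- s) * (2 * pi) powr s = 1" by (simp flip: powr_add)
    moreover have "A * c * (B / c * y) = (A * B) * y" if "c > 0" for A B c y :: real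
      using that by simp
    ultimately have "(2 * pi) powr (- s) * cos (pi * s / 2) * (Gamma (s + 2) * X) = Re (zeta (of_real (1 - s)))"
      using c0 FE unfolding X_def[symmetric] by (simp only:)
    then have "rGamma s * Re (zeta (of_real (1 - s))) = (s * (s + 1) / Gamma (s + 2)) * ((2 * pi) powr (- s) * cos (pi * s / 2) * (Gamma (s + 2) * X))"
      unfolding rG by simp
    also have "\<dots> = 2 * (2 * pi) powr (- s) * cos (pi * s / 2) * (k * X)"
      using G by (simp add: k_def)
    finally show ?thesis by (simp add: X_def)
  qed
  then have "complex_of_real (rGamma s * Re (zeta (of_real (1 - s)))) =
      of_real (2 * (2 * pi) powr (- s) * cos (pi * s / 2) * (k * (R / k + Q 0)))" by simp
  moreover have "complex_of_real (2 * pi) powr (- of_real s) = of_real ((2 * pi) powr (- s))"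
    using powr_of_real[of "2 * pi" "- s"] by simp
  moreover have "cos (complex_of_real pi * of_real s / 2) = of_real (cos (pi * s / 2))"
    using cos_of_real[of "pi * s / 2", where 'a = complex] by simp
  ultimately show ?thesis
    unfolding z1 zk by (simp only: of_real_mult of_real_numeral rGamma_complex_of_real)
qed

text \<open>With \<open>rGamma\<close> instead of \<open>Gamma\<close> both sides are holomorphic
  away from 0 and 1, the poles of \<open>zeta (1 - s)\<close> and \<open>zeta s\<close>, so
  agreement on a real segment suffices.\<close>

theorem zeta_functional_equation:
  assumes "s \<noteq> 0" "s \<noteq> 1"
  shows "rGamma s * zeta (1 - s) = 2 * of_real (2 * pi) powr (- s) * cos (of_real pi * s / 2) * zeta s"
proof -
  define f where "f = (\<lambda>s. rGamma s * zeta (1 - s) - 2 * of_real (2 * pi) powr (- s) * cos (of_real pi * s / 2) * zeta s)"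
  have "f s = 0"
  proof (rule analytic_continuation[of f "- {0, 1}" "of_real ` {-3/4..-1/4}" "of_real (-1/2)" s])
    have "zeta \<circ> (\<lambda>s. 1 - s) holomorphic_on (- {0, 1})"
      by (rule holomorphic_on_compose) (auto intro!: holomorphic_intros)
    then have "(\<lambda>s. zeta (1 - s)) holomorphic_on (- {0, 1})" by (simp add: o_def)
    then show "f holomorphic_on - {0, 1}" unfolding f_def
      by (intro holomorphic_intros) auto
    have "- {0, 1} = UNIV - {0, 1 :: complex}" by auto
    then show "connected (- {0, 1 :: complex})"
      by (metis connected_open_delete_finite open_UNIV connected_UNIV DIM_complex finite.emptyI finite.insertI order_refl)
    show "of_real ` {-3/4..-1/4::real} \<subseteq> - {0, 1 :: complex}"
      by (auto simp: complex_eq_iff)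
    show "complex_of_real (-1/2) islimpt of_real ` {-3/4..-1/4}"
    proof -
      have "(-1/2::real) islimpt {-3/4..-1/4}"
        by (intro interior_limit_point) (auto simp: interior_atLeastAtMost_real)
      then show ?thesis by (rule islimpt_isCont_image)
         (simp, simp only: of_real_eq_iff eventually_at_filter, simp)
    qed
    show "f z = 0" if z: "z \<in> of_real ` {-3/4..-1/4::real}" for z
    proof -
      from z obtain x :: real where x: "z = of_real x" "-3/4 \<le> x" "x \<le> -1/4" by auto
      then show ?thesis using zeta_functional_equation_real[of x] by (simp add: f_def)
    qed
  qed (use assms in \<open>auto simp: complex_eq_iff\<close>)
  then show ?thesis by (simp add: f_def)
qed

section \<open>Reflection of lower bounds in the critical line\<close>

text \<open>The quotient of \<open>cmod (Gamma (Complex x t))\<close> by \<open>Gamma x\<close>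
  increases with \<open>x\<close>, because every factor
  \<open>(x + k) / cmod (Complex (x + k) t)\<close> of Euler's limit formula does.\<close>

lemma norm_Gamma_ratio_mono:
  fixes u v t :: real
  assumes v: "0 < v" "v \<le> u"
  shows "Gamma u * cmod (Gamma (Complex v t)) \<le> Gamma v * cmod (Gamma (Complex u t))"
proof (rule tendsto_le[OF sequentially_bot])
  show "(\<lambda>n. Gamma_series v n * cmod (Gamma_series (Complex u t) n)) \<longlonglongrightarrow> Gamma v * cmod (Gamma (Complex u t))"
    by (intro tendsto_intros)
  show "(\<lambda>n. Gamma_series u n * cmod (Gamma_series (Complex v t) n)) \<longlonglongrightarrow> Gamma u * cmod (Gamma (Complex v t))"
    by (intro tendsto_intros)
  have factor: "(v + k) * cmod (Complex u t + of_real k) \<le> (u + k) * cmod (Complex v t + of_real k)"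
    if "k \<ge> 0" for k
  proof (rule power2_le_imp_le)
    have e: "(cmod (Complex a t + of_real k))\<^sup>2 = (a + k)\<^sup>2 + t\<^sup>2" for a
      by (simp add: cmod_power2)
    have "(v + k)\<^sup>2 \<le> (u + k)\<^sup>2" using v that by (intro power_mono) auto
    then have "(v + k)\<^sup>2 * t\<^sup>2 \<le> (u + k)\<^sup>2 * t\<^sup>2" by (rule mult_right_mono) simp
    then show "((v + k) * cmod (Complex u t + of_real k))\<^sup>2 \<le> ((u + k) * cmod (Complex v t + of_real k))\<^sup>2"
      unfolding power_mult_distrib e by (simp add: algebra_simps)
  qed (use v that in auto)
  have "Gamma_series u n * cmod (Gamma_series (Complex v t) n) \<le> Gamma_series v n * cmod (Gamma_series (Complex u t) n)" for n
  proof -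
    define P where "P = (\<lambda>a. \<Prod>k=0..n. a + real k)"
    define R where "R = (\<lambda>a. \<Prod>k=0..n. cmod (Complex a t + of_real (real k)))"
    have PR0: "P a > 0" "R a > 0" if "a > 0" for a
      unfolding P_def R_def using that by (auto intro!: prod_pos simp: complex_eq_iff)
    have "(\<Prod>k=0..n. (v + real k) * cmod (Complex u t + of_real (real k))) \<le>
      (\<Prod>k=0..n. (u + real k) * cmod (Complex v t + of_real (real k)))"
      using v by (intro prod_mono conjI factor mult_nonneg_nonneg) auto
    then have le: "P v * R u \<le> P u * R v" by (simp add: P_def R_def prod.distrib)
    have gs: "Gamma_series a n = fact n * exp (a * ln (real n)) / P a" for a
      by (simp add: Gamma_series_def P_def pochhammer_prod atLeastLessThanSuc_atLeastAtMost add.commute)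
    have gc: "cmod (Gamma_series (Complex a t) n) = fact n * exp (a * ln (real n)) / R a" for a
      by (simp add: Gamma_series_def R_def pochhammer_prod atLeastLessThanSuc_atLeastAtMost
          norm_mult norm_divide prod_norm del: of_nat_Suc)
    have "1 / (P u * R v) \<le> 1 / (P v * R u)"
      using le PR0 v by (intro divide_left_mono mult_pos_pos) auto
    then have "(fact n * exp (u * ln (real n))) * (fact n * exp (v * ln (real n))) * (1 / (P u * R v)) \<le>
      (fact n * exp (u * ln (real n))) * (fact n * exp (v * ln (real n))) * (1 / (P v * R u))"
      by (intro mult_left_mono) auto
    then show ?thesis unfolding gs gc by (simp add: mult_ac)
  qed
  then show "\<forall>\<^sub>F n in sequentially. Gamma_series u n * cmod (Gamma_series (Complex v t) n) \<le> Gamma_series v n * cmod (Gamma_series (Complex u t) n)"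
    by simp
qed

lemma norm_Gamma_half:
  "(cmod (Gamma (Complex (1/2) t)))\<^sup>2 = pi / cosh (pi * t)"
proof -
  have "(cmod (Gamma (Complex (1/2) t)))\<^sup>2 = cmod (Gamma (Complex (1/2) t) * cnj (Gamma (Complex (1/2) t)))"
    by (simp add: norm_mult power2_eq_square)
  also have "cnj (Gamma (Complex (1/2) t)) = Gamma (1 - Complex (1/2) t)"
    unfolding cnj_Gamma by (rule arg_cong[of _ _ Gamma]) (simp add: complex_eq_iff)
  also have "Gamma (Complex (1/2) t) * Gamma (1 - Complex (1/2) t) = of_real pi / sin (of_real pi * Complex (1/2) t)"
    by (rule Gamma_reflection_complex)
  also have "sin (of_real pi * Complex (1/2) t) = of_real (cosh (pi * t))"
  proof -
    have "of_real pi * Complex (1/2) t = of_real pi / 2 + \<i> * of_real (pi * t)"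
      by (simp add: complex_eq_iff)
    then have "sin (of_real pi * Complex (1/2) t) = cos (\<i> * of_real (pi * t))"
      by (simp only: sin_add) simp
    also have "\<dots> = of_real (cosh (pi * t))"
    proof -
      have "exp (of_real pi * of_real t) = complex_of_real (exp (pi * t))"
        by (simp add: exp_of_real flip: of_real_mult)
      then show ?thesis by (simp add: cosh_conv_cos [symmetric] cosh_field_def exp_minus)
    qed
    finally show ?thesis .
  qed
  also have "cmod (of_real pi / of_real (cosh (pi * t))) = pi / cosh (pi * t)"
    by (simp add: norm_divide)
  finally show ?thesis .
qed

text \<open>The exponential growth of the cosine cancels the exponential decay of
  \<open>Gamma\<close>. Monotonicity in the real part reduces the decay to the abscissa 1/2, where
  the modulus is explicit; \<open>\<bar>t\<bar> \<ge> 1\<close> keeps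
  \<open>sinh (pi * t / 2)\<close> away from 0.\<close>

lemma norm_cos_Gamma_ge:
  assumes u: "u \<ge> 1/2" and t: "\<bar>t\<bar> \<ge> 1"
  shows "cmod (cos (of_real pi * Complex u t / 2) * Gamma (Complex u t)) \<ge> Gamma u / 2"
proof -
  define y where "y = pi * t / 2"
  define S where "S = (sinh y)\<^sup>2"
  have Gu: "Gamma u > 0" using u by (intro Gamma_real_pos) auto
  have "(cmod (cos (of_real pi * Complex u t / 2)))\<^sup>2 \<ge> S"
  proof -
    have "Im (of_real pi * Complex u t / 2) = y" by (simp add: y_def)
    then show ?thesis
      by (simp add: norm_cos_squared S_def sinh_field_def exp_minus power_divide)
  qed
  moreover have ch: "cosh (pi * t) = 1 + 2 * S"
  proof -
    have "cosh (2 * y) = (cosh y)\<^sup>2 + (sinh y)\<^sup>2" by (rule cosh_double)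
    then show ?thesis by (simp add: S_def y_def cosh_square_eq)
  qed
  have S1: "S \<ge> 1"
  proof -
    have "\<bar>y\<bar> \<ge> 1"
      using t pi_ge_two mult_mono[of 2 pi 1 "\<bar>t\<bar>"] by (simp add: y_def abs_mult)
    moreover have "\<bar>y\<bar> \<le> \<bar>sinh y\<bar>"
      using real_le_abs_sinh[of y] by (simp add: sinh_field_def exp_minus)
    ultimately have "1 \<le> \<bar>sinh y\<bar>" by simp
    then show ?thesis unfolding S_def by (rule abs_le_square_iff[of 1 "sinh y", simplified, THEN iffD1])
  qed
  define c g where "c = cmod (cos (of_real pi * Complex u t / 2))" and "g = cmod (Gamma (Complex u t))"
  have c: "c\<^sup>2 \<ge> S" using \<open>_ \<ge> S\<close> by (simp add: c_def)
  have "(Gamma u * cmod (Gamma (Complex (1/2) t)))\<^sup>2 \<le> (sqrt pi * g)\<^sup>2"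
    using norm_Gamma_ratio_mono[of "1/2" u t] u Gu
    by (intro power_mono) (auto simp: Gamma_one_half_real g_def)
  then have "(Gamma u)\<^sup>2 * (pi / (1 + 2 * S)) \<le> pi * g\<^sup>2"
    by (simp add: power_mult_distrib norm_Gamma_half ch)
  then have "pi * ((Gamma u)\<^sup>2 / (1 + 2 * S)) \<le> pi * g\<^sup>2" by (simp add: mult_ac)
  then have "(Gamma u)\<^sup>2 / (1 + 2 * S) \<le> g\<^sup>2" by (simp only: mult_le_cancel_left_pos pi_gt_zero)
  then have "S * ((Gamma u)\<^sup>2 / (1 + 2 * S)) \<le> c\<^sup>2 * g\<^sup>2"
    using c S1 by (intro mult_mono) auto
  moreover have "(Gamma u)\<^sup>2 / 4 \<le> S * ((Gamma u)\<^sup>2 / (1 + 2 * S))"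
  proof -
    have "1 / 4 \<le> S / (1 + 2 * S)" using S1 by (simp add: field_simps)
    then have "(Gamma u)\<^sup>2 * (1 / 4) \<le> (Gamma u)\<^sup>2 * (S / (1 + 2 * S))" by (rule mult_left_mono) simp
    then show ?thesis by (simp add: mult_ac)
  qed
  moreover have "(Gamma u / 2)\<^sup>2 = (Gamma u)\<^sup>2 / 4" by (simp add: power_divide)
  ultimately have "(Gamma u / 2)\<^sup>2 \<le> (c * g)\<^sup>2" unfolding power_mult_distrib by linarith
  then have "Gamma u / 2 \<le> c * g"
    by (rule power2_le_imp_le) (simp add: c_def g_def)
  then show ?thesis by (simp add: c_def g_def norm_mult)
qed

text \<open>A shift by 1 multiplies the function by \<open>u / (2 * pi)\<close>, which is at least 1
  for \<open>u \<ge> 8\<close>. So its minimum on the compact interval \<open>{1/2..9}\<close> is a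
  lower bound everywhere to the right.\<close>

lemma Gamma_over_exp_bounded_below:
  obtains m where "m > 0" "\<And>u. u \<ge> 1/2 \<Longrightarrow> (2 * pi) powr (- u) * Gamma u \<ge> m"
proof -
  define f where "f = (\<lambda>u. (2 * pi) powr (- u) * Gamma u)"
  have pos: "f u > 0" if "u > 0" for u using that by (simp add: f_def)
  have "continuous_on {1/2..9} f"
    unfolding f_def by (intro continuous_intros) (auto elim!: nonpos_Ints_cases)
  then obtain w where w: "w \<in> {1/2..9}" "\<And>u. u \<in> {1/2..9} \<Longrightarrow> f w \<le> f u"
    using continuous_attains_inf[of "{1/2..9}" f] by auto
  have step: "f (u + 1) \<ge> f u" if "u \<ge> 8" for u
  proof -
    have "Gamma (u + 1) = u * Gamma u"
      by (rule Gamma_plus1) (use that in \<open>auto elim!: nonpos_Ints_cases\<close>)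
    moreover have "(2 * pi) powr (- (u + 1)) = (2 * pi) powr (- u) / (2 * pi)"
      by (simp add: powr_diff)
    ultimately have "f (u + 1) = f u * (u / (2 * pi))" by (simp add: f_def)
    moreover have "1 \<le> u / (2 * pi)" using that pi_less_4 by (simp add: field_simps)
    ultimately show ?thesis using mult_left_mono[of 1 "u / (2 * pi)" "f u"] pos[of u] that by simp
  qed
  have "\<forall>u\<in>{1/2..9 + real n}. f u \<ge> f w" for n
  proof (induction n)
    case (Suc n)
    show ?case
    proof
      fix u assume u: "u \<in> {1/2..9 + real (Suc n)}"
      show "f u \<ge> f w"
      proof (cases "u \<le> 9")
        case False
        then have "f (u - 1) \<ge> f w" using Suc u by auto
        with step[of "u - 1"] False show ?thesis by simp
      qed (use w u in auto)
    qed
  qed (use w in auto)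
  moreover have "\<exists>n. u \<le> 9 + real n" for u
    using real_arch_simple[of "u - 9"] by (auto simp: algebra_simps)
  ultimately have "f u \<ge> f w" if "u \<ge> 1/2" for u using that by (meson atLeastAtMost_iff)
  then show ?thesis using that[of "f w"] pos[of w] w(1) by (auto simp: f_def)
qed

lemma zeta_cnj:
  assumes "s \<noteq> 1"
  shows "zeta (cnj s) = cnj (zeta s)"
proof -
  have "is_zeta (\<lambda>s. cnj (zeta (cnj s)))"
    unfolding is_zeta_def
  proof (intro conjI allI impI)
    have "cnj ` (- {1}) = - {1}"
    proof (intro equalityI subsetI)
      fix x :: complex assume "x \<in> - {1}"
      then have "x = cnj (cnj x)" "cnj x \<in> - {1}" by auto
      then show "x \<in> cnj ` (- {1})" by (rule image_eqI)
    qed auto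
    then have "cnj \<circ> zeta \<circ> cnj holomorphic_on - {1}"
      by (intro holomorphic_on_compose_cnj_cnj zeta_holomorphic_on) auto
    then show "(\<lambda>s. cnj (zeta (cnj s))) holomorphic_on - {1}" by (simp add: o_def)
    fix s assume "Re s > 1"
    then have "(\<lambda>n. 1 / of_nat (Suc n) powr (cnj s)) sums zeta (cnj s)"
      using is_zeta_zeta by (simp add: is_zeta_def del: of_nat_Suc)
    then have "(\<lambda>n. cnj (1 / of_nat (Suc n) powr (cnj s))) sums cnj (zeta (cnj s))"
      by (simp only: sums_cnj)
    moreover have "cnj (1 / of_nat (Suc n) powr (cnj s)) = 1 / of_nat (Suc n) powr s" for n
      by (simp add: cnj_powr del: of_nat_Suc)
    ultimately show "(\<lambda>n. 1 / of_nat (Suc n) powr s) sums cnj (zeta (cnj s))" by simp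
  qed
  from is_zeta_unique[OF this is_zeta_zeta assms] show ?thesis by (metis complex_cnj_cnj)
qed

text \<open>The functional equation is taken at \<open>w\<close>, the conjugate of the reflected
  point, so that \<open>1 - w\<close> is \<open>Complex \<sigma> t\<close>. The two preceding
  estimates bound its factor below uniformly; any growth of the factor with \<open>t\<close> is
  given up.\<close>

lemma norm_zeta_reflection_ge:
  obtains m where "m > 0"
    "\<And>\<sigma> t. \<sigma> \<le> 1/2 \<Longrightarrow> t \<ge> 1 \<Longrightarrow> cmod (zeta (Complex \<sigma> t)) \<ge> m * cmod (zeta (Complex (1 - \<sigma>) t))"
proof -
  obtain m where m: "m > 0" "\<And>u. u \<ge> 1/2 \<Longrightarrow> (2 * pi) powr (- u) * Gamma u \<ge> m"
    using Gamma_over_exp_bounded_below by metis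
  have "cmod (zeta (Complex \<sigma> t)) \<ge> m * cmod (zeta (Complex (1 - \<sigma>) t))"
    if st: "\<sigma> \<le> 1/2" "t \<ge> 1" for \<sigma> t
  proof -
    define u where "u = 1 - \<sigma>"
    define w where "w = Complex u (- t)"
    have w1: "w \<noteq> 0" "w \<noteq> 1" using st by (auto simp: w_def u_def complex_eq_iff)
    have "w \<notin> \<int>\<^sub>\<le>\<^sub>0" using st by (auto simp: w_def elim!: nonpos_Ints_cases simp: complex_eq_iff)
    then have "Gamma w * rGamma w = 1" by (simp add: Gamma_def rGamma_eq_zero_iff)
    then have "zeta (1 - w) = Gamma w * (rGamma w * zeta (1 - w))" by (simp add: mult.assoc[symmetric])
    also have "\<dots> = 2 * of_real (2 * pi) powr (- w) * (cos (of_real pi * w / 2) * Gamma w) * zeta w"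
      unfolding zeta_functional_equation[OF w1] by (simp add: mult_ac)
    finally have "cmod (zeta (1 - w)) = 2 * (2 * pi) powr (- u) * cmod (cos (of_real pi * w / 2) * Gamma w) * cmod (zeta w)"
      using norm_powr_real_powr[of "of_real (2 * pi)" "- w"] by (simp add: norm_mult w_def del: of_real_mult)
    also have "\<dots> \<ge> 2 * (2 * pi) powr (- u) * (Gamma u / 2) * cmod (zeta w)"
      unfolding w_def using st by (intro mult_right_mono mult_left_mono norm_cos_Gamma_ge) (auto simp: u_def)
    finally have "cmod (zeta (1 - w)) \<ge> ((2 * pi) powr (- u) * Gamma u) * cmod (zeta w)" by simp
    moreover have "((2 * pi) powr (- u) * Gamma u) * cmod (zeta w) \<ge> m * cmod (zeta w)"
      using m(2)[of u] st by (intro mult_right_mono) (auto simp: u_def)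
    moreover have "1 - w = Complex \<sigma> t" by (simp add: w_def u_def complex_eq_iff)
    moreover have "cmod (zeta w) = cmod (zeta (Complex (1 - \<sigma>) t))"
    proof -
      have "w = cnj (Complex (1 - \<sigma>) t)" by (simp add: w_def u_def complex_eq_iff)
      moreover have "Complex (1 - \<sigma>) t \<noteq> 1" using st by (auto simp: complex_eq_iff)
      ultimately show ?thesis by (simp add: zeta_cnj)
    qed
    ultimately show ?thesis by simp
  qed
  then show ?thesis using that m(1) by blast
qed

section \<open>Damping on a T-shaped contour\<close>

text \<open>
  The contour is the boundary of the square-shouldered region
  \<open>[0,1] \<times> [-1/8,1/8] \<union> [0,w] \<times> [-1/2,1/2]\<close>.
\<close>

lemma cauchy_T_shape_bound:
  fixes F :: "complex \<Rightarrow> complex"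
  assumes S: "open S" "convex S" and hol: "F holomorphic_on S"
    and sub: "\<And>z. 0 \<le> Re z \<Longrightarrow> Re z \<le> 1 \<Longrightarrow> \<bar>Im z\<bar> \<le> 1/2 \<Longrightarrow> z \<in> S"
    and w: "0 < w" "w < \<eta>" and \<eta>: "0 < \<eta>" "\<eta> \<le> 1/2"
    and M0: "M \<ge> 0"
    and shoulder: "\<And>x y. w \<le> x \<Longrightarrow> x \<le> 1 \<Longrightarrow> \<bar>y\<bar> = 1/8 \<Longrightarrow> cmod (F (Complex x y)) \<le> M"
    and right: "\<And>y. \<bar>y\<bar> \<le> 1/8 \<Longrightarrow> cmod (F (Complex 1 y)) \<le> M"
    and neck: "\<And>y. 1/8 \<le> \<bar>y\<bar> \<Longrightarrow> \<bar>y\<bar> \<le> 1/2 \<Longrightarrow> cmod (F (Complex w y)) \<le> M"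
    and ends: "\<And>x y. 0 \<le> x \<Longrightarrow> x \<le> w \<Longrightarrow> \<bar>y\<bar> = 1/2 \<Longrightarrow> cmod (F (Complex x y)) \<le> M"
  shows "2 * pi * cmod (F (of_real \<eta>)) \<le> 40 * M + 1 / \<eta> * integral {-1/2..1/2} (\<lambda>y. cmod (F (Complex 0 y)))"
proof -
  define f where "f = (\<lambda>z. F z / (z - of_real \<eta>))"
  define J where "J = (\<lambda>p q. contour_integral (linepath p q) f)"
  define A1 A2 A3 A4 where "A1 = Complex 0 (-1/8)" and "A2 = Complex 1 (-1/8)"
    and "A3 = Complex 1 (1/8)" and "A4 = Complex 0 (1/8)"
  define B1 B2 B3 where "B1 = Complex w (1/8)" and "B2 = Complex w (1/2)" and "B3 = Complex 0 (1/2)"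
  define C1 C2 C3 where "C1 = Complex w (-1/8)" and "C2 = Complex w (-1/2)" and "C3 = Complex 0 (-1/2)"
  note pts = A1_def A2_def A3_def A4_def B1_def B2_def B3_def C1_def C2_def C3_def
  have \<eta>S: "of_real \<eta> \<in> S" using \<eta> by (intro sub) auto
  have contF: "continuous_on S F" by (rule holomorphic_on_imp_continuous_on[OF hol])
  have contf: "continuous_on (S - {of_real \<eta>}) f"
    unfolding f_def by (intro continuous_intros continuous_on_subset[OF contF]) auto
  have int: "f contour_integrable_on linepath p q" if "closed_segment p q \<subseteq> S - {of_real \<eta>}" for p q
    by (rule contour_integrable_continuous_linepath[OF continuous_on_subset[OF contf that]])
  have seg: "closed_segment p q \<subseteq> S - {of_real \<eta>}"
    if "Re p = Re q \<and> Re p \<noteq> \<eta> \<or> Im p = Im q \<and> Im p \<noteq> 0"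
      "0 \<le> Re p" "Re p \<le> 1" "\<bar>Im p\<bar> \<le> 1/2" "0 \<le> Re q" "Re q \<le> 1" "\<bar>Im q\<bar> \<le> 1/2" for p q
  proof
    fix z assume z: "z \<in> closed_segment p q"
    have "closed_segment p q \<subseteq> {z. 0 \<le> Re z} \<inter> {z. Re z \<le> 1} \<inter> {z. Im z \<le> 1/2} \<inter> {z. -1/2 \<le> Im z}"
      using that by (intro closed_segment_subset convex_Int convex_halfspace_Re_ge convex_halfspace_Re_le
          convex_halfspace_Im_ge convex_halfspace_Im_le) auto
    then have "0 \<le> Re z" "Re z \<le> 1" "Im z \<le> 1/2" "-1/2 \<le> Im z" using z by blast+
    then have "z \<in> S" by (intro sub) (auto simp: abs_le_iff)
    moreover have "z \<noteq> of_real \<eta>"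
      using that(1) z closed_segment_same_Re[of p q] closed_segment_same_Im[of p q] by auto
    ultimately show "z \<in> S - {of_real \<eta>}" by simp
  qed
  have rect: "J A1 A2 + (J A2 A3 + (J A3 A4 + J A4 A1)) = 2 * of_real pi * \<i> * F (of_real \<eta>)"
  proof -
    have w1: "winding_number (rectpath A1 A3) (of_real \<eta>) = 1"
      by (rule winding_number_rectpath) (use \<eta> in \<open>auto simp: in_box_complex_iff pts\<close>)
    have pim: "path_image (rectpath A1 A3) \<subseteq> S - {of_real \<eta>}"
      using \<eta> by (subst path_image_rectpath) (auto simp: pts intro!: sub)
    have "(f has_contour_integral (2 * pi * \<i> * winding_number (rectpath A1 A3) (of_real \<eta>) * F (of_real \<eta>))) (rectpath A1 A3)"
      unfolding f_def
      by (rule Cauchy_integral_formula_convex_simple[OF S(2) hol _ valid_path_rectpath pim])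
         (use \<eta>S S in \<open>auto simp: interior_open\<close>)
    then have "contour_integral (rectpath A1 A3) f = 2 * of_real pi * \<i> * F (of_real \<eta>)"
      by (simp add: contour_integral_unique w1)
    moreover have "rectpath A1 A3 = linepath A1 A2 +++ linepath A2 A3 +++ linepath A3 A4 +++ linepath A4 A1"
      by (simp add: rectpath_def pts Let_def)
    moreover have "f contour_integrable_on linepath A1 A2" "f contour_integrable_on linepath A2 A3"
      "f contour_integrable_on linepath A3 A4" "f contour_integrable_on linepath A4 A1"
      using \<eta> by (auto intro!: int[OF seg] simp: pts)
    ultimately show ?thesis
      by (simp add: J_def contour_integrable_joinI valid_path_join)
  qed
  \<comment> \<open>Above and below the real axis the pole is absent and \<open>f\<close> has a
    primitive, so a side of the rectangle may be traded for any polygon with the same ends in the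
    same half-plane. Only the rectangle needs a winding number; the T-shape arises from the detours
    \<open>upper\<close> and \<open>lower\<close>.\<close>
  have prim: "\<exists>g. \<forall>p q. closed_segment p q \<subseteq> S \<inter> H \<longrightarrow> J p q = g q - g p"
    if H: "open H" "convex H" "of_real \<eta> \<notin> H" for H
  proof -
    have "f holomorphic_on (S \<inter> H)"
      unfolding f_def using H by (intro holomorphic_intros holomorphic_on_subset[OF hol]) auto
    then obtain g where g: "\<And>x. x \<in> S \<inter> H \<Longrightarrow> (g has_field_derivative f x) (at x within (S \<inter> H))"
      using holomorphic_convex_primitive'[of "S \<inter> H" f] S H by (metis convex_Int open_Int)
    have "J p q = g q - g p" if "closed_segment p q \<subseteq> S \<inter> H" for p q
      unfolding J_def using contour_integral_primitive[OF g valid_path_linepath, of p q] that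
      by (intro contour_integral_unique) auto
    then show ?thesis by blast
  qed
  have segH: "closed_segment p q \<subseteq> S \<inter> H"
    if "convex H" "p \<in> H" "q \<in> H"
      "0 \<le> Re p" "Re p \<le> 1" "\<bar>Im p\<bar> \<le> 1/2" "0 \<le> Re q" "Re q \<le> 1" "\<bar>Im q\<bar> \<le> 1/2" for p q H
    using that S sub by (intro closed_segment_subset convex_Int) auto
  have upper: "J A3 A4 = J A3 B1 + J B1 B2 + J B2 B3 + J B3 A4"
  proof -
    obtain g where g: "\<forall>p q. closed_segment p q \<subseteq> S \<inter> {z. Im z > 0} \<longrightarrow> J p q = g q - g p"
      using prim[of "{z. Im z > 0}"] by (auto simp: open_halfspace_Im_gt convex_halfspace_Im_gt)
    have "J A3 A4 = g A4 - g A3" "J A3 B1 = g B1 - g A3" "J B1 B2 = g B2 - g B1"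
      "J B2 B3 = g B3 - g B2" "J B3 A4 = g A4 - g B3"
      using w \<eta> by - (rule g[rule_format], rule segH, rule convex_halfspace_Im_gt, simp_all add: pts)+
    then show ?thesis by simp
  qed
  have lower: "J A1 A2 = J A1 C3 + J C3 C2 + J C2 C1 + J C1 A2"
  proof -
    obtain g where g: "\<forall>p q. closed_segment p q \<subseteq> S \<inter> {z. Im z < 0} \<longrightarrow> J p q = g q - g p"
      using prim[of "{z. Im z < 0}"] by (auto simp: open_halfspace_Im_lt convex_halfspace_Im_lt)
    have "J A1 A2 = g A2 - g A1" "J A1 C3 = g C3 - g A1" "J C3 C2 = g C2 - g C3"
      "J C2 C1 = g C1 - g C2" "J C1 A2 = g A2 - g C1"
      using w \<eta> by - (rule g[rule_format], rule segH, rule convex_halfspace_Im_lt, simp_all add: pts)+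
    then show ?thesis by simp
  qed
  \<comment> \<open>The factor 8 is the inverse of the distance 1/8 to the pole: either the
    imaginary part is at least 1/8 in modulus, or the real part is 1 and the distance is at least
    \<open>1 - \<eta> \<ge> 1/2\<close>.\<close>
  have piece: "cmod (J p q) \<le> 8 * M * (\<bar>Re q - Re p\<bar> + \<bar>Im q - Im p\<bar>)"
    if "Re p = Re q \<and> Re p \<noteq> \<eta> \<or> Im p = Im q \<and> Im p \<noteq> 0"
      "0 \<le> Re p" "Re p \<le> 1" "\<bar>Im p\<bar> \<le> 1/2" "0 \<le> Re q" "Re q \<le> 1" "\<bar>Im q\<bar> \<le> 1/2"
      and FM: "\<And>z. z \<in> closed_segment p q \<Longrightarrow> cmod (F z) \<le> M \<and> (1/8 \<le> \<bar>Im z\<bar> \<or> Re z = 1)" for p q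
  proof -
    have "cmod (J p q) \<le> 8 * M * cmod (q - p)"
      unfolding J_def
    proof (rule contour_integral_bound_linepath)
      fix z assume z: "z \<in> closed_segment p q"
      have "1/8 \<le> cmod (z - of_real \<eta>)"
        using FM[OF z] \<eta> abs_Im_le_cmod[of "z - of_real \<eta>"] abs_Re_le_cmod[of "z - of_real \<eta>"] by auto
      then have "cmod (F z) / cmod (z - of_real \<eta>) \<le> M / (1/8)"
        using FM[OF z] M0 by (intro frac_le) auto
      then show "cmod (f z) \<le> 8 * M" by (simp add: f_def norm_divide)
    qed (use that M0 in \<open>auto intro!: int[OF seg]\<close>)
    also have "8 * M * cmod (q - p) \<le> 8 * M * (\<bar>Re q - Re p\<bar> + \<bar>Im q - Im p\<bar>)"
      using cmod_le[of "q - p"] M0 by (intro mult_left_mono) auto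
    finally show ?thesis .
  qed
  have horiz: "cmod (J (Complex x1 y) (Complex x2 y)) \<le> 8 * M * \<bar>x2 - x1\<bar>"
    if y: "0 \<le> x1" "x1 \<le> 1" "0 \<le> x2" "x2 \<le> 1" "1/8 \<le> \<bar>y\<bar>" "\<bar>y\<bar> \<le> 1/2"
      and FM: "\<And>x. min x1 x2 \<le> x \<Longrightarrow> x \<le> max x1 x2 \<Longrightarrow> cmod (F (Complex x y)) \<le> M" for x1 x2 y
  proof -
    have "cmod (F z) \<le> M \<and> (1/8 \<le> \<bar>Im z\<bar> \<or> Re z = 1)" if z: "z \<in> closed_segment (Complex x1 y) (Complex x2 y)" for z
    proof -
      from z have "Im z = y" "min x1 x2 \<le> Re z" "Re z \<le> max x1 x2"
        by (auto simp: closed_segment_same_Im closed_segment_eq_real_ivl split: if_splits)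
      then show ?thesis using FM[of "Re z"] y(5) by (metis complex_surj)
    qed
    then show ?thesis using y piece[of "Complex x1 y" "Complex x2 y"] by (cases "y = 0") auto
  qed
  have vert: "cmod (J (Complex x y1) (Complex x y2)) \<le> 8 * M * \<bar>y2 - y1\<bar>"
    if x: "0 \<le> x" "x \<le> 1" "x \<noteq> \<eta>" "\<bar>y1\<bar> \<le> 1/2" "\<bar>y2\<bar> \<le> 1/2"
      and FM: "\<And>y. min y1 y2 \<le> y \<Longrightarrow> y \<le> max y1 y2 \<Longrightarrow> cmod (F (Complex x y)) \<le> M \<and> (1/8 \<le> \<bar>y\<bar> \<or> x = 1)" for x y1 y2
  proof -
    have "cmod (F z) \<le> M \<and> (1/8 \<le> \<bar>Im z\<bar> \<or> Re z = 1)" if z: "z \<in> closed_segment (Complex x y1) (Complex x y2)" for z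
    proof -
      from z have "Re z = x" "min y1 y2 \<le> Im z" "Im z \<le> max y1 y2"
        by (auto simp: closed_segment_same_Re closed_segment_eq_real_ivl split: if_splits)
      then show ?thesis using FM[of "Im z"] by (metis complex_surj)
    qed
    then show ?thesis using x piece[of "Complex x y1" "Complex x y2"] by auto
  qed
  have r1: "cmod (J A3 B1) \<le> 8 * M * (1 - w)" "cmod (J C1 A2) \<le> 8 * M * (1 - w)"
    using horiz[of 1 w "1/8"] horiz[of w 1 "-1/8"] shoulder w \<eta> by (auto simp: pts)
  have r2: "cmod (J B1 B2) \<le> 8 * M * (3/8)" "cmod (J C2 C1) \<le> 8 * M * (3/8)"
    using vert[of w "1/8" "1/2"] vert[of w "-1/2" "-1/8"] neck w \<eta> by (auto simp: pts)
  have r3: "cmod (J B2 B3) \<le> 8 * M * w" "cmod (J C3 C2) \<le> 8 * M * w"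
    using horiz[of w 0 "1/2"] horiz[of 0 w "-1/2"] ends w \<eta> by (auto simp: pts)
  have r4: "cmod (J A2 A3) \<le> 8 * M * (1/4)"
    using vert[of 1 "-1/8" "1/8"] right \<eta> by (auto simp: pts abs_le_iff)
  define g where "g = (\<lambda>y. cmod (F (Complex 0 y)))"
  have contF0: "continuous_on {-1/2..1/2} (\<lambda>y. F (Complex 0 y))"
    by (rule continuous_on_compose2[OF contF])
       (auto intro!: continuous_intros sub simp: complex_eq_iff Complex_eq abs_le_iff)
  then have contg: "continuous_on {-1/2..1/2} g" unfolding g_def by (rule continuous_on_norm)
  have left: "cmod (J (Complex 0 c) (Complex 0 d)) \<le> 1 / \<eta> * integral {c..d} g"
    "J (Complex 0 d) (Complex 0 c) = - J (Complex 0 c) (Complex 0 d)"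
    if cd: "-1/2 \<le> c" "c < d" "d \<le> 1/2" for c d
  proof -
    have sg: "closed_segment (Complex 0 c) (Complex 0 d) \<subseteq> S - {of_real \<eta>}"
      using cd \<eta> by (intro seg) auto
    show "J (Complex 0 d) (Complex 0 c) = - J (Complex 0 c) (Complex 0 d)"
      using contour_integral_reverse_linepath[OF continuous_on_subset[OF contf sg]]
      unfolding J_def by (metis minus_minus)
    have "J (Complex 0 c) (Complex 0 d) = \<i> * integral {c..d} (\<lambda>y. f (Complex 0 y))"
      unfolding J_def by (rule contour_integral_linepath_same_Re) (use cd in auto)
    moreover have "cmod (integral {c..d} (\<lambda>y. f (Complex 0 y))) \<le> integral {c..d} (\<lambda>y. 1 / \<eta> * g y)"
    proof (rule integral_norm_bound_integral)
      have cF: "continuous_on {c..d} (\<lambda>y. F (Complex 0 y))"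
        by (rule continuous_on_subset[OF contF0]) (use cd in auto)
      show "(\<lambda>y. f (Complex 0 y)) integrable_on {c..d}"
        unfolding f_def using \<eta>
        by (intro integrable_continuous_real continuous_intros cF)
           (auto simp: complex_eq_iff Complex_eq intro!: continuous_intros)
      show "(\<lambda>y. 1 / \<eta> * g y) integrable_on {c..d}"
        by (intro integrable_continuous_real continuous_intros continuous_on_subset[OF contg]) (use cd in auto)
      fix y assume "y \<in> {c..d}"
      have "\<eta> \<le> cmod (Complex 0 y - of_real \<eta>)"
        using abs_Re_le_cmod[of "Complex 0 y - of_real \<eta>"] \<eta> by simp
      then have "g y / cmod (Complex 0 y - of_real \<eta>) \<le> g y / \<eta>"
        using \<eta> by (intro divide_left_mono mult_pos_pos) (auto simp: g_def)
      then show "cmod (f (Complex 0 y)) \<le> 1 / \<eta> * g y"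
        by (simp add: f_def g_def norm_divide)
    qed
    ultimately show "cmod (J (Complex 0 c) (Complex 0 d)) \<le> 1 / \<eta> * integral {c..d} g"
      by (simp add: norm_mult)
  qed
  have gint: "g integrable_on {c..d}" if "-1/2 \<le> c" "d \<le> 1/2" for c d
    by (intro integrable_continuous_real continuous_on_subset[OF contg]) (use that in auto)
  have "integral {-1/2..1/2} g = integral {-1/2..-1/8} g + integral {-1/8..1/8} g + integral {1/8..1/2} g"
    using Henstock_Kurzweil_Integration.integral_combine[of "-1/2" "1/8" "1/2" g]
      Henstock_Kurzweil_Integration.integral_combine[of "-1/2" "-1/8" "1/8" g] gint by simp
  then have "1 / \<eta> * integral {-1/2..1/2} g =
     1 / \<eta> * integral {-1/2..-1/8} g + 1 / \<eta> * integral {-1/8..1/8} g + 1 / \<eta> * integral {1/8..1/2} g"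
    by (simp only: distrib_left)
  then have lefts: "cmod (J B3 A4) + cmod (J A4 A1) + cmod (J A1 C3) \<le> 1 / \<eta> * integral {-1/2..1/2} g"
    using left[of "1/8" "1/2"] left[of "-1/8" "1/8"] left[of "-1/2" "-1/8"] by (simp add: pts)
  have "2 * pi * cmod (F (of_real \<eta>)) = cmod (J A1 A2 + (J A2 A3 + (J A3 A4 + J A4 A1)))"
    unfolding rect by (simp add: norm_mult)
  also have "\<dots> = cmod ((J A1 C3 + J C3 C2 + J C2 C1 + J C1 A2) + (J A2 A3 + ((J A3 B1 + J B1 B2 + J B2 B3 + J B3 A4) + J A4 A1)))"
    by (simp only: upper lower)
  also have "\<dots> \<le> (cmod (J A1 C3) + cmod (J C3 C2) + cmod (J C2 C1) + cmod (J C1 A2)) +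
      (cmod (J A2 A3) + ((cmod (J A3 B1) + cmod (J B1 B2) + cmod (J B2 B3) + cmod (J B3 A4)) + cmod (J A4 A1)))"
    by (intro norm_triangle_le add_mono order_refl)
  \<comment> \<open>The sides other than the left one have total length
    \<open>2 * (1 - w) + 2 * (3/8) + 2 * w + 1/4 = 3\<close>, and \<open>24 = 8 * 3\<close>.\<close>
  also have "\<dots> \<le> 24 * M + 1 / \<eta> * integral {-1/2..1/2} g"
    using r1 r2 r3 r4 lefts by (simp add: algebra_simps)
  also have "\<dots> \<le> 40 * M + 1 / \<eta> * integral {-1/2..1/2} g" using M0 by simp
  finally show ?thesis by (simp only: g_def)
qed

text \<open>
  The first factor decays doubly exponentially towards \<open>\<bar>Im z\<bar> = 1/2\<close> but is harmless for
  \<open>\<bar>Im z\<bar> \<le> 1/8\<close>; the zeros of the second factor compensate the pole-like bound for the zeta function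
  near the corners of the contour; the modulus of the third factor is \<open>exp (- \<mu> * (pi - \<theta>))\<close>, where
  \<open>\<theta>\<close> is the angle under which the segment between the two zeros is seen from \<open>z\<close>.
\<close>

definition damp :: "real \<Rightarrow> real \<Rightarrow> complex \<Rightarrow> complex" where
  "damp l \<mu> z = exp (- of_real (exp (- l / 8)) * cos (of_real l * z))
     * ((z - Complex (- 1 / l) (1/8)) * (z - Complex (- 1 / l) (- 1/8)))
     * exp (- of_real \<mu> * (of_real pi - \<i> * (Ln (z - Complex (- 1 / l) (1/8)) - Ln (z - Complex (- 1 / l) (- 1/8)))))"

text \<open>The difference of the arguments of the vectors from the two zeros. Since the zeros lie
  at distance \<open>1 / l\<close> to the left of the contour, both vectors point into the right
  half-plane, where \<open>arctan\<close> computes the argument and no branch cut is met.\<close>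

definition damp_angle :: "real \<Rightarrow> real \<Rightarrow> real \<Rightarrow> real" where
  "damp_angle l x y = arctan ((y + 1/8) / (x + 1 / l)) - arctan ((y - 1/8) / (x + 1 / l))"

lemma damp_holomorphic:
  "damp l \<mu> holomorphic_on {z. Re z > - 1 / l}"
  unfolding damp_def
  by (intro holomorphic_intros) (auto simp: complex_nonpos_Reals_iff)

lemma norm_damp:
  assumes l: "l > 0" and x: "x \<ge> 0"
  shows "cmod (damp l \<mu> (Complex x y)) = exp (- exp (- l / 8) * (cos (l * x) * cosh (l * y)))
     * (cmod (Complex (x + 1 / l) (y - 1/8)) * cmod (Complex (x + 1 / l) (y + 1/8)))
     * exp (- \<mu> * (pi - damp_angle l x y))"
proof -
  define r where "r = x + 1 / l"
  have r: "r > 0" using l x by (simp add: r_def add_nonneg_pos)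
  have d: "Complex x y - Complex (- 1 / l) (1/8) = Complex r (y - 1/8)"
    "Complex x y - Complex (- 1 / l) (- 1/8) = Complex r (y + 1/8)"
    by (simp_all add: complex_eq_iff r_def)
  have "Im (Ln (Complex r c)) = arctan (c / r)" for c
    using r by (subst Im_Ln_eq) (auto simp: complex_eq_iff)
  then have 3: "cmod (exp (- of_real \<mu> * (of_real pi - \<i> * (Ln (Complex r (y - 1/8)) - Ln (Complex r (y + 1/8))))))
      = exp (- \<mu> * (pi - damp_angle l x y))"
    by (simp add: damp_angle_def r_def [symmetric])
  have "Re (cos (of_real l * Complex x y)) = cos (l * x) * cosh (l * y)"
    by (simp add: Re_cos cosh_field_def)
  then have 1: "cmod (exp (- of_real (exp (- l / 8)) * cos (of_real l * Complex x y))) =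
      exp (- exp (- l / 8) * (cos (l * x) * cosh (l * y)))"
    by simp
  show ?thesis
    unfolding damp_def d norm_mult 1 3 by (simp only: r_def)
qed

lemma arctan_le_self:
  assumes "x \<ge> 0"
  shows "arctan x \<le> x"
proof -
  have "0 - arctan 0 \<le> x - arctan x"
  proof (rule DERIV_nonneg_imp_nondecreasing[OF assms])
    fix u :: real
    have "((\<lambda>u. u - arctan u) has_real_derivative 1 - inverse (1 + u\<^sup>2)) (at u)"
      by (auto intro!: derivative_eq_intros)
    moreover have "inverse (1 + u\<^sup>2) \<le> 1" by (rule inverse_le_1_iff[THEN iffD2]) simp
    ultimately show "\<exists>y. ((\<lambda>u. u - arctan u) has_real_derivative y) (at u) \<and> 0 \<le> y"
      by (intro exI[of _ "1 - inverse (1 + u\<^sup>2)"]) simp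
  qed
  then show ?thesis by simp
qed

lemma damp_angle_le_pi: "damp_angle l x y \<le> pi"
  using arctan_ubound[of "(y + 1/8) / (x + 1 / l)"] arctan_lbound[of "(y - 1/8) / (x + 1 / l)"]
  by (simp add: damp_angle_def)

text \<open>Above or below both zeros the two arguments have the same sign, so their difference is
  at most \<open>pi / 2\<close>. Between them, at horizontal distance at least 1, each argument is
  at most \<open>pi / 4\<close> in modulus.\<close>

lemma damp_angle_le_half_pi:
  assumes l: "l > 0" and x: "x \<ge> 0" and xy: "\<bar>y\<bar> \<ge> 1/8 \<or> x \<ge> 1"
  shows "damp_angle l x y \<le> pi / 2"
proof -
  define r where "r = x + 1 / l"
  have r: "r > 0" "r > x" using l x by (simp_all add: r_def add_nonneg_pos)
  have A: "damp_angle l x y = arctan ((y + 1/8) / r) - arctan ((y - 1/8) / r)"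
    by (simp add: damp_angle_def r_def)
  consider "y \<ge> 1/8" | "y \<le> -1/8" | "\<bar>y\<bar> \<le> 1/8" "x \<ge> 1" using xy by linarith
  then show ?thesis
  proof cases
    case 1
    then have "arctan ((y - 1/8) / r) \<ge> 0" using r by simp
    then show ?thesis using A arctan_ubound[of "(y + 1/8) / r"] by linarith
  next
    case 2
    then have "arctan ((y + 1/8) / r) \<le> 0" using r by (simp add: divide_le_0_iff)
    then show ?thesis using A arctan_lbound[of "(y - 1/8) / r"] by linarith
  next
    case 3
    have "arctan ((y + 1/8) / r) \<le> arctan 1" "arctan (- 1) \<le> arctan ((y - 1/8) / r)"
      unfolding arctan_le_iff using 3 r by (simp_all add: field_simps)
    then show ?thesis using A by (simp add: arctan_one arctan_minus)
  qed
qed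

context
  fixes l \<mu> :: real
  assumes l: "l \<ge> 8" and mu: "\<mu> \<ge> 0"
begin

private lemma l_inv: "0 < 1 / l" "1 / l \<le> 1/8"
  using l by (auto simp: field_simps)

private lemma angle_factor_le:
  assumes "x \<ge> 0" "\<bar>y\<bar> \<ge> 1/8 \<or> x \<ge> 1"
  shows "exp (- \<mu> * (pi - damp_angle l x y)) \<le> exp (- \<mu> * pi / 2)"
proof -
  have "\<mu> * (pi / 2) \<le> \<mu> * (pi - damp_angle l x y)"
    using damp_angle_le_half_pi[of l x y] assms l mu by (intro mult_left_mono) auto
  then show ?thesis by simp
qed

text \<open>The coefficient \<open>exp (- l / 8)\<close> is normalised for the strip
  \<open>\<bar>y\<bar> \<le> 1/8\<close>: there the exponent has modulus at most 1, even where
  \<open>cos (l * x)\<close> is negative. The constant 3 stands for \<open>exp 1\<close>.\<close>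

private lemma exp_cos_center:
  assumes "\<bar>y\<bar> \<le> 1/8"
  shows "exp (- exp (- l / 8) * (cos (l * x) * cosh (l * y))) \<le> 3"
    "exp (- exp (- l / 8) * (cos (l * x) * cosh (l * y))) \<ge> 1/3"
proof -
  have "cosh (l * y) = cosh (l * \<bar>y\<bar>)" using cosh_real_abs[of "l * y"] l by (simp add: abs_mult)
  also have "\<dots> \<le> cosh (l * (1/8))"
  proof -
    have "0 \<le> l * \<bar>y\<bar>" "l * \<bar>y\<bar> \<le> l * (1/8)" using assms l by (auto intro!: mult_left_mono)
    then show ?thesis by (subst cosh_real_nonneg_le_iff) linarith+
  qed
  also have "\<dots> \<le> exp (l / 8)" using l by (simp add: cosh_field_def)
  finally have c: "cosh (l * y) \<le> exp (l / 8)" .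
  have "\<bar>exp (- l / 8) * (cos (l * x) * cosh (l * y))\<bar> = exp (- l / 8) * (\<bar>cos (l * x)\<bar> * cosh (l * y))"
    by (simp add: abs_mult)
  also have "\<dots> \<le> exp (- l / 8) * (1 * exp (l / 8))"
    using c by (intro mult_left_mono mult_mono) auto
  also have "\<dots> = 1" by (simp flip: exp_add)
  finally have b: "\<bar>exp (- l / 8) * (cos (l * x) * cosh (l * y))\<bar> \<le> 1" .
  then have "exp (- exp (- l / 8) * (cos (l * x) * cosh (l * y))) \<le> exp 1" by simp
  then show "exp (- exp (- l / 8) * (cos (l * x) * cosh (l * y))) \<le> 3" using exp_le by linarith
  have "exp (- 1) \<le> exp (- exp (- l / 8) * (cos (l * x) * cosh (l * y)))" using b by simp
  moreover have "exp (- 1 :: real) \<ge> 1/3"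
    using exp_le by (simp add: exp_minus field_simps)
  ultimately show "exp (- exp (- l / 8) * (cos (l * x) * cosh (l * y))) \<ge> 1/3" by linarith
qed

private lemma mult_mono3:
  fixes a b c :: real
  assumes "a \<le> a'" "b \<le> b'" "c \<le> c'" "0 \<le> a" "0 \<le> b" "0 \<le> c"
  shows "a * b * c \<le> a' * b' * c'"
  using assms by (intro mult_mono) auto

private lemma norm_Complex_le:
  "x \<ge> 0 \<Longrightarrow> cmod (Complex (x + 1 / l) c) \<le> x + 1/8 + \<bar>c\<bar>"
  "1 / l \<le> x \<Longrightarrow> cmod (Complex (x + 1 / l) c) \<le> 2 * x + \<bar>c\<bar>"
proof -
  have "cmod (Complex (x + 1 / l) c) \<le> \<bar>x + 1 / l\<bar> + \<bar>c\<bar>"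
    using cmod_le[of "Complex (x + 1 / l) c"] by simp
  with l_inv show "x \<ge> 0 \<Longrightarrow> cmod (Complex (x + 1 / l) c) \<le> x + 1/8 + \<bar>c\<bar>"
    "1 / l \<le> x \<Longrightarrow> cmod (Complex (x + 1 / l) c) \<le> 2 * x + \<bar>c\<bar>" by linarith+
qed

private lemma norm_Complex_two_inv_le:
  "cmod (Complex (1 / l + 1 / l) c) \<le> 1/4 + \<bar>c\<bar>" "cmod (Complex (1 / l + 1 / l) c) \<le> 2 / l + \<bar>c\<bar>"
  using norm_Complex_le(2)[of "1 / l" c] l_inv by linarith+

section \<open>The damping factor on the sides of the contour and at its centre\<close>

lemma damp_left:
  assumes y: "\<bar>y\<bar> \<le> 1/2"
  shows "cmod (damp l \<mu> (Complex 0 y)) \<le> 1"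
proof -
  have "cmod (Complex (0 + 1 / l) (y - 1/8)) \<le> 1" "cmod (Complex (0 + 1 / l) (y + 1/8)) \<le> 1"
    using norm_Complex_le(1)[of 0 "y - 1/8"] norm_Complex_le(1)[of 0 "y + 1/8"] y by linarith+
  then have "cmod (Complex (0 + 1 / l) (y - 1/8)) * cmod (Complex (0 + 1 / l) (y + 1/8)) \<le> 1 * 1"
    by (intro mult_mono) auto
  moreover have "exp (- exp (- l / 8) * (cos (l * 0) * cosh (l * y))) \<le> 1"
    using cosh_real_nonneg[of "l * y"] by simp
  moreover have "exp (- \<mu> * (pi - damp_angle l 0 y)) \<le> 1"
    using mu damp_angle_le_pi[of l 0 y] by simp
  ultimately have "exp (- exp (- l / 8) * (cos (l * 0) * cosh (l * y)))
     * (cmod (Complex (0 + 1 / l) (y - 1/8)) * cmod (Complex (0 + 1 / l) (y + 1/8)))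
     * exp (- \<mu> * (pi - damp_angle l 0 y)) \<le> 1 * (1 * 1) * 1"
    by (intro mult_mono3) auto
  then show ?thesis using norm_damp[of l 0 \<mu> y] l by simp
qed

text \<open>The zero at the height of the shoulder is at distance
  \<open>x + 1 / l \<le> 2 * x\<close>; this \<open>x\<close> will cancel the \<open>1 / x\<close>
  in the bound for zeta. The constant is \<open>3 * (2 * 2)\<close>.\<close>

lemma damp_shoulder:
  assumes x: "1 / l \<le> x" "x \<le> 1" and y: "\<bar>y\<bar> = 1/8"
  shows "cmod (damp l \<mu> (Complex x y)) \<le> 12 * x * exp (- \<mu> * pi / 2)"
proof -
  have x0: "x \<ge> 0" using x l_inv by linarith
  have "cmod (Complex (x + 1 / l) (y - 1/8)) * cmod (Complex (x + 1 / l) (y + 1/8)) \<le> (2 * x) * 2"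
  proof (cases "y = 1/8")
    case True
    then have "cmod (Complex (x + 1 / l) (y - 1/8)) \<le> 2 * x" "cmod (Complex (x + 1 / l) (y + 1/8)) \<le> 2"
      using norm_Complex_le(2)[of x "y - 1/8"] norm_Complex_le(1)[of x "y + 1/8"] x x0 by linarith+
    then show ?thesis using x0 by (intro mult_mono) auto
  next
    case False
    then have "y = -1/8" using y by auto
    then have "cmod (Complex (x + 1 / l) (y - 1/8)) \<le> 2" "cmod (Complex (x + 1 / l) (y + 1/8)) \<le> 2 * x"
      using norm_Complex_le(1)[of x "y - 1/8"] norm_Complex_le(2)[of x "y + 1/8"] x x0 by linarith+
    then have "cmod (Complex (x + 1 / l) (y - 1/8)) * cmod (Complex (x + 1 / l) (y + 1/8)) \<le> 2 * (2 * x)"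
      using x0 by (intro mult_mono) auto
    then show ?thesis by simp
  qed
  then have "exp (- exp (- l / 8) * (cos (l * x) * cosh (l * y)))
     * (cmod (Complex (x + 1 / l) (y - 1/8)) * cmod (Complex (x + 1 / l) (y + 1/8)))
     * exp (- \<mu> * (pi - damp_angle l x y)) \<le> 3 * ((2 * x) * 2) * exp (- \<mu> * pi / 2)"
    using exp_cos_center(1)[of y x] angle_factor_le[of x y] y x0  by (intro mult_mono3) auto
  then show ?thesis using norm_damp[of l x \<mu> y] l x0 by simp
qed

lemma damp_right:
  assumes y: "\<bar>y\<bar> \<le> 1/8"
  shows "cmod (damp l \<mu> (Complex 1 y)) \<le> 12 * exp (- \<mu> * pi / 2)"
proof -
  have "cmod (Complex (1 + 1 / l) (y - 1/8)) \<le> 2" "cmod (Complex (1 + 1 / l) (y + 1/8)) \<le> 2"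
    using norm_Complex_le(1)[of 1 "y - 1/8"] norm_Complex_le(1)[of 1 "y + 1/8"] y by linarith+
  then have "cmod (Complex (1 + 1 / l) (y - 1/8)) * cmod (Complex (1 + 1 / l) (y + 1/8)) \<le> 2 * 2"
    by (intro mult_mono) auto
  then have "exp (- exp (- l / 8) * (cos (l * 1) * cosh (l * y)))
     * (cmod (Complex (1 + 1 / l) (y - 1/8)) * cmod (Complex (1 + 1 / l) (y + 1/8)))
     * exp (- \<mu> * (pi - damp_angle l 1 y)) \<le> 3 * (2 * 2) * exp (- \<mu> * pi / 2)"
    using exp_cos_center(1)[OF y, of 1] angle_factor_le[of 1 y]  by (intro mult_mono3) auto
  then show ?thesis using norm_damp[of l 1 \<mu> y] l by simp
qed

private lemma cos_ge_half:
  assumes "0 \<le> x" "x \<le> 1 / l"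
  shows "cos (l * x) \<ge> 1/2"
proof -
  have "0 \<le> l * x" "l * x \<le> 1" using assms l by (auto simp: field_simps)
  moreover have "1 \<le> pi / 3" using pi_gt3 by simp
  ultimately have "cos (pi / 3) \<le> cos (l * x)" by (intro cos_monotone_0_pi_le) auto
  then show ?thesis by (simp add: cos_60)
qed

text \<open>In the neck \<open>l * x \<le> 1 < pi / 3\<close>, so the cosine is at least 1/2 and the
  exponent keeps its sign. This is why the width of the neck is tied to
  \<open>1 / l\<close>.\<close>

private lemma exp_cosh_le:
  assumes "0 \<le> x" "x \<le> 1 / l"
  shows "exp (- exp (- l / 8) * (cos (l * x) * cosh (l * y))) \<le> exp (- exp (l * (\<bar>y\<bar> - 1/8)) / 4)"
proof -
  have "cosh (l * y) = cosh (l * \<bar>y\<bar>)" using cosh_real_abs[of "l * y"] l by (simp add: abs_mult)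
  also have "\<dots> \<ge> exp (l * \<bar>y\<bar>) / 2" by (simp add: cosh_field_def)
  finally have "1/2 * (exp (l * \<bar>y\<bar>) / 2) \<le> cos (l * x) * cosh (l * y)"
    using cos_ge_half[OF assms] by (intro mult_mono) auto
  then have "exp (- l / 8) * (1/2 * (exp (l * \<bar>y\<bar>) / 2)) \<le> exp (- l / 8) * (cos (l * x) * cosh (l * y))"
    by (rule mult_left_mono) simp
  moreover have "exp (- l / 8) * (1/2 * (exp (l * \<bar>y\<bar>) / 2)) = exp (l * (\<bar>y\<bar> - 1/8)) / 4"
    by (simp add: algebra_simps flip: exp_add)
  ultimately have "- exp (- l / 8) * (cos (l * x) * cosh (l * y)) \<le> - exp (l * (\<bar>y\<bar> - 1/8)) / 4"
    by linarith
  then show ?thesis by (rule exp_le_cancel_iff[THEN iffD2])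
qed

text \<open>At the corner the nearby zero supplies the factor \<open>1 / l\<close>. Further along
  the neck its distance grows like \<open>(2 + w) / l\<close>, and the first factor of
  \<open>damp\<close> absorbs the linear growth in \<open>w\<close>:
  \<open>exp (- w / 4) * (2 + w) \<le> 2 + 4\<close>.\<close>

lemma damp_neck:
  assumes y: "1/8 \<le> \<bar>y\<bar>" "\<bar>y\<bar> \<le> 1/2"
  shows "cmod (damp l \<mu> (Complex (1 / l) y)) \<le> 6 / l * exp (- \<mu> * pi / 2)"
proof -
  define w where "w = l * (\<bar>y\<bar> - 1/8)"
  have w: "w \<ge> 0" using y l by (simp add: w_def)
  have "cmod (Complex (1 / l + 1 / l) (y - 1/8)) * cmod (Complex (1 / l + 1 / l) (y + 1/8)) \<le> (2 + w) / l"
  proof -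
    have wl: "2 / l + (\<bar>y\<bar> - 1/8) = (2 + w) / l" using l by (simp add: w_def field_simps)
    show ?thesis
    proof (cases "y \<ge> 0")
      case True
      have "cmod (Complex (1 / l + 1 / l) (y - 1/8)) \<le> (2 + w) / l" "cmod (Complex (1 / l + 1 / l) (y + 1/8)) \<le> 1"
        using norm_Complex_two_inv_le(2)[of "y - 1/8"] norm_Complex_two_inv_le(1)[of "y + 1/8"]
          y True wl by linarith+
      then have "cmod (Complex (1 / l + 1 / l) (y - 1/8)) * cmod (Complex (1 / l + 1 / l) (y + 1/8)) \<le> (2 + w) / l * 1"
        using w l by (intro mult_mono) auto
      then show ?thesis by simp
    next
      case False
      have "cmod (Complex (1 / l + 1 / l) (y - 1/8)) \<le> 1" "cmod (Complex (1 / l + 1 / l) (y + 1/8)) \<le> (2 + w) / l"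
        using norm_Complex_two_inv_le(1)[of "y - 1/8"] norm_Complex_two_inv_le(2)[of "y + 1/8"]
          y False wl by linarith+
      then have "cmod (Complex (1 / l + 1 / l) (y - 1/8)) * cmod (Complex (1 / l + 1 / l) (y + 1/8)) \<le> 1 * ((2 + w) / l)"
        using w l by (intro mult_mono) auto
      then show ?thesis by simp
    qed
  qed
  moreover have "exp (- exp (- l / 8) * (cos (l * (1 / l)) * cosh (l * y))) \<le> exp (- exp w / 4)"
    unfolding w_def by (rule exp_cosh_le) (use l in auto)
  ultimately have "exp (- exp (- l / 8) * (cos (l * (1 / l)) * cosh (l * y)))
     * (cmod (Complex (1 / l + 1 / l) (y - 1/8)) * cmod (Complex (1 / l + 1 / l) (y + 1/8)))
     * exp (- \<mu> * (pi - damp_angle l (1 / l) y)) \<le> exp (- exp w / 4) * ((2 + w) / l) * exp (- \<mu> * pi / 2)"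
    using angle_factor_le[of "1 / l" y] y l_inv w l  by (intro mult_mono3) auto
  also have "exp (- exp w / 4) * ((2 + w) / l) \<le> 6 / l"
  proof -
    have "exp (- exp w / 4) \<le> exp (- (w / 4))"
    proof -
      have "w \<le> exp w" using exp_ge_add_one_self[of w] by linarith
      then show ?thesis by simp
    qed
    moreover have "w / 4 \<le> exp (w / 4)" using exp_ge_add_one_self[of "w / 4"] by linarith
    then have "exp (- (w / 4)) * w \<le> 4" by (simp add: exp_minus field_simps)
    moreover have "exp (- (w / 4)) \<le> 1" using w by simp
    moreover have "exp (- (w / 4)) * (2 + w) = 2 * exp (- (w / 4)) + exp (- (w / 4)) * w"
      by (simp add: algebra_simps)
    ultimately have "exp (- exp w / 4) * (2 + w) \<le> 6"
      using mult_right_mono[of "exp (- exp w / 4)" "exp (- (w / 4))" "2 + w"] w by linarith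
    then show ?thesis using l by (simp add: divide_right_mono)
  qed
  finally show ?thesis using norm_damp[of l "1 / l" \<mu> y] l by (simp add: mult_right_mono)
qed

lemma damp_ends:
  assumes x: "0 \<le> x" "x \<le> 1 / l" and y: "\<bar>y\<bar> = 1/2"
  shows "cmod (damp l \<mu> (Complex x y)) \<le> exp (- exp (3 * l / 8) / 4) * exp (- \<mu> * pi / 2)"
proof -
  have "cmod (Complex (x + 1 / l) (y - 1/8)) \<le> 1" "cmod (Complex (x + 1 / l) (y + 1/8)) \<le> 1"
    using norm_Complex_le(1)[of x "y - 1/8"] norm_Complex_le(1)[of x "y + 1/8"] x y l_inv by linarith+
  then have "cmod (Complex (x + 1 / l) (y - 1/8)) * cmod (Complex (x + 1 / l) (y + 1/8)) \<le> 1 * 1"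
    by (intro mult_mono) auto
  moreover have "exp (- exp (- l / 8) * (cos (l * x) * cosh (l * y))) \<le> exp (- exp (3 * l / 8) / 4)"
    
  proof -
    \<comment> \<open>The length of the neck is \<open>1/2 - 1/8 = 3/8\<close>.\<close>
    have "l * (\<bar>y\<bar> - 1/8) = 3 * l / 8" using y by simp
    then show ?thesis using exp_cosh_le[OF x, of y] by (simp only:)
  qed
  ultimately have "exp (- exp (- l / 8) * (cos (l * x) * cosh (l * y)))
     * (cmod (Complex (x + 1 / l) (y - 1/8)) * cmod (Complex (x + 1 / l) (y + 1/8)))
     * exp (- \<mu> * (pi - damp_angle l x y)) \<le> exp (- exp (3 * l / 8) / 4) * (1 * 1) * exp (- \<mu> * pi / 2)"
    using angle_factor_le[of x y] x y  by (intro mult_mono3) auto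
  then show ?thesis using norm_damp[of l x \<mu> y] l x by simp
qed

text \<open>The deficit of the angle is \<open>2 * arctan (8 * r)\<close> with
  \<open>r \<le> 2 * \<eta>\<close>, hence at most \<open>32 * \<eta>\<close>. Both zeros are at
  distance at least 1/8, and \<open>192 = 3 * 8 * 8\<close>.\<close>

lemma damp_center:
  assumes \<eta>: "1 / l \<le> \<eta>"
  shows "cmod (damp l \<mu> (of_real \<eta>)) \<ge> exp (- 32 * \<mu> * \<eta>) / 192"
proof -
  define r where "r = \<eta> + 1 / l"
  have r: "0 < r" "r \<le> 2 * \<eta>" unfolding r_def using \<eta> l_inv by linarith+
  have "pi - damp_angle l \<eta> 0 = 2 * arctan (8 * r)"
  proof -
    have "arctan (1 / (8 * r)) = sgn (8 * r) * pi / 2 - arctan (8 * r)"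
      by (rule Transcendental.arctan_inverse) (use r in simp)
    moreover have "sgn (8 * r) = 1" using r by simp
    moreover have "1 / (8 * r) = 1/8 / r" by simp
    ultimately have "arctan (1/8 / r) = pi / 2 - arctan (8 * r)" by (simp only: mult_1)
    then show ?thesis by (simp add: damp_angle_def r_def [symmetric] arctan_minus)
  qed
  also have "\<dots> \<le> 2 * (8 * r)" using arctan_le_self[of "8 * r"] r by simp
  also have "\<dots> \<le> 32 * \<eta>" using r by simp
  finally have "exp (- 32 * \<mu> * \<eta>) \<le> exp (- \<mu> * (pi - damp_angle l \<eta> 0))"
    using mult_left_mono[of "pi - damp_angle l \<eta> 0" "32 * \<eta>" \<mu>] mu by (simp add: mult_ac)
  moreover have "cmod (Complex (\<eta> + 1 / l) (0 - 1/8)) * cmod (Complex (\<eta> + 1 / l) (0 + 1/8)) \<ge> 1/8 * (1/8)"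
    using abs_Im_le_cmod[of "Complex (\<eta> + 1 / l) (0 - 1/8)"] abs_Im_le_cmod[of "Complex (\<eta> + 1 / l) (0 + 1/8)"]
    by (intro mult_mono) auto
  ultimately have "1/3 * (1/8 * (1/8)) * exp (- 32 * \<mu> * \<eta>) \<le>
     exp (- exp (- l / 8) * (cos (l * \<eta>) * cosh (l * 0)))
     * (cmod (Complex (\<eta> + 1 / l) (0 - 1/8)) * cmod (Complex (\<eta> + 1 / l) (0 + 1/8)))
     * exp (- \<mu> * (pi - damp_angle l \<eta> 0))"
    using exp_cos_center(2)[of 0 \<eta>] by (intro mult_mono3) auto
  also have "\<dots> = cmod (damp l \<mu> (Complex \<eta> 0))"
    proof (rule norm_damp [symmetric])
    show "l > 0" using l by simp
    show "\<eta> \<ge> 0" using \<eta> l_inv by linarith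
  qed
  also have "Complex \<eta> 0 = of_real \<eta>" by (simp add: complex_eq_iff)
  finally show ?thesis by simp
qed

end

section \<open>Means over short segments\<close>

lemma norm_zeta_vertical_continuous:
  assumes "a > 0"
  shows "continuous_on {a..b} (\<lambda>t. cmod (zeta (Complex \<sigma> t)))"
proof (rule continuous_on_norm, rule continuous_on_compose2[OF holomorphic_on_imp_continuous_on[OF zeta_holomorphic]])
  show "continuous_on {a..b} (Complex \<sigma>)" by (simp add: Complex_eq continuous_intros)
  show "Complex \<sigma> ` {a..b} \<subseteq> - {1}" using assms by (auto simp: complex_eq_iff)
qed

text \<open>
  Apply Cauchy's formula to the damped function \<open>z \<mapsto> zeta (\<sigma> + \<i> (T + h / 2) + h z) * damp l \<mu> z\<close> on the
  T-shaped contour. The height of the point \<open>\<eta>\<close> above the line of integration is \<open>\<eta> h\<close>, so a small \<open>\<eta>\<close>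
  makes the loss \<open>exp (- 32 * \<mu> * \<eta>)\<close> caused by the damping a small power of \<open>h\<close>.
\<close>

lemma integral_norm_zeta_ge:
  fixes \<epsilon> :: real
  assumes \<epsilon>: "\<epsilon> > 0"
  obtains c A where "c > 0" "A > 0"
    "\<And>T h \<sigma>. T > 16 \<Longrightarrow> h > 0 \<Longrightarrow> \<sigma> \<ge> 1/2 \<Longrightarrow> A * (1 - \<sigma>) * (1 + ln (ln (T + h))) \<le> h \<Longrightarrow>
       integral {T..T + h} (\<lambda>t. cmod (zeta (Complex \<sigma> t))) \<ge> c * min (h powr (2 + \<epsilon>)) h"
proof -
  obtain B where B: "B \<ge> 1"
    "\<And>s. Re s \<ge> 1/2 \<Longrightarrow> Im s \<ge> 1 \<Longrightarrow> cmod (zeta s) \<le> B * (Im s)\<^sup>2"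
    using norm_zeta_le_square by metis
  \<comment> \<open>The bound 1/64 ensures \<open>1 + 32 * \<eta> < pi / 2\<close> and
    \<open>l \<ge> 64 * L\<close>; the bound \<open>\<epsilon> / 64\<close> keeps the loss
    \<open>H powr (64 * \<eta>)\<close> above \<open>H powr \<epsilon>\<close>.\<close>
  define \<eta> where "\<eta> = min (1/64) (\<epsilon> / 64)"
  have \<eta>: "0 < \<eta>" "\<eta> \<le> 1/64" "64 * \<eta> \<le> \<epsilon>" using \<epsilon> by (auto simp: \<eta>_def)
  \<comment> \<open>Here \<open>1440 = 40 * 36\<close> is the contour constant times the constant of
    \<open>M\<close>; the factor \<open>256 / \<eta>\<close> makes the resulting error half of the
    main term.\<close>
  define K where "K = 1440 * 256 * B / \<eta>"
  have K: "K \<ge> 1"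
  proof -
    have "\<eta> \<le> 1440 * 256 * B" using \<eta> B(1) by linarith
    then show ?thesis using \<eta> by (simp add: K_def field_simps)
  qed
  define c where "c = \<eta>\<^sup>2 / 256 * K powr (- 32 * \<eta>)"
  have "integral {T..T + h} (\<lambda>t. cmod (zeta (Complex \<sigma> t))) \<ge> c * min (h powr (2 + \<epsilon>)) h"
    if T: "T > 16" and h: "h > 0" and \<sigma>: "\<sigma> \<ge> 1/2" and A: "2 / \<eta> * (1 - \<sigma>) * (1 + ln (ln (T + h))) \<le> h" for T h \<sigma>
  proof -
    define X where "X = ln (T + h)"
    have X: "X > 1" "T + h = exp X"
    proof -
      show "T + h = exp X" using T h by (simp add: X_def)
      have "exp 1 < T + h" using exp_le T h by linarith
      then show "X > 1" unfolding \<open>T + h = exp X\<close> by simp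
    qed
    define L where "L = 1 + ln X"
    have L: "L > 1" using X by (simp add: L_def)
    \<comment> \<open>The neck has width \<open>1 / l = \<eta> / L\<close>, hence ends left of the
      centre. \<open>L\<close> grows like \<open>ln (ln (T + h))\<close>, which is enough for
      \<open>exp (3 * l / 8)\<close> to exceed a multiple of \<open>ln (T + h)\<close>.\<close>
    define l where "l = L / \<eta>"
    have l64: "l \<ge> 64 * L"
    proof -
      have "64 * \<eta> * L \<le> 1 * L" using \<eta> L by (intro mult_right_mono) auto
      then show ?thesis using \<eta> by (simp add: l_def field_simps)
    qed
    then have l8: "l \<ge> 8" using L by linarith
    have linv: "0 < 1 / l" "1 / l < \<eta>" "1 / l \<le> 1"
    proof -
      show "0 < 1 / l" "1 / l \<le> 1" using l8 by auto
      show "1 / l < \<eta>" using L \<eta> by (simp add: l_def field_simps)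
    qed
    have \<delta>: "1 - \<sigma> \<le> h / (2 * l)"
    proof -
      have "(1 - \<sigma>) * (2 * l) = 2 / \<eta> * (1 - \<sigma>) * (1 + ln (ln (T + h)))"
      proof -
        have "(1 - \<sigma>) * (2 * (Y / \<eta>)) = 2 / \<eta> * (1 - \<sigma>) * Y" for Y by (simp add: field_simps)
        then show ?thesis unfolding l_def L_def X_def .
      qed
      then have "(1 - \<sigma>) * (2 * l) \<le> h" using A by simp
      then show ?thesis using l8 by (simp add: pos_le_divide_eq)
    qed
    \<comment> \<open>For long segments the powers of the length saturate: both the bound
      \<open>3 / (H * x)\<close> for zeta and the lower bound at the centre are governed by
      \<open>min 1 h\<close>.\<close>
    define H where "H = min 1 h"
    have H: "0 < H" "H \<le> 1" "H \<le> h" using h by (auto simp: H_def)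
    \<comment> \<open>\<open>exp \<mu>\<close> matches, up to constants, the ratio of the contour
      bound of order \<open>1 / H\<close> to the central bound of order \<open>H\<close>.\<close>
    define \<mu> where "\<mu> = ln (K / H\<^sup>2)"
    have H2: "0 < H\<^sup>2" "H\<^sup>2 \<le> 1" using H by (auto simp: power_le_one)
    have KH: "K / H\<^sup>2 \<ge> 1" using K H2 by (simp add: field_simps)
    have \<mu>: "\<mu> \<ge> 0" "exp \<mu> = K / H\<^sup>2" using KH by (auto simp: \<mu>_def)
    define E where "E = exp (- \<mu> * pi / 2)"
    have E0: "E > 0" by (simp add: E_def)
    define t0 where "t0 = T + h / 2"
    have t0: "t0 > 16" using T h by (simp add: t0_def)
    define s where "s = (\<lambda>z. Complex \<sigma> t0 + of_real h * z)"
    have s_Re: "Re (s z) = \<sigma> + h * Re z" and s_Im: "Im (s z) = t0 + h * Im z" for z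
      by (simp_all add: s_def)
    define F where "F = (\<lambda>z. zeta (s z) * damp l \<mu> z)"
    \<comment> \<open>The lower half-plane removed here corresponds to
      \<open>Im (s z) \<le> 0\<close>, which contains the pole; what remains is convex.\<close>
    define S where "S = {z. Re z > - 1 / l} \<inter> {z. Im z > - t0 / h}"
    have S: "open S" "convex S"
      unfolding S_def by (auto intro!: open_Int convex_Int simp: open_halfspace_Re_gt open_halfspace_Im_gt
          convex_halfspace_Re_gt convex_halfspace_Im_gt)
    have s_Im_pos: "Im (s z) > 0" if "z \<in> S" for z
      using that h by (simp add: S_def s_Im field_simps)
    have hol: "F holomorphic_on S"
    proof -
      have "zeta \<circ> s holomorphic_on S"
      proof (rule holomorphic_on_compose)
        show "s holomorphic_on S" unfolding s_def by (intro holomorphic_intros)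
        have "1 \<notin> s ` S" using s_Im_pos by force
        then show "zeta holomorphic_on s ` S" by (rule zeta_holomorphic_on)
      qed
      moreover have "damp l \<mu> holomorphic_on S"
        by (rule holomorphic_on_subset[OF damp_holomorphic]) (auto simp: S_def)
      ultimately show ?thesis unfolding F_def o_def by (rule holomorphic_on_mult)
    qed
    have sub: "z \<in> S" if "0 \<le> Re z" "Re z \<le> 1" "\<bar>Im z\<bar> \<le> 1/2" for z
    proof -
      have "h * (- 1/2) \<le> h * Im z" using that h by (intro mult_left_mono) auto
      then have "t0 + h * Im z > 0" using T by (simp add: t0_def)
      moreover have "Re z > - 1 / l" using that linv by linarith
      ultimately show ?thesis using h by (simp add: S_def field_simps)
    qed
    have zeta_right: "cmod (zeta (s (Complex x y))) \<le> 3 / (H * x)" if x: "1 / l \<le> x" "x \<le> 1" for x y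
    proof -
      have x0: "x > 0" using x linv by linarith
      have "h / (2 * l) = h * (1 / l) / 2" by simp
      also have "\<dots> \<le> h * x / 2" using x h by (intro divide_right_mono mult_left_mono) auto
      finally have R: "Re (s (Complex x y)) - 1 \<ge> h * x / 2" using \<delta> by (simp add: s_Re)
      have Hx: "0 < H * x" "H * x \<le> 1" "H * x \<le> h * x"
        using H x x0 mult_mono[of H 1 x 1] by auto
      have hx: "h * x / 2 > 0" using h x0 by simp
      have q1: "cmod (zeta (s (Complex x y))) \<le> 1 + 1 / (Re (s (Complex x y)) - 1)"
        by (rule norm_zeta_le) (use R hx in linarith)
      have q2: "1 / (Re (s (Complex x y)) - 1) \<le> 1 / (H * x / 2)"
        using R hx Hx by (intro divide_left_mono mult_pos_pos) auto
      have q3: "1 \<le> 1 / (H * x)" using Hx by simp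
      have "1 / (H * x) + 1 / (H * x / 2) = 3 / (H * x)" by (simp flip: add_divide_distrib)
      moreover have "cmod (zeta (s (Complex x y))) \<le> 1 / (H * x) + 1 / (H * x / 2)"
        using q1 add_mono[OF q3 q2] by (rule order_trans)
      ultimately show ?thesis by (simp only:)
    qed
    define M where "M = 36 * B * E / H"
    have M0: "M \<ge> 0" using B(1) E0 H by (simp add: M_def)
    have EH: "k * (E / H) \<le> M" if "k \<le> 36 * B" for k
      using mult_right_mono[OF that, of "E / H"] E0 H by (simp add: M_def)
    have shoulder: "cmod (F (Complex x y)) \<le> M" if "1 / l \<le> x" "x \<le> 1" "\<bar>y\<bar> = 1/8" for x y
    proof -
      have x0: "x > 0" using that linv by linarith
      have "cmod (F (Complex x y)) \<le> 3 / (H * x) * (12 * x * E)"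
        unfolding F_def norm_mult E_def
        using zeta_right[OF that(1,2)] damp_shoulder[OF l8 \<mu>(1) that] x0 H by (intro mult_mono) auto
      also have "\<dots> = 36 * (E / H)" using x0 by simp
      also have "\<dots> \<le> M" by (rule EH) (use B(1) in simp)
      finally show ?thesis .
    qed
    have right: "cmod (F (Complex 1 y)) \<le> M" if "\<bar>y\<bar> \<le> 1/8" for y
    proof -
      have "cmod (F (Complex 1 y)) \<le> 3 / (H * 1) * (12 * E)"
        unfolding F_def norm_mult E_def
        using zeta_right[of 1 y] damp_right[OF l8 \<mu>(1) that] linv H by (intro mult_mono) auto
      also have "\<dots> = 36 * (E / H)" by simp
      also have "\<dots> \<le> M" by (rule EH) (use B(1) in simp)
      finally show ?thesis .
    qed
    have neck: "cmod (F (Complex (1 / l) y)) \<le> M" if "1/8 \<le> \<bar>y\<bar>" "\<bar>y\<bar> \<le> 1/2" for y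
    proof -
      have "cmod (F (Complex (1 / l) y)) \<le> 3 / (H * (1 / l)) * (6 / l * E)"
        unfolding F_def norm_mult E_def
        using zeta_right[of "1 / l" y] damp_neck[OF l8 \<mu>(1) that] linv l8 H by (intro mult_mono) auto
      also have "\<dots> = 18 * (E / H)" using l8 by simp
      also have "\<dots> \<le> M" by (rule EH) (use B(1) in simp)
      finally show ?thesis .
    qed
    have ends: "cmod (F (Complex x y)) \<le> M" if "0 \<le> x" "x \<le> 1 / l" "\<bar>y\<bar> = 1/2" for x y
    proof -
      have Im: "T \<le> Im (s (Complex x y))" "Im (s (Complex x y)) \<le> T + h"
      proof -
        have "y = 1/2 \<or> y = - (1/2)" using that(3) by linarith
        then have "h * y = h / 2 \<or> h * y = - (h / 2)" by auto
        then show "T \<le> Im (s (Complex x y))" "Im (s (Complex x y)) \<le> T + h"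
          using h unfolding s_Im t0_def complex.sel by linarith+
      qed
      have "cmod (zeta (s (Complex x y))) \<le> B * (Im (s (Complex x y)))\<^sup>2"
        by (rule B(2)) (use Im T \<sigma> h that in \<open>auto simp: s_Re intro: add_increasing2\<close>)
      also have "\<dots> \<le> B * (exp X)\<^sup>2"
        using Im T B(1) X by (intro mult_left_mono power_mono) auto
      finally have z: "cmod (zeta (s (Complex x y))) \<le> B * exp (2 * X)"
        by (simp add: power2_eq_square flip: exp_add)
      \<comment> \<open>This must beat \<open>(T + h)\<^sup>2 = exp (2 * X)\<close>. Since
        \<open>exp L \<ge> 2 * X\<close>, cubing gives
        \<open>exp (3 * l / 8) \<ge> 8 * X ^ 3 \<ge> 8 * X\<close>, and a quarter of it is at least
        \<open>2 * X\<close>.\<close>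
      have "exp (- exp (3 * l / 8) / 4) \<le> exp (- (2 * X))"
      proof -
        have "exp L = exp 1 * X" using X by (simp add: L_def exp_add)
        also have "\<dots> \<ge> 2 * X" using exp_ge_add_one_self[of 1] X by (intro mult_right_mono) auto
        finally have "(2 * X) ^ 3 \<le> exp L ^ 3" using X by (intro power_mono) auto
        also have "exp L ^ 3 = exp (3 * L)" by (simp flip: exp_of_nat_mult)
        also have "\<dots> \<le> exp (3 * l / 8)" using l64 L by simp
        finally have "8 * X ^ 3 \<le> exp (3 * l / 8)" by (simp add: power_mult_distrib)
        moreover have "X ^ 1 \<le> X ^ 3" using X by (intro power_increasing) auto
        ultimately show ?thesis by simp
      qed
      then have "exp (- exp (3 * l / 8) / 4) * E \<le> exp (- (2 * X)) * E"
        by (rule mult_right_mono) (use E0 in simp)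
      then have "cmod (damp l \<mu> (Complex x y)) \<le> exp (- (2 * X)) * E"
        using damp_ends[OF l8 \<mu>(1) that] unfolding E_def by (rule order_trans[rotated])
      then have "cmod (F (Complex x y)) \<le> (B * exp (2 * X)) * (exp (- (2 * X)) * E)"
        unfolding F_def norm_mult using z B(1) by (intro mult_mono) auto
      also have "\<dots> = B * E" by (simp add: exp_minus)
      also have "\<dots> \<le> B * (E / H)"
        using B(1) E0 H by (intro mult_left_mono) (auto simp: field_simps)
      also have "\<dots> \<le> M" by (rule EH) (use B(1) in simp)
      finally show ?thesis .
    qed
    have cauchy: "2 * pi * cmod (F (of_real \<eta>)) \<le> 40 * M + 1 / \<eta> * integral {-1/2..1/2} (\<lambda>y. cmod (F (Complex 0 y)))"
      by (rule cauchy_T_shape_bound[OF S hol sub linv(1,2) _ _ M0 shoulder right neck ends]) (use \<eta> in auto)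
    define I where "I = integral {T..T + h} (\<lambda>t. cmod (zeta (Complex \<sigma> t)))"
    have zcont: "continuous_on {T..T + h} (\<lambda>t. cmod (zeta (Complex \<sigma> t)))"
      by (rule norm_zeta_vertical_continuous) (use T in simp)
    have left: "integral {-1/2..1/2} (\<lambda>y. cmod (F (Complex 0 y))) \<le> I / h"
    proof -
      have "((\<lambda>t. cmod (zeta (Complex \<sigma> t))) has_integral I) (cbox T (T + h))"
        unfolding I_def using integrable_integral[OF integrable_continuous_real[OF zcont]] by simp
      from has_integral_affinity'[OF this h, of t0]
      have "((\<lambda>y. cmod (zeta (Complex \<sigma> (h * y + t0)))) has_integral I / h) (cbox ((T - t0) / h) ((T + h - t0) / h))"
        by (simp add: divide_inverse_commute)
      moreover have "(T - t0) / h = -1/2" "(T + h - t0) / h = 1/2"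
        using h by (auto simp: t0_def field_simps)
      ultimately have I': "((\<lambda>y. cmod (zeta (Complex \<sigma> (h * y + t0)))) has_integral I / h) {-1/2..1/2}"
        by simp
      show ?thesis
      proof (rule integral_le[OF _ has_integral_integrable[OF I'], unfolded integral_unique[OF I']])
        have "continuous_on {-1/2..1/2} (\<lambda>y. F (Complex 0 y))"
          by (rule continuous_on_compose2[OF holomorphic_on_imp_continuous_on[OF hol]])
             (auto intro!: sub continuous_intros simp: Complex_eq)
        then show "(\<lambda>y. cmod (F (Complex 0 y))) integrable_on {-1/2..1/2}"
          by (intro integrable_continuous_real continuous_on_norm)
        fix y :: real assume y: "y \<in> {-1/2..1/2}"
        have "s (Complex 0 y) = Complex \<sigma> (h * y + t0)" by (simp add: s_def complex_eq_iff)
        moreover have "cmod (damp l \<mu> (Complex 0 y)) \<le> 1"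
          by (rule damp_left[OF l8 \<mu>(1)]) (use y in \<open>simp add: abs_le_iff, linarith\<close>)
        ultimately show "cmod (F (Complex 0 y)) \<le> cmod (zeta (Complex \<sigma> (h * y + t0)))"
          by (simp add: F_def norm_mult mult_left_le)
      qed
    qed
    have center: "cmod (F (of_real \<eta>)) \<ge> \<eta> * H / 4 * (exp (- 32 * \<mu> * \<eta>) / 192)"
    proof -
      have "\<eta> * H / 4 \<le> cmod (zeta (s (of_real \<eta>)))"
      proof -
        define x where "x = Re (s (of_real \<eta>)) - 1"
        have "h / (2 * l) = h * (1 / l) / 2" by simp
        also have "\<dots> \<le> h * \<eta> / 2" using linv h by (intro divide_right_mono mult_left_mono) auto
        finally have "1 - \<sigma> \<le> h * \<eta> / 2" using \<delta> by (rule order_trans[rotated])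
        moreover have "x = \<sigma> + h * \<eta> - 1" by (simp add: s_Re x_def)
        ultimately have "x \<ge> h * \<eta> / 2" by linarith
        moreover have "h * \<eta> / 2 \<ge> H * \<eta> / 2" using H \<eta> by (intro divide_right_mono mult_right_mono) auto
        ultimately have x: "x \<ge> H * \<eta> / 2" by linarith
        have He: "0 < H * \<eta>" "H * \<eta> \<le> 1" using H \<eta> mult_mono[of H 1 \<eta> 1] by auto
        have x0: "x > 0" using x He by linarith
        have "\<eta> * H / 4 \<le> x / (1 + x)"
        proof -
          have "H * \<eta> * (1 + x) \<le> 4 * x"
          proof -
            have "H * \<eta> * x \<le> 1 * x" using He x0 by (intro mult_right_mono) auto
            moreover have "H * \<eta> * (1 + x) = H * \<eta> + H * \<eta> * x" by (simp add: algebra_simps)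
            ultimately show ?thesis using x x0 by linarith
          qed
          then show ?thesis using x0 by (simp add: field_simps)
        qed
        also have "\<dots> \<le> cmod (zeta (s (of_real \<eta>)))"
          using norm_zeta_ge[of "s (of_real \<eta>)"] x0 by (simp add: x_def)
        finally show ?thesis .
      qed
      moreover have "exp (- 32 * \<mu> * \<eta>) / 192 \<le> cmod (damp l \<mu> (of_real \<eta>))"
        by (rule damp_center[OF l8 \<mu>(1)]) (use linv in linarith)
      ultimately show ?thesis
        unfolding F_def norm_mult using \<eta> H by (intro mult_mono) auto
    qed
    define W where "W = exp (- 32 * \<mu> * \<eta>)"
    have W0: "W > 0" by (simp add: W_def)
    \<comment> \<open>The comparison of gain and loss:
      \<open>\<mu> * (1 + 32 * \<eta>) \<le> \<mu> * (pi / 2)\<close>, where the summand 1 stands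
      for the factor \<open>K / H\<^sup>2\<close>.\<close>
    have KEW: "K * E \<le> H\<^sup>2 * W"
    proof -
      have "\<mu> * (1 + 32 * \<eta>) \<le> \<mu> * (pi / 2)"
        using \<mu>(1) \<eta> pi_gt3 by (intro mult_left_mono) auto
      then have "exp (\<mu> + - \<mu> * pi / 2) \<le> W" by (simp add: W_def algebra_simps)
      then have "K / H\<^sup>2 * E \<le> W" by (simp only: exp_add \<mu>(2) E_def)
      then show ?thesis using H2 by (simp add: field_simps)
    qed
    have M_le: "40 * M \<le> \<eta> / 256 * H * W"
    proof -
      have "40 * M = \<eta> / 256 * (K * E) / H" using \<eta> by (simp add: M_def K_def)
      also have "\<dots> \<le> \<eta> / 256 * (H\<^sup>2 * W) / H"
        using KEW \<eta> H by (intro divide_right_mono mult_left_mono) auto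
      also have "\<dots> = \<eta> / 256 * H * W" using H by (simp add: power2_eq_square)
      finally show ?thesis .
    qed
    have "\<eta> / 128 * H * W \<le> 2 * pi * cmod (F (of_real \<eta>))"
    proof -
      \<comment> \<open>The constant is \<open>2 * 3 / (4 * 192) = 1 / 128\<close>, twice the share
        \<open>\<eta> / 256\<close> that the choice of \<open>K\<close> leaves to the
        contour.\<close>
      have "\<eta> / 128 * H * W = 2 * 3 * (\<eta> * H / 4 * (W / 192))" by simp
      also have "\<dots> \<le> 2 * pi * cmod (F (of_real \<eta>))"
        using center pi_gt3 \<eta> H W0 unfolding W_def by (intro mult_mono) auto
      finally show ?thesis .
    qed
    also have "\<dots> \<le> \<eta> / 256 * H * W + 1 / \<eta> * (I / h)"
      using cauchy M_le mult_left_mono[OF left, of "1 / \<eta>"] \<eta> by simp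
    finally have "\<eta> / 256 * H * W \<le> 1 / \<eta> * (I / h)" by (simp add: field_simps)
    then have "\<eta> * h * (\<eta> / 256 * H * W) \<le> \<eta> * h * (1 / \<eta> * (I / h))"
      using \<eta> h by (intro mult_left_mono) auto
    then have I_ge: "\<eta>\<^sup>2 / 256 * h * H * W \<le> I"
      using \<eta> h by (simp add: power2_eq_square mult_ac)
    have W_eq: "W \<ge> K powr (- 32 * \<eta>) * H powr \<epsilon>"
    proof -
      have "W = (K / H\<^sup>2) powr (- 32 * \<eta>)"
        using K H by (simp add: W_def powr_def \<mu>_def mult_ac)
      also have "\<dots> = K powr (- 32 * \<eta>) * (H\<^sup>2) powr (32 * \<eta>)"
      proof -
        have "(K / H\<^sup>2) powr (- 32 * \<eta>) = K powr (- 32 * \<eta>) / (H\<^sup>2) powr (- 32 * \<eta>)"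
          by (rule powr_divide)
        then show ?thesis by (simp add: powr_minus divide_inverse)
      qed
      also have "(H\<^sup>2) powr (32 * \<eta>) = H powr (64 * \<eta>)"
      proof -
        have "(H\<^sup>2) powr (32 * \<eta>) = (H powr 2) powr (32 * \<eta>)" using H by simp
        also have "\<dots> = H powr (2 * (32 * \<eta>))" by (rule powr_powr)
        finally show ?thesis by simp
      qed
      finally have "W = K powr (- 32 * \<eta>) * H powr (64 * \<eta>)" .
      moreover have "H powr \<epsilon> \<le> H powr (64 * \<eta>)"
        using \<eta> H by (intro powr_mono') auto
      ultimately show ?thesis by (simp add: mult_left_mono)
    qed
    have "min (h powr (2 + \<epsilon>)) h \<le> h * H * H powr \<epsilon>"
    proof (cases "h \<le> 1")
      case True
      then have "h * H * H powr \<epsilon> = h powr (2 + \<epsilon>)"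
        using h by (simp add: H_def powr_add power2_eq_square)
      then show ?thesis by simp
    next
      case False
      then show ?thesis using h by (simp add: H_def)
    qed
    then have "c * min (h powr (2 + \<epsilon>)) h \<le> c * (h * H * H powr \<epsilon>)"
      using K by (intro mult_left_mono) (auto simp: c_def)
    also have "\<dots> = \<eta>\<^sup>2 / 256 * h * H * (K powr (- 32 * \<eta>) * H powr \<epsilon>)" by (simp add: c_def)
    also have "\<dots> \<le> \<eta>\<^sup>2 / 256 * h * H * W"
      using W_eq h H by (intro mult_left_mono) auto
    also have "\<dots> \<le> I" by (rule I_ge)
    finally show ?thesis by (simp add: I_def)
  qed
  moreover have "c > 0" using \<eta> K by (simp add: c_def)
  ultimately show ?thesis using that[of c "2 / \<eta>"] \<eta> by auto
qed

section \<open>Bounded heights\<close>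

lemma integral_ge_on_subinterval:
  fixes g :: "real \<Rightarrow> real"
  assumes g: "continuous_on {a..b} g" "\<And>t. t \<in> {a..b} \<Longrightarrow> g t \<ge> 0"
    and uv: "a \<le> u" "u \<le> v" "v \<le> b" and m: "\<And>t. t \<in> {u..v} \<Longrightarrow> g t \<ge> m"
  shows "integral {a..b} g \<ge> m * (v - u)"
proof -
  have "continuous_on {u..v} g" by (rule continuous_on_subset[OF g(1)]) (use uv in auto)
  then have i: "g integrable_on {u..v}" by (rule integrable_continuous_real)
  have "m * (v - u) = integral {u..v} (\<lambda>_. m)" using uv by simp
  also have "\<dots> \<le> integral {u..v} g" by (rule integral_le[OF _ i m]) auto
  also have "\<dots> \<le> integral {a..b} g"
    by (rule integral_subset_le) (use uv g i in \<open>auto intro: integrable_continuous_real\<close>)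
  finally show ?thesis .
qed

text \<open>Wherever \<open>t1\<close> lies, one of the two outer quarters of the interval stays at
  distance at least \<open>H / 4\<close> from it.\<close>

lemma integral_ge_of_dist_le:
  fixes g :: "real \<Rightarrow> real"
  assumes g: "continuous_on {T..T + H} g" and c: "c \<ge> 0" and H: "H > 0"
    and le: "\<And>t. t \<in> {T..T + H} \<Longrightarrow> g t \<ge> c * \<bar>t - t1\<bar>"
  shows "integral {T..T + H} g \<ge> c / 16 * H\<^sup>2"
proof -
  have g0: "g t \<ge> 0" if "t \<in> {T..T + H}" for t
    using le[OF that] c by (meson abs_ge_zero mult_nonneg_nonneg order_trans)
  have m: "g t \<ge> c * (H / 4)" if "t \<in> {T..T + H}" "\<bar>t - t1\<bar> \<ge> H / 4" for t
    using le[OF that(1)] mult_left_mono[OF that(2) c] by linarith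
  show ?thesis
  proof (cases "t1 \<ge> T + H / 2")
    case True
    have "g t \<ge> c * (H / 4)" if "t \<in> {T..T + H / 4}" for t
      by (rule m) (use that True H in auto)
    then have "integral {T..T + H} g \<ge> c * (H / 4) * (T + H / 4 - T)"
      using H by (intro integral_ge_on_subinterval[OF g g0]) auto
    then show ?thesis by (simp add: power2_eq_square)
  next
    case False
    have "g t \<ge> c * (H / 4)" if "t \<in> {T + 3 * H / 4..T + H}" for t
      by (rule m) (use that False H in auto)
    then have "integral {T..T + H} g \<ge> c * (H / 4) * (T + H - (T + 3 * H / 4))"
      using H by (intro integral_ge_on_subinterval[OF g g0]) auto
    then show ?thesis by (simp add: power2_eq_square algebra_simps)
  qed
qed

text \<open>By the lower bound \<open>norm_zeta_ge\<close>, a zero on the line \<open>Re s = 1\<close> would be simple.\<close>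

lemma norm_zeta_ge_dist_local:
  assumes s1: "Re s1 = 1" "s1 \<noteq> 1"
  shows "\<exists>r c. r > 0 \<and> c > 0 \<and> (\<forall>s\<in>ball s1 r. cmod (zeta s) \<ge> c * cmod (s - s1))"
proof (cases "zeta s1 = 0")
  case False
  have "isCont zeta s1"
    using holomorphic_on_imp_continuous_on[OF zeta_holomorphic] s1(2)
    by (subst (asm) continuous_on_eq_continuous_at) auto
  then have "((\<lambda>s. cmod (zeta s)) \<longlongrightarrow> cmod (zeta s1)) (at s1)"
    by (intro tendsto_norm) (simp add: isCont_def)
  then have "\<forall>\<^sub>F s in at s1. cmod (zeta s) > cmod (zeta s1) / 2"
    by (rule order_tendstoD) (use False in simp)
  then obtain d where d: "d > 0" "\<And>s. s \<noteq> s1 \<Longrightarrow> dist s s1 < d \<Longrightarrow> cmod (zeta s) > cmod (zeta s1) / 2"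
    by (auto simp: eventually_at)
  \<comment> \<open>Radius at most 1 lets a constant lower bound be weakened to the linear form that
    also covers a simple zero.\<close>
  have "cmod (zeta s) \<ge> cmod (zeta s1) / 2 * cmod (s - s1)" if "s \<in> ball s1 (min d 1)" for s
  proof -
    have "cmod (s - s1) \<le> 1" "dist s s1 < d" using that by (auto simp: dist_norm norm_minus_commute)
    moreover have "cmod (zeta s) \<ge> cmod (zeta s1) / 2"
      using d(2)[of s] \<open>dist s s1 < d\<close> by (cases "s = s1") auto
    ultimately show ?thesis
      using mult_left_mono[of "cmod (s - s1)" 1 "cmod (zeta s1) / 2"] by simp
  qed
  then show ?thesis using d(1) False by (intro exI[of _ "min d 1"] exI[of _ "cmod (zeta s1) / 2"]) auto
next
  case True
  have "(zeta has_field_derivative deriv zeta s1) (at s1)"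
    by (rule holomorphic_derivI[OF zeta_holomorphic]) (use s1 in auto)
  then have lim: "((\<lambda>h. cmod (zeta (s1 + h) / h)) \<longlongrightarrow> cmod (deriv zeta s1)) (at 0)"
    using True by (intro tendsto_norm) (simp add: DERIV_def)
  \<comment> \<open>Approach the zero horizontally from the right: the difference quotient at
    \<open>s1 + x\<close> is at least \<open>1 / (1 + x) \<ge> 1/2\<close> in modulus for
    \<open>x \<le> 1\<close>.\<close>
  have "cmod (deriv zeta s1) \<ge> 1/2"
  proof (rule ccontr)
    assume "\<not> ?thesis"
    then have "\<forall>\<^sub>F h in at 0. cmod (zeta (s1 + h) / h) < 1/2"
      using order_tendstoD(2)[OF lim, of "1/2"] by simp
    then obtain d where d: "d > 0" "\<And>h. h \<noteq> 0 \<Longrightarrow> dist h 0 < d \<Longrightarrow> cmod (zeta (s1 + h) / h) < 1/2"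
      by (auto simp: eventually_at)
    define x where "x = min (d / 2) 1"
    have x: "0 < x" "x < d" "x \<le> 1" using d(1) by (auto simp: x_def)
    have "x / (1 + x) \<le> cmod (zeta (s1 + of_real x))"
      using norm_zeta_ge[of "s1 + of_real x"] s1 x by (simp add: add.commute)
    moreover have "x / 2 \<le> x / (1 + x)" using x by (intro divide_left_mono) auto
    moreover have "cmod (zeta (s1 + of_real x)) < 1/2 * x"
      using d(2)[of "of_real x"] x by (simp add: norm_divide field_simps)
    ultimately show False by linarith
  qed
  then have "\<forall>\<^sub>F h in at 0. cmod (zeta (s1 + h) / h) > 1/4"
    by (intro order_tendstoD(1)[OF lim]) simp
  then obtain d where d: "d > 0" "\<And>h. h \<noteq> 0 \<Longrightarrow> dist h 0 < d \<Longrightarrow> cmod (zeta (s1 + h) / h) > 1/4"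
    by (auto simp: eventually_at)
  have "cmod (zeta s) \<ge> 1/4 * cmod (s - s1)" if "s \<in> ball s1 d" for s
  proof (cases "s = s1")
    case False
    then show ?thesis
      using d(2)[of "s - s1"] that by (simp add: norm_divide dist_norm norm_minus_commute field_simps)
  qed auto
  then show ?thesis using d(1) by (intro exI[of _ d] exI[of _ "1/4"]) auto
qed

lemma norm_zeta_ge_dist:
  obtains r c where "r > 0" "c > 0"
    "\<And>t. 16 \<le> t \<Longrightarrow> t \<le> T1 \<Longrightarrow> \<exists>s1. \<forall>s\<in>ball (Complex 1 t) r. cmod (zeta s) \<ge> c * cmod (s - s1)"
proof -
  define K where "K = Complex 1 ` {16..T1}"
  have K: "compact K"
    unfolding K_def by (intro compact_continuous_image) (auto simp: Complex_eq intro!: continuous_intros)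
  have "\<forall>k\<in>K. \<exists>r c. r > 0 \<and> c > 0 \<and> (\<forall>s\<in>ball k r. cmod (zeta s) \<ge> c * cmod (s - k))"
    by (intro ballI norm_zeta_ge_dist_local) (auto simp: K_def complex_eq_iff)
  then obtain r c where rc: "\<And>k. k \<in> K \<Longrightarrow> r k > 0 \<and> c k > 0 \<and> (\<forall>s\<in>ball k (r k). cmod (zeta s) \<ge> c k * cmod (s - k))"
    by metis
  have cover: "K \<subseteq> (\<Union>k\<in>K. ball k (r k))" using rc by force
  obtain K' where K': "K' \<subseteq> K" "finite K'" "K \<subseteq> (\<Union>k\<in>K'. ball k (r k))"
    using compactE_image[OF K, of K "\<lambda>k. ball k (r k)"] cover by (metis open_ball)
  have op: "\<And>G. G \<in> (\<lambda>k. ball k (r k)) ` K' \<Longrightarrow> open G" by auto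
  obtain e where e: "e > 0" "\<And>x. x \<in> K \<Longrightarrow> \<exists>G\<in>(\<lambda>k. ball k (r k)) ` K'. ball x e \<subseteq> G"
    using Heine_Borel_lemma[OF K K'(3) op] by blast
  \<comment> \<open>Inserting 1 keeps \<open>Min\<close> meaningful when the subcover is empty, as
    for \<open>T1 < 16\<close>.\<close>
  define c0 where "c0 = Min (insert 1 (c ` K'))"
  have c0: "c0 > 0" "\<And>k. k \<in> K' \<Longrightarrow> c0 \<le> c k"
    unfolding c0_def using K' rc by (auto simp: subset_iff)
  have "\<exists>s1. \<forall>s\<in>ball (Complex 1 t) e. cmod (zeta s) \<ge> c0 * cmod (s - s1)" if "16 \<le> t" "t \<le> T1" for t
  proof -
    have "Complex 1 t \<in> K" using that by (auto simp: K_def)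
    then obtain k where k: "k \<in> K'" "ball (Complex 1 t) e \<subseteq> ball k (r k)" using e(2) by blast
    have "cmod (zeta s) \<ge> c0 * cmod (s - k)" if "s \<in> ball (Complex 1 t) e" for s
    proof -
      have "c0 * cmod (s - k) \<le> c k * cmod (s - k)" using c0(2)[OF k(1)] by (rule mult_right_mono) simp
      also have "\<dots> \<le> cmod (zeta s)" using rc k that K'(1) by blast
      finally show ?thesis .
    qed
    then show ?thesis by blast
  qed
  then show ?thesis using that[of e c0] e(1) c0(1) by blast
qed

text \<open>For fixed \<open>h\<close> the integral depends continuously on the starting point of
  the segment and so attains its minimum. A minimum of 0 would make zeta vanish on a segment, hence
  also at 2.\<close>

lemma integral_norm_zeta_ge_compact:
  assumes h: "h > 0"
  obtains m where "m > 0"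
    "\<And>T \<sigma>. 16 \<le> T \<Longrightarrow> T \<le> T1 \<Longrightarrow> 1/2 \<le> \<sigma> \<Longrightarrow> \<sigma> \<le> b \<Longrightarrow> integral {T..T + h} (\<lambda>t. cmod (zeta (Complex \<sigma> t))) \<ge> m"
proof (cases "16 \<le> T1 \<and> 1/2 \<le> b")
  case True
  define R where "R = cbox (Complex (1/2) 16) (Complex b T1)"
  define \<Phi> where "\<Phi> = (\<lambda>w. integral {0..h} (\<lambda>u. cmod (zeta (w + \<i> * of_real u))))"
  have R: "compact R" "R \<noteq> {}"
    using True by (auto simp: R_def in_cbox_complex_iff box_ne_empty Basis_complex_def)
  have ne: "w + \<i> * of_real u \<noteq> 1" if "w \<in> R" "u \<ge> 0" for w u
    using that by (auto simp: R_def in_cbox_complex_iff complex_eq_iff)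
  have cont2: "continuous_on (R \<times> {0..h}) (\<lambda>(w, u). cmod (zeta (w + \<i> * of_real u)))"
    unfolding case_prod_unfold
    by (rule continuous_on_norm, rule continuous_on_compose2[OF holomorphic_on_imp_continuous_on[OF zeta_holomorphic]])
       (use ne in \<open>auto intro!: continuous_intros\<close>)
  have cont1: "continuous_on {0..h} (\<lambda>u. cmod (zeta (w + \<i> * of_real u)))" if "w \<in> R" for w
    by (rule continuous_on_norm, rule continuous_on_compose2[OF holomorphic_on_imp_continuous_on[OF zeta_holomorphic]])
       (use ne that in \<open>auto intro!: continuous_intros\<close>)
  have "continuous_on R \<Phi>"
    unfolding \<Phi>_def using integral_continuous_on_param[of R 0 h "\<lambda>w u. cmod (zeta (w + \<i> * of_real u))"] cont2
    by simp
  then obtain w0 where w0: "w0 \<in> R" "\<And>w. w \<in> R \<Longrightarrow> \<Phi> w0 \<le> \<Phi> w"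
    using continuous_attains_inf[OF R] by blast
  have "\<Phi> w0 > 0"
  proof (rule ccontr)
    assume "\<not> ?thesis"
    moreover have "\<Phi> w0 \<ge> 0"
      unfolding \<Phi>_def by (intro integral_nonneg integrable_continuous_real cont1 w0) auto
    ultimately have "\<Phi> w0 = 0" by simp
    then have zero: "zeta (w0 + \<i> * of_real u) = 0" if "u \<in> {0..h}" for u
      using integral_eq_0_iff[of 0 h "\<lambda>u. cmod (zeta (w0 + \<i> * of_real u))"] cont1[OF w0(1)] h that
      by (auto simp: \<Phi>_def)
    have "zeta 2 = 0"
    proof (rule analytic_continuation[of zeta "- {1}" "(\<lambda>u. w0 + \<i> * of_real u) ` {0..h}" "w0 + \<i> * of_real (h/2)"])
      show "connected (- {1::complex})" by (rule connected_punctured_universe) simp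
      show "(\<lambda>u. w0 + \<i> * of_real u) ` {0..h} \<subseteq> - {1}" using ne[OF w0(1)] by auto
      show "w0 + \<i> * of_real (h/2) \<in> - {1}" using ne[OF w0(1), of "h/2"] h by auto
      have "h/2 islimpt {0..h}" using h by (intro interior_limit_point) (auto simp: interior_atLeastAtMost_real)
      then show "w0 + \<i> * of_real (h/2) islimpt (\<lambda>u. w0 + \<i> * of_real u) ` {0..h}"
        by (rule islimpt_isCont_image) (auto simp: eventually_at_filter complex_eq_iff)
    qed (auto intro: zeta_holomorphic zero)
    with norm_zeta_ge[of 2] show False by simp
  qed
  moreover have "integral {T..T + h} (\<lambda>t. cmod (zeta (Complex \<sigma> t))) \<ge> \<Phi> w0"
    if "16 \<le> T" "T \<le> T1" "1/2 \<le> \<sigma>" "\<sigma> \<le> b" for T \<sigma>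
  proof -
    have "Complex \<sigma> T \<in> R" using that by (auto simp: R_def in_cbox_complex_iff)
    then have "\<Phi> w0 \<le> \<Phi> (Complex \<sigma> T)" by (rule w0(2))
    also have "\<Phi> (Complex \<sigma> T) = integral {0..h} ((\<lambda>t. cmod (zeta (Complex \<sigma> t))) \<circ> (\<lambda>u. u + T))"
    proof -
      have "Complex \<sigma> T + \<i> * of_real u = Complex \<sigma> (u + T)" for u by (simp add: complex_eq_iff)
      then show ?thesis by (simp add: \<Phi>_def o_def)
    qed
    also have "\<dots> = integral {0 + T..h + T} (\<lambda>t. cmod (zeta (Complex \<sigma> t)))"
      by (rule integral_shift) (use that in \<open>auto intro!: norm_zeta_vertical_continuous\<close>)
    also have "{0 + T..h + T} = {T..T + h}" by (simp add: add.commute)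
    finally show ?thesis .
  qed
  ultimately show ?thesis using that by blast
next
  case False
  then show ?thesis using that[of 1] by fastforce
qed

lemma integral_norm_zeta_ge_bounded_height:
  assumes C: "C > 0" and T1: "T1 > 0"
  obtains c where "c > 0"
    "\<And>T H \<sigma>. 16 \<le> T \<Longrightarrow> H > 0 \<Longrightarrow> T + H \<le> T1 \<Longrightarrow> 1/2 \<le> \<sigma> \<Longrightarrow> 1 - C * H \<le> \<sigma> \<Longrightarrow>
       integral {T..T + H} (\<lambda>t. cmod (zeta (Complex \<sigma> t))) \<ge> c * (H * min H 1)"
proof -
  obtain r c0 where r: "r > 0" and c0: "c0 > 0"
    and loc: "\<And>t. 16 \<le> t \<Longrightarrow> t \<le> T1 \<Longrightarrow> \<exists>s1. \<forall>s\<in>ball (Complex 1 t) r. cmod (zeta s) \<ge> c0 * cmod (s - s1)"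
    using norm_zeta_ge_dist[of T1] by metis
  \<comment> \<open>For \<open>H \<le> h0\<close> this gives \<open>C * H + H \<le> r / 3\<close>;
    together with \<open>\<sigma> \<le> 1 + r / 2\<close> the whole segment then lies within
    \<open>r\<close> of the point \<open>Complex 1 T\<close>.\<close>
  define h0 where "h0 = r / (3 * (C + 1))"
  have h0: "h0 > 0" "(C + 1) * h0 = r / 3" using r C by (auto simp: h0_def field_simps)
  obtain m where m: "m > 0"
    "\<And>T \<sigma>. 16 \<le> T \<Longrightarrow> T \<le> T1 \<Longrightarrow> 1/2 \<le> \<sigma> \<Longrightarrow> \<sigma> \<le> 1 + r / 2 \<Longrightarrow> integral {T..T + h0} (\<lambda>t. cmod (zeta (Complex \<sigma> t))) \<ge> m"
    using integral_norm_zeta_ge_compact[OF h0(1), of T1 "1 + r / 2"] by metis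
  define c1 where "c1 = (r / 2) / (1 + r / 2)"
  have c1: "c1 > 0" using r by (simp add: c1_def add_pos_pos)
  \<comment> \<open>The quotient \<open>m / T1\<close> serves the long segments, where
    \<open>H * min H 1 \<le> H \<le> T1\<close>.\<close>
  define c where "c = min (c0 / 16) (min c1 (m / T1))"
  have c: "c > 0" "c \<le> c0 / 16" "c \<le> c1" "c \<le> m / T1"
    using c0 c1 m(1) T1 unfolding c_def by (simp, linarith+)
  have "integral {T..T + H} (\<lambda>t. cmod (zeta (Complex \<sigma> t))) \<ge> c * (H * min H 1)"
    if T: "16 \<le> T" and H: "H > 0" and TH: "T + H \<le> T1" and \<sigma>: "1/2 \<le> \<sigma>" "1 - C * H \<le> \<sigma>" for T H \<sigma>
  proof -
    define g where "g = (\<lambda>t. cmod (zeta (Complex \<sigma> t)))"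
    have g: "continuous_on {T..T + H} g"
      unfolding g_def by (rule norm_zeta_vertical_continuous) (use T in simp)
    have Hm: "H * min H 1 \<le> H" "H * min H 1 \<le> H\<^sup>2" "H * min H 1 > 0"
      using H by (auto simp: power2_eq_square min_def)
    consider "\<sigma> > 1 + r / 2" | "\<sigma> \<le> 1 + r / 2" "H \<le> h0" | "\<sigma> \<le> 1 + r / 2" "H > h0" by linarith
    then show ?thesis
    proof cases
      case 1
      have "c1 \<le> g t" for t
      proof -
        have "c1 \<le> (\<sigma> - 1) / \<sigma>" using 1 r by (simp add: c1_def field_simps)
        also have "\<dots> \<le> g t" using norm_zeta_ge[of "Complex \<sigma> t"] 1 r by (simp add: g_def)
        finally show ?thesis .
      qed
      then have "integral {T..T + H} g \<ge> c1 * (T + H - T)"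
        using H by (intro integral_ge_on_subinterval[OF g]) (auto simp: g_def)
      moreover have "c * (H * min H 1) \<le> c1 * H" using c Hm by (intro mult_mono) auto
      ultimately show ?thesis by (simp add: g_def)
    next
      case 2
      obtain s1 where s1: "\<forall>s\<in>ball (Complex 1 T) r. cmod (zeta s) \<ge> c0 * cmod (s - s1)"
        using loc[of T] T TH H by auto
      have "g t \<ge> c0 * \<bar>t - Im s1\<bar>" if t: "t \<in> {T..T + H}" for t
      proof -
        have "(C + 1) * H \<le> r / 3" using mult_left_mono[OF 2(2), of "C + 1"] C h0 by simp
        then have "C * H + H \<le> r / 3" by (simp add: algebra_simps)
        moreover have "C * H > 0" using C H by simp
        moreover have "cmod (Complex 1 T - Complex \<sigma> t) \<le> \<bar>1 - \<sigma>\<bar> + \<bar>T - t\<bar>"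
          using cmod_le[of "Complex 1 T - Complex \<sigma> t"] by simp
        ultimately have "Complex \<sigma> t \<in> ball (Complex 1 T) r"
          using t 2 \<sigma> r H by (auto simp: dist_norm abs_if split: if_splits)
        with s1 have "c0 * cmod (Complex \<sigma> t - s1) \<le> g t" by (simp add: g_def)
        moreover have "\<bar>t - Im s1\<bar> \<le> cmod (Complex \<sigma> t - s1)"
          using abs_Im_le_cmod[of "Complex \<sigma> t - s1"] by simp
        ultimately show ?thesis using mult_left_mono[of "\<bar>t - Im s1\<bar>" "cmod (Complex \<sigma> t - s1)" c0] c0 by linarith
      qed
      then have "integral {T..T + H} g \<ge> c0 / 16 * H\<^sup>2"
        using c0 H by (intro integral_ge_of_dist_le[OF g]) auto
      moreover have "c * (H * min H 1) \<le> c0 / 16 * H\<^sup>2" using c c0 Hm by (intro mult_mono) auto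
      ultimately show ?thesis by (simp add: g_def)
    next
      case 3
      have "m \<le> integral {T..T + h0} g"
        unfolding g_def using T TH H \<sigma> 3 by (intro m(2)) auto
      also have "\<dots> \<le> integral {T..T + H} g"
      proof (rule integral_subset_le)
        show "g integrable_on {T..T + H}" using g by (rule integrable_continuous_real)
        show "g integrable_on {T..T + h0}"
          using 3 by (intro integrable_continuous_real continuous_on_subset[OF g]) auto
      qed (use 3 in \<open>auto simp: g_def\<close>)
      also have "c * (H * min H 1) \<le> m"
      proof -
        have "c * (H * min H 1) \<le> m / T1 * T1"
          using c Hm m(1) T1 TH T by (intro mult_mono) auto
        then show ?thesis using T1 by simp
      qed
      finally show ?thesis by (simp add: g_def)
    qed
  qed
  then show ?thesis using that c(1) by blast
qed

section \<open>The main theorem\<close>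

lemma ln_ln_double_le:
  fixes a :: real
  assumes "a > 0"
  shows "\<exists>H0. \<forall>H\<ge>H0. a * (1 + ln (ln (2 * H))) \<le> H"
\<comment> \<open>Since \<open>1 + ln (ln (2 * H)) \<le> ln (2 * H) \<le> 2 * sqrt (2 * H)\<close>,
  it suffices that \<open>2 * a * sqrt (2 * H) \<le> H\<close>; squaring this gives the threshold
  \<open>8 * a\<^sup>2\<close>.\<close>
proof (intro exI[of _ "max 1 (8 * a\<^sup>2)"] allI impI)
  fix H assume "H \<ge> max 1 (8 * a\<^sup>2)"
  then have H: "H \<ge> 1" "H \<ge> 8 * a\<^sup>2" by auto
  have "1 + ln (ln (2 * H)) \<le> ln (2 * H)"
    using ln_le_minus_one[of "ln (2 * H)"] H by simp
  also have "ln (2 * H) = 2 * ln (sqrt (2 * H))" using H by (simp add: ln_sqrt)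
  also have "\<dots> \<le> 2 * sqrt (2 * H)" using ln_bound[of "sqrt (2 * H)"] H by simp
  finally have "a * (1 + ln (ln (2 * H))) \<le> a * (2 * sqrt (2 * H))"
    using assms by (intro mult_left_mono) auto
  also have "\<dots> \<le> H"
  proof (rule power2_le_imp_le)
    have "(a * (2 * sqrt (2 * H)))\<^sup>2 = (8 * a\<^sup>2) * H" using H by (simp add: power_mult_distrib)
    also have "\<dots> \<le> H * H" using H by (intro mult_right_mono) auto
    finally show "(a * (2 * sqrt (2 * H)))\<^sup>2 \<le> H\<^sup>2" by (simp add: power2_eq_square)
  qed (use H in simp)
  finally show "a * (1 + ln (ln (2 * H))) \<le> H" .
qed

lemma integral_norm_zeta_ge_right:
  fixes \<epsilon> C :: real
  assumes \<epsilon>: "\<epsilon> > 0" and C: "C > 0"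
  obtains c where "c > 0"
    "\<And>T H \<sigma>. T > 16 \<Longrightarrow> H > 0 \<Longrightarrow> \<sigma> \<ge> 1/2 \<Longrightarrow> \<sigma> \<ge> 1 - C * H * ln (ln T) powr (-1 - \<epsilon>) \<Longrightarrow>
       integral {T..T + H} (\<lambda>t. cmod (zeta (Complex \<sigma> t))) \<ge> c * min (H powr (2 + \<epsilon>)) H"
proof -
  obtain c1 A where c1: "c1 > 0" and A: "A > 0"
    and main: "\<And>T H \<sigma>. T > 16 \<Longrightarrow> H > 0 \<Longrightarrow> \<sigma> \<ge> 1/2 \<Longrightarrow> A * (1 - \<sigma>) * (1 + ln (ln (T + H))) \<le> H \<Longrightarrow>
       integral {T..T + H} (\<lambda>t. cmod (zeta (Complex \<sigma> t))) \<ge> c1 * min (H powr (2 + \<epsilon>)) H"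
    using integral_norm_zeta_ge[OF \<epsilon>] by metis
  \<comment> \<open>Chosen so that \<open>3 * A * C * y powr (- \<epsilon>) \<le> 1\<close> for
    \<open>y \<ge> Y\<close>: here the \<epsilon> in the hypothesis on \<sigma> absorbs
    \<open>C\<close>.\<close>
  define Y where "Y = max 1 ((3 * A * C) powr (1 / \<epsilon>))"
  define T0 where "T0 = exp (exp Y)"
  obtain H0 where H0: "\<And>H. H \<ge> H0 \<Longrightarrow> A / 2 * (1 + ln (ln (2 * H))) \<le> H"
    using ln_ln_double_le[of "A / 2"] A by auto
  \<comment> \<open>The doubled maximum closes the case distinction: \<open>T \<le> H < H0\<close>
    and \<open>H < T < T0\<close> both force \<open>T + H \<le> T1\<close>.\<close>
  define T1 where "T1 = 2 * max T0 (max H0 1)"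
  have ln16: "ln 16 > (1::real)"
  proof -
    have "exp 1 < (16::real)" using exp_le by linarith
    then show ?thesis using ln_less_cancel_iff[of "exp 1" "16::real"] by simp
  qed
  \<comment> \<open>\<open>ln (ln T)\<close> stays above this positive number, so at bounded heights
    its negative power may be replaced by a constant.\<close>
  define y0 where "y0 = ln (ln (16::real))"
  have y0: "y0 > 0" using ln16 by (simp add: y0_def)
  define C' where "C' = C * y0 powr (-1 - \<epsilon>)"
  have C': "C' > 0" using C y0 by (simp add: C'_def)
  obtain c2 where c2: "c2 > 0"
    and compact: "\<And>T H \<sigma>. 16 \<le> T \<Longrightarrow> H > 0 \<Longrightarrow> T + H \<le> T1 \<Longrightarrow> 1/2 \<le> \<sigma> \<Longrightarrow> 1 - C' * H \<le> \<sigma> \<Longrightarrow>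
       integral {T..T + H} (\<lambda>t. cmod (zeta (Complex \<sigma> t))) \<ge> c2 * (H * min H 1)"
    using integral_norm_zeta_ge_bounded_height[OF C', of T1] by (auto simp: T1_def)
  have "integral {T..T + H} (\<lambda>t. cmod (zeta (Complex \<sigma> t))) \<ge> min c1 c2 * min (H powr (2 + \<epsilon>)) H"
    if T: "T > 16" and H: "H > 0" and \<sigma>: "\<sigma> \<ge> 1/2" "\<sigma> \<ge> 1 - C * H * ln (ln T) powr (-1 - \<epsilon>)" for T H \<sigma>
  proof -
    define I where "I = integral {T..T + H} (\<lambda>t. cmod (zeta (Complex \<sigma> t)))"
    define y where "y = ln (ln T)"
    have lnT: "ln T > 1" using T ln16 by (meson less_trans ln_less_cancel_iff zero_less_numeral)
    have y: "y \<ge> y0" "y > 0"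
      using T ln16 lnT unfolding y_def y0_def by (auto intro!: ln_mono)
    have LTH: "1 + ln (ln (T + H)) > 0"
    proof -
      have "ln T \<le> ln (T + H)" using T H by simp
      then have "ln (ln (T + H)) > 0" using lnT by simp
      then show ?thesis by simp
    qed
    have by_main: ?thesis if "A * (1 - \<sigma>) * (1 + ln (ln (T + H))) \<le> H"
    proof -
      have "min c1 c2 * min (H powr (2 + \<epsilon>)) H \<le> c1 * min (H powr (2 + \<epsilon>)) H"
        using H by (intro mult_right_mono) auto
      then show ?thesis using main[OF T H \<sigma>(1) that] by linarith
    qed
    show ?thesis
    proof (cases "\<sigma> \<ge> 1")
      case True
      then have "A * (1 - \<sigma>) * (1 + ln (ln (T + H))) \<le> 0"
        using A LTH by (simp add: mult_le_0_iff)
      then show ?thesis using H by (intro by_main) linarith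
    next
      case False
      consider "H \<ge> T" "H \<ge> H0" | "H < T" "T \<ge> T0" | "T + H \<le> T1"
        unfolding T1_def by linarith
      then show ?thesis
      proof cases
        case 1
        \<comment> \<open>For \<open>H \<ge> T\<close> the hypothesis on \<sigma> gives little, but
          \<open>\<sigma> \<ge> 1/2\<close> is already enough, since \<open>H\<close> dominates
          \<open>ln (ln (2 * H))\<close>.\<close>
        have "A * (1 - \<sigma>) * (1 + ln (ln (T + H))) \<le> A * (1 / 2) * (1 + ln (ln (2 * H)))"
        proof (intro mult_mono)
          have "ln (T + H) \<le> ln (2 * H)" "ln (T + H) > 0" using 1 T H by auto
          then show "1 + ln (ln (T + H)) \<le> 1 + ln (ln (2 * H))" by simp
        qed (use A \<sigma> False LTH in auto)
        also have "\<dots> \<le> H" using H0[OF 1(2)] by simp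
        finally show ?thesis by (rule by_main)
      next
        case 2
        have yY: "y \<ge> Y"
        proof -
          have "ln T \<ge> exp Y" using 2(2) T by (simp add: T0_def ln_ge_iff)
          then show ?thesis using lnT by (simp add: y_def ln_ge_iff)
        qed
        have "ln (T + H) \<le> ln (T * T)"
        proof -
          have "T + H \<le> 2 * T" using 2 by simp
          also have "\<dots> \<le> T * T" using T by (intro mult_right_mono) auto
          finally show ?thesis using T H by simp
        qed
        also have "ln (T * T) = 2 * ln T" using T by (simp add: ln_mult)
        finally have l2: "ln (T + H) \<le> 2 * ln T" .
        have lTH: "ln (T + H) > 0" using T H by simp
        have "ln (ln (T + H)) \<le> ln (2 * ln T)" using l2 lTH lnT by simp
        also have "\<dots> = ln 2 + y" using lnT by (simp add: ln_mult y_def)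
        also have "\<dots> \<le> 1 + y" using ln_2_less_1 by simp
        \<comment> \<open>The sum is at most \<open>2 + y\<close>, and
          \<open>y \<ge> Y \<ge> 1\<close>; this is the reason for the maximum with 1 in
          \<open>Y\<close>.\<close>
        finally have "1 + ln (ln (T + H)) \<le> 3 * y" using yY by (simp add: Y_def)
        moreover have "1 - \<sigma> \<le> C * H * y powr (-1 - \<epsilon>)" using \<sigma>(2) by (simp add: y_def)
        ultimately have "A * (1 - \<sigma>) * (1 + ln (ln (T + H))) \<le> A * (C * H * y powr (-1 - \<epsilon>)) * (3 * y)"
          using A LTH False C H by (intro mult_mono mult_nonneg_nonneg) auto
        also have "\<dots> = H * (3 * A * C * (y powr (-1 - \<epsilon>) * y powr 1))" using y by simp
        also have "y powr (-1 - \<epsilon>) * y powr 1 = y powr (- \<epsilon>)"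
          by (simp only: powr_add [symmetric]) simp
        also have "H * (3 * A * C * y powr (- \<epsilon>)) \<le> H * 1"
        proof (rule mult_left_mono)
          have "(3 * A * C) powr (1 / \<epsilon>) \<le> y" using yY by (simp add: Y_def)
          then have "((3 * A * C) powr (1 / \<epsilon>)) powr \<epsilon> \<le> y powr \<epsilon>" using \<epsilon> by (intro powr_mono2) auto
          then have "3 * A * C \<le> y powr \<epsilon>" using \<epsilon> A C by (simp add: powr_powr)
          then show "3 * A * C * y powr (- \<epsilon>) \<le> 1" using y by (simp add: powr_minus field_simps)
        qed (use H in simp)
        finally show ?thesis by (intro by_main) simp
      next
        case 3
        have "y powr (-1 - \<epsilon>) \<le> y0 powr (-1 - \<epsilon>)" using y y0 \<epsilon> by (intro powr_mono2') auto
        then have "C * H * y powr (-1 - \<epsilon>) \<le> C * H * y0 powr (-1 - \<epsilon>)" using C H by (intro mult_left_mono) auto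
        then have "1 - C' * H \<le> \<sigma>" using \<sigma>(2) by (simp add: y_def C'_def mult_ac)
        from compact[OF _ H 3 \<sigma>(1) this] T have "c2 * (H * min H 1) \<le> I" by (simp add: I_def)
        moreover have "min (H powr (2 + \<epsilon>)) H \<le> H * min H 1"
        proof (cases "H \<le> 1")
          case True
          then have "H powr (2 + \<epsilon>) \<le> H powr 2" using H \<epsilon> by (intro powr_mono') auto
          then show ?thesis using H True by (simp add: power2_eq_square)
        qed simp
        then have "min c1 c2 * min (H powr (2 + \<epsilon>)) H \<le> c2 * (H * min H 1)"
          using c1 c2 H by (intro mult_mono) auto
        ultimately show ?thesis by (simp add: I_def)
      qed
    qed
  qed
  then show ?thesis using that[of "min c1 c2"] c1 c2 by auto
qed

theorem theorem1:
  fixes \<epsilon> C :: real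
  assumes "\<epsilon> > 0" and "C > 0"
  shows "\<exists>c>0. \<forall>T H \<sigma> :: real.
           T > 16 \<longrightarrow> H > 0 \<longrightarrow> \<sigma> \<ge> 1 - C * H * ln (ln T) powr (-1 - \<epsilon>) \<longrightarrow>
           integral {T..T+H} (\<lambda>t. cmod (zeta (Complex \<sigma> t))) \<ge> c * min (H powr (2 + \<epsilon>)) H"
proof -
  obtain c where c: "c > 0"
    and right: "\<And>T H \<sigma>. T > 16 \<Longrightarrow> H > 0 \<Longrightarrow> \<sigma> \<ge> 1/2 \<Longrightarrow> \<sigma> \<ge> 1 - C * H * ln (ln T) powr (-1 - \<epsilon>) \<Longrightarrow>
       integral {T..T + H} (\<lambda>t. cmod (zeta (Complex \<sigma> t))) \<ge> c * min (H powr (2 + \<epsilon>)) H"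
    using integral_norm_zeta_ge_right[OF assms] by metis
  obtain m where m: "m > 0"
    and refl: "\<And>\<sigma> t. \<sigma> \<le> 1/2 \<Longrightarrow> t \<ge> 1 \<Longrightarrow> cmod (zeta (Complex \<sigma> t)) \<ge> m * cmod (zeta (Complex (1 - \<sigma>) t))"
    using norm_zeta_reflection_ge by metis
  have "integral {T..T + H} (\<lambda>t. cmod (zeta (Complex \<sigma> t))) \<ge> (c * min 1 m) * min (H powr (2 + \<epsilon>)) H"
    if T: "T > 16" and H: "H > 0" and \<sigma>: "\<sigma> \<ge> 1 - C * H * ln (ln T) powr (-1 - \<epsilon>)" for T H \<sigma>
  proof -
    \<comment> \<open>\<tau> is at least 1/2 and at least \<sigma>, so it inherits the hypothesis on
      \<sigma>. On the line with abscissa \<sigma>, zeta is bounded below pointwise by a constant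
      multiple of its modulus at abscissa \<tau> and the same height.\<close>
    define \<tau> where "\<tau> = max \<sigma> (1 - \<sigma>)"
    have cont: "(\<lambda>t. cmod (zeta (Complex x t))) integrable_on {T..T + H}" for x
      by (intro integrable_continuous_real norm_zeta_vertical_continuous) (use T in simp)
    have ge: "cmod (zeta (Complex \<sigma> t)) \<ge> min 1 m * cmod (zeta (Complex \<tau> t))" if t: "t \<in> {T..T + H}" for t
    proof (cases "\<sigma> \<le> 1/2")
      case True
      then have "\<tau> = 1 - \<sigma>" by (simp add: \<tau>_def)
      moreover have "m * cmod (zeta (Complex (1 - \<sigma>) t)) \<le> cmod (zeta (Complex \<sigma> t))"
        using refl[OF True, of t] t T by simp
      moreover have "min 1 m * cmod (zeta (Complex (1 - \<sigma>) t)) \<le> m * cmod (zeta (Complex (1 - \<sigma>) t))"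
        by (intro mult_right_mono) auto
      ultimately show ?thesis by simp
    next
      case False
      then have "\<tau> = \<sigma>" by (simp add: \<tau>_def)
      then show ?thesis using mult_right_mono[of "min 1 m" 1 "cmod (zeta (Complex \<sigma> t))"] by simp
    qed
    have "c * min (H powr (2 + \<epsilon>)) H \<le> integral {T..T + H} (\<lambda>t. cmod (zeta (Complex \<tau> t)))"
      by (rule right[OF T H]) (use \<sigma> in \<open>auto simp: \<tau>_def max_def\<close>)
    then have "min 1 m * (c * min (H powr (2 + \<epsilon>)) H) \<le> min 1 m * integral {T..T + H} (\<lambda>t. cmod (zeta (Complex \<tau> t)))"
      using m by (intro mult_left_mono) auto
    also have "\<dots> = integral {T..T + H} (\<lambda>t. min 1 m * cmod (zeta (Complex \<tau> t)))" by simp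
    also have "\<dots> \<le> integral {T..T + H} (\<lambda>t. cmod (zeta (Complex \<sigma> t)))"
      by (intro integral_le integrable_on_mult_right cont ge)
    finally show ?thesis by (simp add: mult_ac)
  qed
  then show ?thesis using c m by (intro exI[of _ "c * min 1 m"]) auto
qed

end
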